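(* Let $\varphi$ be an admissible inhomogeneous $\mathbf{SG}$-phase function of order $(n,\nu)$ on $\mathbb{R}^d\times\mathbb{R}^s$. Then there exists a map $$I_\varphi:\mathbf{SG}^{\infty,\infty}(\mathbb{R}^d,\mathbb{R}^s)\to\mathcal{S}'(\mathbb{R}^d),$$ uniquely determined by the following properties: (1) $a\mapsto I_\varphi(a)$ is a linear map; (2) if $a\in\mathbf{SG}^{-\infty,-\infty}(\mathbb{R}^d,\mathbb{R}^s)$, then $I_\varphi(a)$ coincides with the absolutely convergent integral $$[I_\varphi(a)](x)=\int_{\mathbb{R}^s}e^{i\varphi(x,\xi)}a(x,\xi)\,d\xi;$$ (3) for each $(m,\mu)\in\mathbb{R}^2$, the restriction of $I_\varphi$ to $\mathbf{SG}^{m,\mu}(\mathbb{R}^d,\mathbb{R}^s)$ is a continuous map $\mathbf{SG}^{m,\mu}(\mathbb{R}^d,\mathbb{R}^s)\to\mathcal{S}'(\mathbb{R}^d)$.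
   Context: $\langle x\rangle=\sqrt{1+|x|^2}$; $f\gtrsim g$ means there is a constant $C>0$ with $f\ge Cg$ on the whole indicated set. $\mathbf{SG}$-symbols: for $(m,\mu)\in\mathbb{R}^2$, $\mathbf{SG}^{m,\mu}(\mathbb{R}^d,\mathbb{R}^s)$ is the space of $a\in C^\infty(\mathbb{R}^d\times\mathbb{R}^s;\mathbb{C})$ such that for all multiindices $\alpha\in\mathbb{Z}_+^d,\beta\in\mathbb{Z}_+^s$ there is $C_{\alpha,\beta}>0$ with $|\partial_x^\alpha\partial_\xi^\beta a(x,\xi)|\le C_{\alpha,\beta}\langle x\rangle^{m-|\alpha|}\langle\xi\rangle^{\mu-|\beta|}$ for all $(x,\xi)$; it carries the Fréchet topology given by the seminorms $\sup_{\gamma\le\alpha,\delta\le\beta}\sup_{x,\xi}|\partial_x^\gamma\partial_\xi^\delta a(x,\xi)|\langle x\rangle^{-m+|\gamma|}\langle\xi\rangle^{-\mu+|\delta|}$. $\mathbf{SG}^{\infty,\infty}=\bigcup_{m,\mu}\mathbf{SG}^{m,\mu}$ and $\mathbf{SG}^{-\infty,-\infty}=\bigcap_{m,\mu}\mathbf{SG}^{m,\mu}=\mathcal{S}(\mathbb{R}^{d+s})$. An admissible inhomogeneous $\mathbf{SG}$-phase function of order $(n,\nu)$, $n,\nu>0$, is a real-valued $\varphi\in\mathbf{SG}^{n,\nu}(\mathbb{R}^d,\mathbb{R}^s)$ for which there is $R>0$ with $\langle x\rangle^2|\nabla_x\varphi(x,\xi)|^2+\langle\xi\rangle^2|\nabla_\xi\varphi(x,\xi)|^2\gtrsim\langle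 x\rangle^{2n}\langle\xi\rangle^{2\nu}$ for $|x|+|\xi|\ge R$. *)

theory Defs
  imports "HOL-Analysis.Analysis"
begin

subsection \<open>Smooth functions and multiindex derivatives\<close>

definition partial ::
  "'v::real_normed_vector \<Rightarrow> ('v \<Rightarrow> 'w::real_normed_vector) \<Rightarrow> 'v \<Rightarrow> 'w" where
  "partial v f = (\<lambda>x. frechet_derivative f (at x) v)"

primrec C_k :: "nat \<Rightarrow> ('v::euclidean_space \<Rightarrow> 'w::real_normed_vector) \<Rightarrow> bool" where
  "C_k 0 f \<longleftrightarrow> continuous_on UNIV f"
| "C_k (Suc k) f \<longleftrightarrow> (\<forall>x. f differentiable (at x)) \<and> (\<forall>v. C_k k (partial v f))"

definition smooth :: "('v::euclidean_space \<Rightarrow> 'w::real_normed_vector) \<Rightarrow> bool" where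
  "smooth f \<longleftrightarrow> (\<forall>k. C_k k f)"

text \<open>
  A multiindex over the coordinates \<open>'i\<close> is a function \<open>\<alpha> :: 'i \<Rightarrow> nat\<close>, and the
  order of multiindices is the pointwise order of functions.  The partial derivatives are
  applied in an arbitrarily fixed order of the coordinates, which is immaterial for smooth
  functions.  The family \<open>e\<close> gives the coordinate directions.
\<close>

definition index_list :: "'i::finite list" where
  "index_list = (SOME is. set is = UNIV \<and> distinct is)"

definition mi_partial ::
  "('i::finite \<Rightarrow> 'v::real_normed_vector) \<Rightarrow> ('i \<Rightarrow> nat) \<Rightarrow>
    ('v \<Rightarrow> 'w::real_normed_vector) \<Rightarrow> 'v \<Rightarrow> 'w" where
  "mi_partial e \<alpha> f = foldr (\<lambda>i. partial (e i) ^^ \<alpha> i) index_list f"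

definition mi_size :: "('i::finite \<Rightarrow> nat) \<Rightarrow> nat" where
  "mi_size \<alpha> = (\<Sum>i\<in>UNIV. \<alpha> i)"

definition deriv_x ::
  "('d::finite \<Rightarrow> nat) \<Rightarrow> ((real^'d) \<times> (real^'s::finite) \<Rightarrow> 'w::real_normed_vector) \<Rightarrow>
    (real^'d) \<times> (real^'s) \<Rightarrow> 'w" where
  "deriv_x = mi_partial (\<lambda>i. (axis i 1, 0))"

definition deriv_xi ::
  "('s::finite \<Rightarrow> nat) \<Rightarrow> ((real^'d::finite) \<times> (real^'s) \<Rightarrow> 'w::real_normed_vector) \<Rightarrow>
    (real^'d) \<times> (real^'s) \<Rightarrow> 'w" where
  "deriv_xi = mi_partial (\<lambda>j. (0, axis j 1))"

definition grad_x ::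
  "((real^'d::finite) \<times> (real^'s::finite) \<Rightarrow> real) \<Rightarrow> (real^'d) \<times> (real^'s) \<Rightarrow> real^'d" where
  "grad_x \<phi> z = (\<chi> i. partial (axis i 1, 0) \<phi> z)"

definition grad_xi ::
  "((real^'d::finite) \<times> (real^'s::finite) \<Rightarrow> real) \<Rightarrow> (real^'d) \<times> (real^'s) \<Rightarrow> real^'s" where
  "grad_xi \<phi> z = (\<chi> j. partial (0, axis j 1) \<phi> z)"

definition jap :: "'v::real_normed_vector \<Rightarrow> real" where
  "jap x = sqrt (1 + (norm x)\<^sup>2)"

subsection \<open>Topologies given by seminorms\<close>

text \<open>
  The locally convex topology on a vector space \<open>V\<close> of complex-valued functions that is
  defined by a set \<open>P\<close> of seminorms.  The set \<open>V\<close> is listed only so that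
  it is the underlying set also when \<open>P\<close> is empty.
\<close>

definition seminorm_topology ::
  "('z \<Rightarrow> complex) set \<Rightarrow> (('z \<Rightarrow> complex) \<Rightarrow> real) set \<Rightarrow> ('z \<Rightarrow> complex) topology" where
  "seminorm_topology V P = topology_generated_by
     (insert V {{g \<in> V. p (\<lambda>z. g z - f z) < \<epsilon>} | p f \<epsilon>. p \<in> P \<and> f \<in> V \<and> 0 < \<epsilon>})"

subsection \<open>SG-symbols and admissible phase functions\<close>

definition SG :: "real \<Rightarrow> real \<Rightarrow> ((real^'d::finite) \<times> (real^'s::finite) \<Rightarrow> complex) set" where
  "SG m \<mu> = {a. smooth a \<and>
     (\<forall>\<alpha> \<beta>. \<exists>C>0. \<forall>x \<xi>. cmod (deriv_x \<alpha> (deriv_xi \<beta> a) (x, \<xi>))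
        \<le> C * jap x powr (m - mi_size \<alpha>) * jap \<xi> powr (\<mu> - mi_size \<beta>))}"

definition SG_seminorm ::
  "real \<Rightarrow> real \<Rightarrow> ('d \<Rightarrow> nat) \<Rightarrow> ('s \<Rightarrow> nat) \<Rightarrow>
    ((real^'d::finite) \<times> (real^'s::finite) \<Rightarrow> complex) \<Rightarrow> real" where
  "SG_seminorm m \<mu> \<alpha> \<beta> a =
     (SUP (\<gamma>, \<delta>) \<in> {..\<alpha>} \<times> {..\<beta>}. SUP (x, \<xi>).
        cmod (deriv_x \<gamma> (deriv_xi \<delta> a) (x, \<xi>))
          * jap x powr (- m + mi_size \<gamma>) * jap \<xi> powr (- \<mu> + mi_size \<delta>))"

definition SG_topology ::
  "real \<Rightarrow> real \<Rightarrow> ((real^'d::finite) \<times> (real^'s::finite) \<Rightarrow> complex) topology" where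
  "SG_topology m \<mu> = seminorm_topology (SG m \<mu>) {SG_seminorm m \<mu> \<alpha> \<beta> | \<alpha> \<beta>. True}"

definition SG_pinf :: "((real^'d::finite) \<times> (real^'s::finite) \<Rightarrow> complex) set" where
  "SG_pinf = (\<Union>m. \<Union>\<mu>. SG m \<mu>)"

definition SG_minf :: "((real^'d::finite) \<times> (real^'s::finite) \<Rightarrow> complex) set" where
  "SG_minf = (\<Inter>m. \<Inter>\<mu>. SG m \<mu>)"

definition admissible_phase ::
  "real \<Rightarrow> real \<Rightarrow> ((real^'d::finite) \<times> (real^'s::finite) \<Rightarrow> real) \<Rightarrow> bool" where
  "admissible_phase n \<nu> \<phi> \<longleftrightarrow> n > 0 \<and> \<nu> > 0 \<and> (\<lambda>z. complex_of_real (\<phi> z)) \<in> SG n \<nu> \<and>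
     (\<exists>R>0. \<exists>C>0. \<forall>x \<xi>. norm x + norm \<xi> \<ge> R \<longrightarrow>
        (jap x)\<^sup>2 * (norm (grad_x \<phi> (x, \<xi>)))\<^sup>2 + (jap \<xi>)\<^sup>2 * (norm (grad_xi \<phi> (x, \<xi>)))\<^sup>2
          \<ge> C * (jap x powr (2 * n) * jap \<xi> powr (2 * \<nu>)))"

subsection \<open>Schwartz functions and tempered distributions\<close>

definition schwartz :: "(real^'d::finite \<Rightarrow> complex) set" where
  "schwartz = {f. smooth f \<and>
     (\<forall>k \<alpha>. \<exists>C. \<forall>x. jap x ^ k * cmod (mi_partial (\<lambda>i. axis i 1) \<alpha> f x) \<le> C)}"

definition schwartz_seminorm ::
  "nat \<Rightarrow> ('d \<Rightarrow> nat) \<Rightarrow> (real^'d::finite \<Rightarrow> complex) \<Rightarrow> real" where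
  "schwartz_seminorm k \<alpha> f = (SUP x. jap x ^ k * cmod (mi_partial (\<lambda>i. axis i 1) \<alpha> f x))"

definition schwartz_topology :: "(real^'d::finite \<Rightarrow> complex) topology" where
  "schwartz_topology = seminorm_topology schwartz {schwartz_seminorm k \<alpha> | k \<alpha>. True}"

definition schwartz_bounded :: "(real^'d::finite \<Rightarrow> complex) set \<Rightarrow> bool" where
  "schwartz_bounded B \<longleftrightarrow> B \<subseteq> schwartz \<and> (\<forall>k \<alpha>. \<exists>C. \<forall>f\<in>B. schwartz_seminorm k \<alpha> f \<le> C)"

text \<open>
  A functional on the Schwartz space is represented by a function on all of
  \<open>real^'d \<Rightarrow> complex\<close> that is \<open>undefined\<close> outside \<open>schwartz\<close>, so that equal
  distributions are equal functions.
\<close>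

definition tempered :: "((real^'d::finite \<Rightarrow> complex) \<Rightarrow> complex) set" where
  "tempered = {u \<in> extensional schwartz.
     (\<forall>f\<in>schwartz. \<forall>g\<in>schwartz. u (\<lambda>x. f x + g x) = u f + u g) \<and>
     (\<forall>c. \<forall>f\<in>schwartz. u (\<lambda>x. c * f x) = c * u f) \<and>
     continuous_map schwartz_topology euclidean u}"

text \<open>
  The two usual topologies on the space of tempered distributions: pointwise convergence, and
  uniform convergence on the bounded subsets of the Schwartz space.
\<close>

definition tempered_weak_topology :: "((real^'d::finite \<Rightarrow> complex) \<Rightarrow> complex) topology" where
  "tempered_weak_topology = seminorm_topology tempered {\<lambda>u. cmod (u f) | f. f \<in> schwartz}"

definition tempered_strong_topology :: "((real^'d::finite \<Rightarrow> complex) \<Rightarrow> complex) topology" where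
  "tempered_strong_topology = seminorm_topology tempered
     {\<lambda>u. (SUP f\<in>B. cmod (u f)) | B. schwartz_bounded B \<and> B \<noteq> {}}"

end

theory Submission
  imports Defs
begin

text \<open>
The idea is Hoermander's.  Where the gradient of \<open>\<phi>\<close> is large, the exponential \<open>e\<^sup>i\<^sup>\<phi>\<close> oscillates, and
integration by parts converts oscillation into decay.  Let \<open>W\<^sub>\<iota>\<close> be \<open>\<langle>x\<rangle>\<^sup>2\<close> for a coordinate of \<open>x\<close> and \<open>\<langle>\<xi>\<rangle>\<^sup>2\<close>
for a coordinate of \<open>\<xi>\<close>, and put \<open>\<psi> = 1 + \<Sum> W\<^sub>\<iota> (\<partial>\<^sub>\<iota> \<phi>)\<^sup>2\<close>.  Admissibility makes \<open>\<psi>\<close> an elliptic symbol of order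
\<open>(2 n, 2 \<nu>)\<close>, so its reciprocal is a symbol of the opposite order (\<open>SG_inverse\<close>).  The first-order
operator \<open>\<psi>\<^sup>-\<^sup>1 - i \<Sum> \<psi>\<^sup>-\<^sup>1 W\<^sub>\<iota> (\<partial>\<^sub>\<iota> \<phi>) \<partial>\<^sub>\<iota>\<close> reproduces \<open>e\<^sup>i\<^sup>\<phi>\<close>, and its transpose maps symbols of order \<open>(m, \<mu>)\<close> to
symbols of order \<open>(m - n, \<mu> - \<nu>)\<close> (\<open>parts_op_symbol_bound\<close>), while it leaves the integral against \<open>e\<^sup>i\<^sup>\<phi>\<close>
unchanged if the symbol decays rapidly (\<open>osc_integral_parts_op\<close>).  As \<open>n\<close> and \<open>\<nu>\<close> are positive, some power
of it maps symbols of order \<open>(m, \<mu>)\<close> to absolutely integrable ones.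

For a test function \<open>f\<close> the product \<open>a(x, \<xi>) f(x)\<close> is a symbol on the whole phase space.  Hence it
suffices to define the integral of \<open>e\<^sup>i\<^sup>\<phi> b\<close> over both variables for a symbol \<open>b\<close>.  This is done by
regularising \<open>b\<close> with \<open>exp (- \<epsilon> \<langle>x\<rangle>\<^sup>2 \<langle>\<xi>\<rangle>\<^sup>2)\<close> and letting \<open>\<epsilon> \<rightarrow> 0\<close>.  The regularised symbols are rapidly
decreasing and converge to \<open>b\<close> with an error \<open>O(\<epsilon>)\<close> in the symbols of order \<open>(m + 2, \<mu> + 2)\<close>; after enough
integrations by parts the limit becomes an absolutely convergent integral
(\<open>regularised_integral_tendsto\<close>).  The limit does not mention how many there were, so linearity is
immediate, and it agrees with the ordinary integral for rapidly decreasing symbols.  All estimates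
carry explicit constants, which yields one bound by a product of a symbol seminorm and a Schwartz
norm (\<open>osc_distribution_bound\<close>) and with it temperedness and continuity in both topologies.

Uniqueness follows from the same regularisation: it shows that rapidly decreasing symbols approximate
each symbol in a topology of higher order, and there two continuous maps that agree on them
coincide (\<open>continuous_extension_unique\<close>).
\<close>

section \<open>Smooth functions\<close>

lemma partial_eq: "(f has_derivative f') (at x) \<Longrightarrow> partial v f x = f' v"
  unfolding partial_def using frechet_derivative_at by metis

lemma differentiable_has_partial:
  "f differentiable (at x) \<Longrightarrow> (f has_derivative (\<lambda>v. partial v f x)) (at x)"
  unfolding partial_def by (simp add: frechet_derivative_works)

lemma C_k_Suc_imp: "C_k (Suc k) f \<Longrightarrow> C_k k f"
proof (induction k arbitrary: f)
  case 0
  then show ?case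
    by (auto intro!: continuous_at_imp_continuous_on differentiable_imp_continuous_within)
next
  case (Suc k)
  then show ?case by (metis C_k.simps(2))
qed

lemma smooth_differentiable: "smooth f \<Longrightarrow> f differentiable (at x)"
  unfolding smooth_def by (metis C_k.simps(2))

lemma smooth_partial: "smooth f \<Longrightarrow> smooth (partial v f)"
  unfolding smooth_def by (metis C_k.simps(2))

lemma smooth_continuous: "smooth f \<Longrightarrow> continuous_on UNIV f"
  unfolding smooth_def by (metis C_k.simps(1))

lemma smooth_has_derivative:
  "smooth f \<Longrightarrow> (f has_derivative (\<lambda>v. partial v f x)) (at x)"
  by (simp add: differentiable_has_partial smooth_differentiable)

lemma partial_const: "partial v (\<lambda>x. c) = (\<lambda>x. 0)"
  by (intro ext partial_eq) (auto intro: derivative_eq_intros)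

lemma partial_add:
  "(\<And>x. f differentiable (at x)) \<Longrightarrow> (\<And>x. g differentiable (at x)) \<Longrightarrow>
    partial v (\<lambda>x. f x + g x) = (\<lambda>x. partial v f x + partial v g x)"
  by (intro ext partial_eq[where f' = "\<lambda>v. partial v f x + partial v g x" for x])
    (auto intro!: derivative_eq_intros differentiable_has_partial)

lemma partial_mult:
  fixes f g :: "'v::euclidean_space \<Rightarrow> 'w::real_normed_algebra"
  shows "(\<And>x. f differentiable (at x)) \<Longrightarrow> (\<And>x. g differentiable (at x)) \<Longrightarrow>
    partial v (\<lambda>x. f x * g x) = (\<lambda>x. partial v f x * g x + f x * partial v g x)"
  by (intro ext partial_eq[where f' = "\<lambda>v. partial v f x * g x + f x * partial v g x" for x])
    (auto intro!: derivative_eq_intros differentiable_has_partial)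

lemma partial_linear_comp:
  assumes "bounded_linear L" and "\<And>x. f differentiable (at x)"
  shows "partial v (\<lambda>x. L (f x)) = (\<lambda>x. L (partial v f x))"
  by (intro ext partial_eq[where f' = "\<lambda>v. L (partial v f x)" for x]
      bounded_linear.has_derivative[OF assms(1)] differentiable_has_partial assms(2))

lemma partial_comp_linear:
  assumes "bounded_linear L" and "\<And>x. f differentiable (at x)"
  shows "partial v (\<lambda>x. f (L x)) = (\<lambda>x. partial (L v) f (L x))"
proof (intro ext partial_eq[where f' = "\<lambda>v. partial (L v) f (L x)" for x])
  fix x
  show "((\<lambda>x. f (L x)) has_derivative (\<lambda>v. partial (L v) f (L x))) (at x)"
    using has_derivative_compose[OF bounded_linear_imp_has_derivative[OF assms(1)]
        differentiable_has_partial[OF assms(2)]] by simp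
qed

lemma partial_bounded_linear: "bounded_linear L \<Longrightarrow> partial v L = (\<lambda>x. L v)"
  by (intro ext partial_eq) (auto intro: bounded_linear_imp_has_derivative)

text \<open>The classes \<open>C_k\<close> are defined by recursion on the derivatives, so each closure property below is
an induction on \<open>k\<close> whose step is the differentiation rule of the operation in question.\<close>

lemma C_k_const: "C_k k (\<lambda>x. c)"
  by (induction k arbitrary: c) (simp_all add: partial_const)

lemma C_k_add: "C_k k f \<Longrightarrow> C_k k g \<Longrightarrow> C_k k (\<lambda>x. f x + g x)"
  by (induction k arbitrary: f g) (auto simp: partial_add intro: continuous_on_add)

lemma C_k_mult:
  fixes f g :: "'v::euclidean_space \<Rightarrow> 'w::real_normed_algebra"
  shows "C_k k f \<Longrightarrow> C_k k g \<Longrightarrow> C_k k (\<lambda>x. f x * g x)"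
proof (induction k arbitrary: f g)
  case 0
  then show ?case by (auto intro: continuous_on_mult)
next
  case (Suc k)
  have "C_k k f" "C_k k g"
    using Suc.prems by (auto intro: C_k_Suc_imp)
  with Suc show ?case by (auto simp: partial_mult intro!: C_k_add)
qed

lemma C_k_linear_comp:
  "bounded_linear L \<Longrightarrow> C_k k f \<Longrightarrow> C_k k (\<lambda>x. L (f x))"
proof (induction k arbitrary: f)
  case 0
  then show ?case by (auto intro: bounded_linear.continuous_on)
next
  case (Suc k)
  have "(\<lambda>x. L (f x)) differentiable (at x)" for x
    using Suc.prems
      bounded_linear.has_derivative[OF Suc.prems(1) differentiable_has_partial[of f x]]
    by (auto intro: differentiableI)
  with Suc show ?case by (auto simp: partial_linear_comp)
qed

lemma C_k_comp_linear:
  "bounded_linear L \<Longrightarrow> C_k k f \<Longrightarrow> C_k k (\<lambda>x. f (L x))"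
proof (induction k arbitrary: f)
  case 0
  then show ?case
    using continuous_on_compose2[of UNIV f UNIV L] linear_continuous_on[of L] by simp
next
  case (Suc k)
  have "(\<lambda>x. f (L x)) differentiable (at x)" for x
    using has_derivative_compose[OF bounded_linear_imp_has_derivative[OF Suc.prems(1)]
        differentiable_has_partial[of f "L x"]] Suc.prems by (auto intro: differentiableI)
  with Suc show ?case by (auto simp: partial_comp_linear)
qed

lemma smooth_const [intro]: "smooth (\<lambda>x. c)"
  by (simp add: smooth_def C_k_const)

lemma smooth_add [intro]: "smooth f \<Longrightarrow> smooth g \<Longrightarrow> smooth (\<lambda>x. f x + g x)"
  by (simp add: smooth_def C_k_add)

lemma smooth_mult [intro]:
  fixes f g :: "'v::euclidean_space \<Rightarrow> 'w::real_normed_algebra"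
  shows "smooth f \<Longrightarrow> smooth g \<Longrightarrow> smooth (\<lambda>x. f x * g x)"
  by (simp add: smooth_def C_k_mult)

lemma smooth_linear_comp: "bounded_linear L \<Longrightarrow> smooth f \<Longrightarrow> smooth (\<lambda>x. L (f x))"
  by (simp add: smooth_def C_k_linear_comp)

lemma smooth_comp_linear: "bounded_linear L \<Longrightarrow> smooth f \<Longrightarrow> smooth (\<lambda>x. f (L x))"
  by (simp add: smooth_def C_k_comp_linear)

lemma smooth_sum [intro]:
  "finite A \<Longrightarrow> (\<And>i. i \<in> A \<Longrightarrow> smooth (f i)) \<Longrightarrow> smooth (\<lambda>x. \<Sum>i\<in>A. f i x)"
  by (induction A rule: finite_induct) auto

lemma smooth_bounded_linear: "bounded_linear L \<Longrightarrow> smooth L"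
proof -
  assume L: "bounded_linear L"
  have "C_k k L" for k
    using L by (cases k) (auto simp: partial_bounded_linear C_k_const
        intro: bounded_linear_imp_differentiable bounded_linear.continuous_on[OF _ continuous_on_id])
  then show ?thesis by (simp add: smooth_def)
qed

lemma exp_comp_has_derivative:
  fixes f :: "'v::euclidean_space \<Rightarrow> complex"
  assumes "f differentiable (at x)"
  shows "((\<lambda>x. exp (f x)) has_derivative (\<lambda>v. partial v f x * exp (f x))) (at x)"
proof -
  have "(exp has_derivative (\<lambda>h. h * exp (f x))) (at (f x))"
    using DERIV_exp[of "f x"]
    by (simp add: has_field_derivative_def mult.commute[of _ "exp (f x)"])
  from has_derivative_compose[OF differentiable_has_partial[OF assms] this] show ?thesis .
qed

lemma partial_exp:
  fixes f :: "'v::euclidean_space \<Rightarrow> complex"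
  assumes "\<And>x. f differentiable (at x)"
  shows "partial v (\<lambda>x. exp (f x)) = (\<lambda>x. partial v f x * exp (f x))"
  by (intro ext partial_eq[where f' = "\<lambda>v. partial v f x * exp (f x)" for x]
      exp_comp_has_derivative assms)

lemma smooth_exp [intro]:
  fixes f :: "'v::euclidean_space \<Rightarrow> complex"
  assumes "smooth f"
  shows "smooth (\<lambda>x. exp (f x))"
proof -
  have "C_k k (\<lambda>x. exp (f x))" for k
  proof (induction k)
    case 0
    show ?case unfolding C_k.simps by (intro continuous_on_exp smooth_continuous assms)
  next
    case (Suc k)
    have "C_k k (partial v f)" for v
      using smooth_partial[OF assms] by (simp add: smooth_def)
    then show ?case
      using Suc exp_comp_has_derivative[OF smooth_differentiable[OF assms]]
      by (auto simp: partial_exp[OF smooth_differentiable[OF assms]] intro!: C_k_mult differentiableI)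
  qed
  then show ?thesis by (simp add: smooth_def)
qed

lemma inverse_comp_has_derivative:
  fixes f :: "'v::euclidean_space \<Rightarrow> complex"
  assumes "f differentiable (at x)" and "f x \<noteq> 0"
  shows "((\<lambda>x. inverse (f x)) has_derivative
    (\<lambda>v. - (partial v f x * (inverse (f x) * inverse (f x))))) (at x)"
  using Deriv.has_derivative_inverse[OF assms(2) differentiable_has_partial[OF assms(1)]]
  by (simp add: mult_ac)

lemma partial_inverse:
  fixes f :: "'v::euclidean_space \<Rightarrow> complex"
  assumes "\<And>x. f differentiable (at x)" and "\<And>x. f x \<noteq> 0"
  shows "partial v (\<lambda>x. inverse (f x)) =
    (\<lambda>x. -1 * (partial v f x * (inverse (f x) * inverse (f x))))"
  using partial_eq[OF inverse_comp_has_derivative[OF assms], of v] by auto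

lemma smooth_inverse [intro]:
  fixes f :: "'v::euclidean_space \<Rightarrow> complex"
  assumes "smooth f" and "\<And>x. f x \<noteq> 0"
  shows "smooth (\<lambda>x. inverse (f x))"
proof -
  have "C_k k (\<lambda>x. inverse (f x))" for k
  proof (induction k)
    case 0
    show ?case unfolding C_k.simps
      by (intro continuous_on_inverse smooth_continuous ballI assms)
  next
    case (Suc k)
    have "C_k k (partial v f)" for v
      using smooth_partial[OF assms(1)] by (simp add: smooth_def)
    then have "C_k k (\<lambda>x. -1 * (partial v f x * (inverse (f x) * inverse (f x))))" for v
      by (intro C_k_mult C_k_const Suc)
    then show ?case
      using inverse_comp_has_derivative[OF smooth_differentiable[OF assms(1)] assms(2)]
      by (auto simp: partial_inverse[OF smooth_differentiable[OF assms(1)] assms(2)]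
          simp del: mult_minus1 intro!: differentiableI)
  qed
  then show ?thesis by (simp add: smooth_def)
qed

section \<open>Symmetry of mixed partial derivatives\<close>

text \<open>The second difference of \<open>f\<close> on the parallelogram spanned by \<open>h u\<close> and \<open>h v\<close> is the increment over
\<open>[0, h]\<close> of \<open>s \<mapsto> f (z + h v + s u) - f (z + s u)\<close>.  The mean value theorem in \<open>s\<close>, and then in the
direction \<open>v\<close>, turns it into a value of \<open>\<partial>\<^sub>v \<partial>\<^sub>u f\<close> at a point of the parallelogram.\<close>

lemma second_difference_mvt:
  fixes f :: "'v::euclidean_space \<Rightarrow> real"
  assumes f: "\<And>x. f differentiable (at x)" and fu: "\<And>x. partial u f differentiable (at x)"
    and h: "h > 0"
  shows "\<exists>s t. 0 < s \<and> s < h \<and> 0 < t \<and> t < h \<and>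
    f (z + h *\<^sub>R u + h *\<^sub>R v) - f (z + h *\<^sub>R u) - f (z + h *\<^sub>R v) + f z =
      h * h * partial v (partial u f) (z + s *\<^sub>R u + t *\<^sub>R v)"
proof -
  have line: "((\<lambda>s. g (y + s *\<^sub>R w)) has_real_derivative partial w g (y + s *\<^sub>R w)) (at s)"
    if "\<And>x. g differentiable (at x)" for g :: "'v \<Rightarrow> real" and y w s
  proof -
    have "((\<lambda>s. y + s *\<^sub>R w) has_derivative (\<lambda>h. h *\<^sub>R w)) (at s)"
      by (auto intro!: derivative_eq_intros)
    from has_derivative_compose[OF this differentiable_has_partial[OF that]]
    have d: "((\<lambda>s. g (y + s *\<^sub>R w)) has_derivative (\<lambda>h. partial (h *\<^sub>R w) g (y + s *\<^sub>R w))) (at s)" .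
    have "partial (h *\<^sub>R w) g (y + s *\<^sub>R w) = h * partial w g (y + s *\<^sub>R w)" for h
      using linear_cmul[OF has_derivative_linear[OF differentiable_has_partial[OF that]]] by simp
    with d show ?thesis
      by (simp add: has_field_derivative_def mult.commute[of _ "partial w g _"])
  qed
  define F where "F s = f ((z + h *\<^sub>R v) + s *\<^sub>R u) - f (z + s *\<^sub>R u)" for s
  have "(F has_real_derivative partial u f ((z + h *\<^sub>R v) + s *\<^sub>R u) - partial u f (z + s *\<^sub>R u)) (at s)" for s
    unfolding F_def by (intro DERIV_diff line f)
  from MVT2[OF h this] obtain s where s: "0 < s" "s < h"
    and 1: "F h - F 0 = h * (partial u f ((z + h *\<^sub>R v) + s *\<^sub>R u) - partial u f (z + s *\<^sub>R u))"
    by auto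
  have "((\<lambda>t. partial u f ((z + s *\<^sub>R u) + t *\<^sub>R v)) has_real_derivative
      partial v (partial u f) ((z + s *\<^sub>R u) + t *\<^sub>R v)) (at t)" for t
    by (intro line fu)
  from MVT2[OF h this] obtain t where t: "0 < t" "t < h"
    and 2: "partial u f ((z + s *\<^sub>R u) + h *\<^sub>R v) - partial u f ((z + s *\<^sub>R u) + 0 *\<^sub>R v) =
      h * partial v (partial u f) ((z + s *\<^sub>R u) + t *\<^sub>R v)"
    by auto
  have "F h - F 0 = h * (h * partial v (partial u f) ((z + s *\<^sub>R u) + t *\<^sub>R v))"
    using 1 2 by (simp add: algebra_simps)
  with s t show ?thesis
    by (intro exI[of _ s] exI[of _ t]) (auto simp: F_def algebra_simps)
qed

text \<open>The left-hand side is symmetric in \<open>u\<close> and \<open>v\<close> and the limit is not visibly so; this is where the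
symmetry of mixed derivatives comes from.\<close>

lemma mixed_partials_limit:
  fixes f :: "'v::euclidean_space \<Rightarrow> real"
  assumes f: "smooth f"
  shows "(\<lambda>j. (f (z + inverse (Suc j) *\<^sub>R u + inverse (Suc j) *\<^sub>R v)
      - f (z + inverse (Suc j) *\<^sub>R u) - f (z + inverse (Suc j) *\<^sub>R v) + f z)
      / (inverse (Suc j) * inverse (Suc j))) \<longlonglongrightarrow> partial v (partial u f) z"
proof -
  let ?h = "\<lambda>j. inverse (real (Suc j))"
  have "\<forall>j. \<exists>s t. 0 < s \<and> s < ?h j \<and> 0 < t \<and> t < ?h j \<and>
    f (z + ?h j *\<^sub>R u + ?h j *\<^sub>R v) - f (z + ?h j *\<^sub>R u) - f (z + ?h j *\<^sub>R v) + f z =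
      ?h j * ?h j * partial v (partial u f) (z + s *\<^sub>R u + t *\<^sub>R v)"
    by (intro allI second_difference_mvt) (auto intro: smooth_differentiable smooth_partial f)
  then obtain s t where st: "\<And>j. 0 < s j \<and> s j < ?h j \<and> 0 < t j \<and> t j < ?h j \<and>
    f (z + ?h j *\<^sub>R u + ?h j *\<^sub>R v) - f (z + ?h j *\<^sub>R u) - f (z + ?h j *\<^sub>R v) + f z =
      ?h j * ?h j * partial v (partial u f) (z + s j *\<^sub>R u + t j *\<^sub>R v)"
    by metis
  have "s \<longlonglongrightarrow> 0" "t \<longlonglongrightarrow> 0"
    using st by (auto intro!: tendsto_sandwich[OF _ _ tendsto_const LIMSEQ_inverse_real_of_nat]
        always_eventually less_imp_le)
  then have "(\<lambda>j. z + s j *\<^sub>R u + t j *\<^sub>R v) \<longlonglongrightarrow> z + 0 *\<^sub>R u + 0 *\<^sub>R v"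
    by (intro tendsto_intros)
  moreover have "isCont (partial v (partial u f)) z"
    using smooth_continuous[OF smooth_partial[OF smooth_partial[OF f]]]
    by (simp add: continuous_on_eq_continuous_at)
  ultimately have "(\<lambda>j. partial v (partial u f) (z + s j *\<^sub>R u + t j *\<^sub>R v))
      \<longlonglongrightarrow> partial v (partial u f) z"
    by (auto intro: isCont_tendsto_compose)
  moreover have "(\<lambda>j. partial v (partial u f) (z + s j *\<^sub>R u + t j *\<^sub>R v)) =
     (\<lambda>j. (f (z + ?h j *\<^sub>R u + ?h j *\<^sub>R v)
      - f (z + ?h j *\<^sub>R u) - f (z + ?h j *\<^sub>R v) + f z) / (?h j * ?h j))"
  proof
    fix j
    have "?h j * ?h j \<noteq> 0" by simp
    then show "partial v (partial u f) (z + s j *\<^sub>R u + t j *\<^sub>R v) =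
      (f (z + ?h j *\<^sub>R u + ?h j *\<^sub>R v)
      - f (z + ?h j *\<^sub>R u) - f (z + ?h j *\<^sub>R v) + f z) / (?h j * ?h j)"
      using st[of j] by (metis nonzero_mult_div_cancel_left)
  qed
  ultimately show ?thesis by simp
qed

lemma partial_commute_real:
  fixes f :: "'v::euclidean_space \<Rightarrow> real"
  assumes "smooth f"
  shows "partial u (partial v f) = partial v (partial u f)"
proof
  fix z
  show "partial u (partial v f) z = partial v (partial u f) z"
    using mixed_partials_limit[OF assms, of z u v] mixed_partials_limit[OF assms, of z v u]
    by (intro LIMSEQ_unique) (simp_all add: algebra_simps)
qed

lemma partial_commute:
  fixes f :: "'v::euclidean_space \<Rightarrow> complex"
  assumes f: "smooth f"
  shows "partial u (partial v f) = partial v (partial u f)"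
proof
  have L: "L (partial u (partial v f) z) = L (partial v (partial u f) z)"
    if L: "bounded_linear L" for L :: "complex \<Rightarrow> real" and z
  proof -
    have "partial u (partial v (\<lambda>z. L (f z))) = (\<lambda>z. L (partial u (partial v f) z))" for u v
      by (simp add: partial_linear_comp[OF L] smooth_differentiable f smooth_partial)
    then show ?thesis
      using partial_commute_real[OF smooth_linear_comp[OF L f], of u v] by metis
  qed
  show "partial u (partial v f) z = partial v (partial u f) z" for z
    using L[OF bounded_linear_Re] L[OF bounded_linear_Im] by (simp add: complex_eq_iff)
qed

section \<open>Symbol estimates along words of derivatives\<close>

text \<open>
The multiindex derivatives that define symbols apply the coordinate derivatives in a fixed
order.  Inductions that differentiate once more are simpler over arbitrary words of coordinate
derivatives.  Because derivatives of smooth functions commute, a word acts like the multiindex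
that counts its letters, so both descriptions give the same estimates.
\<close>

(* Estimates concern a point z of the phase space, which should not be split into a pair. *)
declare split_paired_All [simp del] split_paired_Ex [simp del]

definition iter_partial ::
  "('i \<Rightarrow> 'v::real_normed_vector) \<Rightarrow> 'i list \<Rightarrow> ('v \<Rightarrow> 'w::real_normed_vector) \<Rightarrow> 'v \<Rightarrow> 'w" where
  "iter_partial e ws = fold (\<lambda>i. partial (e i)) ws"

lemma iter_partial_simps [simp]:
  "iter_partial e [] f = f"
  "iter_partial e (i # ws) f = iter_partial e ws (partial (e i) f)"
  by (simp_all add: iter_partial_def)

lemma iter_partial_append: "iter_partial e (us @ ws) f = iter_partial e ws (iter_partial e us f)"
  by (simp add: iter_partial_def)

lemma iter_partial_map: "iter_partial e (map g ws) f = iter_partial (e \<circ> g) ws f"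
  by (simp add: iter_partial_def fold_map comp_def)

text \<open>Partial derivatives commute on smooth functions only.  Replacing each derivative by the identity
outside the smooth functions gives operators that commute everywhere, to which the permutation
invariance of folds applies.\<close>

lemma iter_partial_perm:
  fixes f :: "'v::euclidean_space \<Rightarrow> complex"
  assumes f: "smooth f" and eq: "mset us = mset ws"
  shows "iter_partial e us f = iter_partial e ws f"
proof -
  let ?D = "\<lambda>i (g :: 'v \<Rightarrow> complex). if smooth g then partial (e i) g else g"
  have D: "iter_partial e vs f = fold ?D vs f" for vs
    using f by (induction vs arbitrary: f) (auto simp: smooth_partial)
  have "fold ?D us = fold ?D ws"
    by (rule fold_multiset_equiv[OF _ eq]) (auto simp: smooth_partial partial_commute intro!: ext)
  then show ?thesis by (simp add: D)
qed

definition mi_word :: "('i::finite \<Rightarrow> nat) \<Rightarrow> 'i list" where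
  "mi_word \<alpha> = rev (concat (map (\<lambda>i. replicate (\<alpha> i) i) index_list))"

lemma index_list: "set (index_list :: 'i::finite list) = UNIV" "distinct (index_list :: 'i list)"
proof -
  have "\<exists>is :: 'i list. set is = UNIV \<and> distinct is"
    using finite_distinct_list[OF finite] by auto
  from someI_ex[OF this] show "set (index_list :: 'i list) = UNIV" "distinct (index_list :: 'i list)"
    unfolding index_list_def by auto
qed

lemma mi_partial_eq_iter: "mi_partial e \<alpha> f = iter_partial e (mi_word \<alpha>) f"
proof -
  have "foldr (\<lambda>i. partial (e i) ^^ \<alpha> i) L f =
      fold (\<lambda>i. partial (e i)) (rev (concat (map (\<lambda>i. replicate (\<alpha> i) i) L))) f" for L
    by (induction L) (simp_all add: fold_replicate)
  then show ?thesis by (simp add: mi_partial_def iter_partial_def mi_word_def)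
qed

lemma count_mi_word: "count (mset (mi_word \<alpha>)) i = \<alpha> i"
proof -
  have "count (mset (concat (map (\<lambda>i. replicate (\<alpha> i) i) L))) i = (if i \<in> set L then \<alpha> i else 0)"
    if "distinct L" for L
    using that by (induction L) auto
  from this[OF index_list(2)] show ?thesis by (simp add: mi_word_def index_list)
qed

lemma length_mi_word: "length (mi_word \<alpha>) = mi_size \<alpha>"
proof -
  have "length (mi_word \<alpha>) = sum_list (map \<alpha> index_list)"
    by (simp add: mi_word_def length_concat comp_def)
  then show ?thesis
    by (simp add: mi_size_def index_list sum_list_distinct_conv_sum_set)
qed

lemma iter_partial_eq_mi:
  fixes f :: "'v::euclidean_space \<Rightarrow> complex"
  assumes "smooth f"
  shows "iter_partial e ws f = mi_partial e (count (mset ws)) f"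
  unfolding mi_partial_eq_iter
  by (intro iter_partial_perm assms multiset_eqI) (simp add: count_mi_word)

text \<open>A sum type indexes the coordinate directions in \<open>x\<close> and \<open>\<xi>\<close> at once, so that one argument serves both
groups of variables; \<open>ord_x\<close> and \<open>ord_xi\<close> tell by how much a derivative lowers the two orders.\<close>

fun dir :: "'d::finite + 's::finite \<Rightarrow> (real^'d) \<times> (real^'s)" where
  "dir (Inl i) = (axis i 1, 0)"
| "dir (Inr j) = (0, axis j 1)"

fun ord_x :: "'d + 's \<Rightarrow> real" where
  "ord_x (Inl i) = 1"
| "ord_x (Inr j) = 0"

fun ord_xi :: "'d + 's \<Rightarrow> real" where
  "ord_xi (Inl i) = 0"
| "ord_xi (Inr j) = 1"

definition weight :: "real \<Rightarrow> real \<Rightarrow> 'v::real_normed_vector \<times> 'w::real_normed_vector \<Rightarrow> real" where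
  "weight m \<mu> z = jap (fst z) powr m * jap (snd z) powr \<mu>"

lemma jap_ge_1: "jap x \<ge> 1"
  by (simp add: jap_def)

lemma jap_pos: "jap x > 0"
  using jap_ge_1[of x] by simp

lemma weight_pos: "weight m \<mu> z > 0"
  using jap_pos[of "fst z"] jap_pos[of "snd z"] by (simp add: weight_def)

lemma weight_add: "weight (m + m') (\<mu> + \<mu>') z = weight m \<mu> z * weight m' \<mu>' z"
  by (simp add: weight_def powr_add)

lemma weight_mono: "m \<le> m' \<Longrightarrow> \<mu> \<le> \<mu>' \<Longrightarrow> weight m \<mu> z \<le> weight m' \<mu>' z"
  unfolding weight_def by (intro mult_mono powr_mono jap_ge_1) auto

lemma weight_0: "weight 0 0 z = 1"
  using jap_pos[of "fst z"] jap_pos[of "snd z"] by (simp add: weight_def)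

lemma weight_uminus: "weight (- m) (- \<mu>) z * weight m \<mu> z = 1"
  using weight_add[of "-m" m "-\<mu>" \<mu> z] by (simp add: weight_0)

text \<open>\<open>symbol_bound k m \<mu> C a\<close> says that the symbol estimates of order \<open>(m, \<mu>)\<close> hold for all words of at most
\<open>k\<close> derivatives, with the one constant \<open>C\<close>.  The recursion on \<open>k\<close> is tailored to the product and chain
rules, and the explicit constant carries the continuity statements.\<close>

primrec symbol_bound ::
  "nat \<Rightarrow> real \<Rightarrow> real \<Rightarrow> real \<Rightarrow> ((real^'d::finite) \<times> (real^'s::finite) \<Rightarrow> complex) \<Rightarrow> bool" where
  "symbol_bound 0 m \<mu> C a \<longleftrightarrow> (\<forall>z. cmod (a z) \<le> C * weight m \<mu> z)"
| "symbol_bound (Suc k) m \<mu> C a \<longleftrightarrow> (\<forall>z. cmod (a z) \<le> C * weight m \<mu> z) \<and>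
     (\<forall>\<iota>. symbol_bound k (m - ord_x \<iota>) (\<mu> - ord_xi \<iota>) C (partial (dir \<iota>) a))"

lemma symbol_bound_iff_words:
  "symbol_bound k m \<mu> C a \<longleftrightarrow> (\<forall>ws. length ws \<le> k \<longrightarrow> (\<forall>z. cmod (iter_partial dir ws a z)
     \<le> C * weight (m - sum_list (map ord_x ws)) (\<mu> - sum_list (map ord_xi ws)) z))"
proof (induction k arbitrary: m \<mu> a)
  case 0
  then show ?case by simp
next
  case (Suc k)
  have "(\<forall>ws. length ws \<le> Suc k \<longrightarrow> P ws) \<longleftrightarrow> P [] \<and> (\<forall>\<iota> ws. length ws \<le> k \<longrightarrow> P (\<iota> # ws))"
    for P :: "('a + 'b) list \<Rightarrow> bool"
    by (metis Suc_le_mono le0 length_Cons list.exhaust list.size(3))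
  then show ?case
    by (simp add: Suc algebra_simps)
qed

lemma deriv_x_xi_eq_iter:
  "deriv_x \<alpha> (deriv_xi \<beta> a) = iter_partial dir (map Inr (mi_word \<beta>) @ map Inl (mi_word \<alpha>)) a"
  by (simp add: deriv_x_def deriv_xi_def mi_partial_eq_iter iter_partial_append iter_partial_map
      comp_def)

lemma iter_dir_eq_deriv:
  fixes a :: "(real^'d::finite) \<times> (real^'s::finite) \<Rightarrow> complex"
  assumes "smooth a"
  shows "iter_partial dir ws a = deriv_x (\<lambda>i. count (mset ws) (Inl i))
    (deriv_xi (\<lambda>j. count (mset ws) (Inr j)) a)"
  unfolding deriv_x_xi_eq_iter
proof (intro iter_partial_perm assms multiset_eqI)
  fix \<iota> :: "'d + 's"
  have inl: "count (image_mset Inl M) (Inl i) = count M i"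
    "count (image_mset Inl M) (Inr j) = 0" for M :: "'d multiset" and i and j :: 's
    by (induction M) auto
  have inr: "count (image_mset Inr M) (Inr j) = count M j"
    "count (image_mset Inr M) (Inl i) = 0" for M :: "'s multiset" and i :: 'd and j
    by (induction M) auto
  show "count (mset ws) \<iota> = count (mset (map Inr (mi_word (\<lambda>j. count (mset ws) (Inr j))) @
      map Inl (mi_word (\<lambda>i. count (mset ws) (Inl i))))) \<iota>"
    by (cases \<iota>) (simp_all add: inl inr count_mi_word)
qed

lemma sum_ord_word:
  fixes \<alpha> :: "'d::finite \<Rightarrow> nat" and \<beta> :: "'s::finite \<Rightarrow> nat"
  shows "sum_list (map ord_x (map Inr (mi_word \<beta>) @ map Inl (mi_word \<alpha>))) = mi_size \<alpha>"
    "sum_list (map ord_xi (map Inr (mi_word \<beta>) @ map Inl (mi_word \<alpha>))) = mi_size \<beta>"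
  by (simp_all add: comp_def length_mi_word sum_list_replicate map_replicate_const)

lemma sum_ord_count:
  fixes ws :: "('d::finite + 's::finite) list"
  shows "sum_list (map ord_x ws) = mi_size (\<lambda>i. count (mset ws) (Inl i))"
    "sum_list (map ord_xi ws) = mi_size (\<lambda>j. count (mset ws) (Inr j))"
proof -
  have *: "(\<Sum>i\<in>UNIV. real (if i' = i then Suc (f i) else f i)) = 1 + (\<Sum>i\<in>UNIV. real (f i))"
    for i' :: "'i::finite" and f
  proof -
    have "(\<Sum>i\<in>UNIV. real (if i' = i then Suc (f i) else f i)) =
        (\<Sum>i\<in>UNIV. real (f i) + (if i' = i then 1 else 0))"
      by (intro sum.cong) auto
    then show ?thesis by (simp add: sum.distrib)
  qed
  have "sum_list (map ord_x ws) = mi_size (\<lambda>i. count (mset ws) (Inl i)) \<and>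
    sum_list (map ord_xi ws) = mi_size (\<lambda>j. count (mset ws) (Inr j))"
  proof (induction ws)
    case (Cons w ws)
    then show ?case
      by (cases w) (simp_all add: mi_size_def *)
  qed (simp add: mi_size_def)
  then show "sum_list (map ord_x ws) = mi_size (\<lambda>i. count (mset ws) (Inl i))"
    "sum_list (map ord_xi ws) = mi_size (\<lambda>j. count (mset ws) (Inr j))"
    by auto
qed

lemma le_weight_iff: "x \<le> C * weight m \<mu> z \<longleftrightarrow> x * weight (- m) (- \<mu>) z \<le> C"
proof -
  have "x \<le> C * weight m \<mu> z \<longleftrightarrow>
      x * weight (- m) (- \<mu>) z \<le> C * weight m \<mu> z * weight (- m) (- \<mu>) z"
    by (simp add: weight_pos)
  then show ?thesis using weight_uminus[of m \<mu> z] by (simp add: mult_ac)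
qed

lemma mi_size_mono: "\<gamma> \<le> \<alpha> \<Longrightarrow> mi_size \<gamma> \<le> mi_size \<alpha>"
  unfolding mi_size_def by (intro sum_mono) (auto simp: le_fun_def)

lemma finite_atMost_mi: "finite {..\<alpha> :: 'i::finite \<Rightarrow> nat}"
proof -
  have "{..\<alpha>} = (\<Pi>\<^sub>E i\<in>UNIV. {..\<alpha> i})"
    by (auto simp: le_fun_def PiE_def Pi_def)
  then show ?thesis by (simp add: finite_PiE)
qed

definition scaled_deriv ::
  "real \<Rightarrow> real \<Rightarrow> ((real^'d::finite) \<times> (real^'s::finite) \<Rightarrow> complex) \<Rightarrow>
    ('d \<Rightarrow> nat) \<Rightarrow> ('s \<Rightarrow> nat) \<Rightarrow> (real^'d) \<times> (real^'s) \<Rightarrow> real" where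
  "scaled_deriv m \<mu> a \<gamma> \<delta> z = cmod (deriv_x \<gamma> (deriv_xi \<delta> a) z) *
     weight (- (m - mi_size \<gamma>)) (- (\<mu> - mi_size \<delta>)) z"

lemma SG_seminorm_eq:
  "SG_seminorm m \<mu> \<alpha> \<beta> a =
    (SUP (\<gamma>, \<delta>) \<in> {..\<alpha>} \<times> {..\<beta>}. SUP z. scaled_deriv m \<mu> a \<gamma> \<delta> z)"
  by (simp add: SG_seminorm_def scaled_deriv_def weight_def case_prod_unfold mult.assoc)

lemma SG_iff_scaled:
  "a \<in> SG m \<mu> \<longleftrightarrow> smooth a \<and> (\<forall>\<alpha> \<beta>. \<exists>C>0. \<forall>z. scaled_deriv m \<mu> a \<alpha> \<beta> z \<le> C)"
  unfolding SG_def scaled_deriv_def le_weight_iff[symmetric]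
  by (simp add: weight_def mult.assoc split_paired_All)

lemma scaled_deriv_le_seminorm:
  assumes a: "a \<in> SG m \<mu>" and le: "\<gamma> \<le> \<alpha>" "\<delta> \<le> \<beta>"
  shows "scaled_deriv m \<mu> a \<gamma> \<delta> z \<le> SG_seminorm m \<mu> \<alpha> \<beta> a"
proof -
  have "bdd_above (range (scaled_deriv m \<mu> a \<gamma> \<delta>))"
    using a unfolding SG_iff_scaled bdd_above_def by (metis (no_types, lifting) rangeE)
  then have "scaled_deriv m \<mu> a \<gamma> \<delta> z \<le> (SUP z. scaled_deriv m \<mu> a \<gamma> \<delta> z)"
    by (intro cSUP_upper) auto
  also have "\<dots> = (case (\<gamma>, \<delta>) of (\<gamma>, \<delta>) \<Rightarrow> SUP z. scaled_deriv m \<mu> a \<gamma> \<delta> z)"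
    by simp
  also have "\<dots> \<le> SG_seminorm m \<mu> \<alpha> \<beta> a"
    unfolding SG_seminorm_eq using le
    by (intro cSUP_upper bdd_above_finite finite_imageI finite_cartesian_product
        finite_atMost_mi) auto
  finally show ?thesis .
qed

text \<open>A word of length at most \<open>k\<close> contains each letter at most \<open>k\<close> times; hence the single seminorm of the
constant multiindices \<open>k\<close> controls all these words.\<close>

lemma SG_imp_symbol_bound:
  assumes a: "a \<in> SG m \<mu>"
  shows "symbol_bound k m \<mu> (SG_seminorm m \<mu> (\<lambda>_. k) (\<lambda>_. k) a) a"
  unfolding symbol_bound_iff_words
proof (intro allI impI)
  fix ws :: "('a + 'b) list" and z
  assume ws: "length ws \<le> k"
  have "count (mset ws) \<iota> \<le> k" for \<iota>
    using count_le_size[of "mset ws" \<iota>] ws by simp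
  then show "cmod (iter_partial dir ws a z) \<le> SG_seminorm m \<mu> (\<lambda>_. k) (\<lambda>_. k) a *
      weight (m - sum_list (map ord_x ws)) (\<mu> - sum_list (map ord_xi ws)) z"
    using a unfolding sum_ord_count le_weight_iff
    by (subst iter_dir_eq_deriv)
      (auto simp: SG_iff_scaled le_fun_def scaled_deriv_def[symmetric] simp del: minus_diff_eq
        intro!: scaled_deriv_le_seminorm)
qed

lemma symbol_bound_imp_scaled:
  assumes b: "symbol_bound k m \<mu> C a" and k: "mi_size \<alpha> + mi_size \<beta> \<le> k"
  shows "scaled_deriv m \<mu> a \<alpha> \<beta> z \<le> C"
proof -
  have "length (map Inr (mi_word \<beta>) @ map Inl (mi_word \<alpha>)) \<le> k"
    using k by (simp add: length_mi_word)
  with b have "cmod (iter_partial dir (map Inr (mi_word \<beta>) @ map Inl (mi_word \<alpha>)) a z) \<le>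
      C * weight (m - mi_size \<alpha>) (\<mu> - mi_size \<beta>) z"
    unfolding symbol_bound_iff_words sum_ord_word[symmetric, of \<alpha> \<beta>]
    using sum_ord_word[of \<beta> \<alpha>] by metis
  then show ?thesis
    unfolding le_weight_iff scaled_deriv_def deriv_x_xi_eq_iter .
qed

lemma symbol_bound_imp_seminorm_le:
  assumes b: "symbol_bound (mi_size \<alpha> + mi_size \<beta>) m \<mu> C a"
  shows "SG_seminorm m \<mu> \<alpha> \<beta> a \<le> C"
  unfolding SG_seminorm_eq
proof (intro cSUP_least)
  fix p assume "p \<in> {..\<alpha>} \<times> {..\<beta>}"
  then have "mi_size (fst p) + mi_size (snd p) \<le> mi_size \<alpha> + mi_size \<beta>"
    by (auto intro!: add_mono mi_size_mono)
  then show "(case p of (\<gamma>, \<delta>) \<Rightarrow> SUP z. scaled_deriv m \<mu> a \<gamma> \<delta> z) \<le> C"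
    by (auto simp: case_prod_unfold intro!: cSUP_least symbol_bound_imp_scaled[OF b])
qed auto

lemma symbol_bound_nonneg: "symbol_bound k m \<mu> C a \<Longrightarrow> C \<ge> 0"
proof -
  assume "symbol_bound k m \<mu> C a"
  then have "cmod (a 0) \<le> C * weight m \<mu> (0 :: (real^'a) \<times> (real^'b))" by (cases k) auto
  then have "0 \<le> C * weight m \<mu> (0 :: (real^'a) \<times> (real^'b))"
    using norm_ge_zero[of "a 0"] by linarith
  then show ?thesis
    using weight_pos[of m \<mu> "0 :: (real^'a) \<times> (real^'b)"] by (simp add: zero_le_mult_iff)
qed

lemma SG_iff: "a \<in> SG m \<mu> \<longleftrightarrow> smooth a \<and> (\<forall>k. \<exists>C. symbol_bound k m \<mu> C a)"
proof
  assume "a \<in> SG m \<mu>"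
  then show "smooth a \<and> (\<forall>k. \<exists>C. symbol_bound k m \<mu> C a)"
    using SG_imp_symbol_bound SG_iff_scaled by blast
next
  assume a: "smooth a \<and> (\<forall>k. \<exists>C. symbol_bound k m \<mu> C a)"
  have "\<exists>C>0. \<forall>z. scaled_deriv m \<mu> a \<alpha> \<beta> z \<le> C" for \<alpha> \<beta>
  proof -
    obtain C where "symbol_bound (mi_size \<alpha> + mi_size \<beta>) m \<mu> C a" using a by blast
    then have "scaled_deriv m \<mu> a \<alpha> \<beta> z \<le> max C 1" for z
      using symbol_bound_imp_scaled[of _ m \<mu> C a \<alpha> \<beta> z] by fastforce
    then show ?thesis by (intro exI[of _ "max C 1"]) auto
  qed
  with a show "a \<in> SG m \<mu>" by (simp add: SG_iff_scaled)
qed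

section \<open>The calculus of symbol estimates\<close>

lemma symbol_bound_partial:
  "symbol_bound (Suc k) m \<mu> C a \<Longrightarrow>
    symbol_bound k (m - ord_x \<iota>) (\<mu> - ord_xi \<iota>) C (partial (dir \<iota>) a)"
  by simp

lemma symbol_bound_mono:
  assumes "symbol_bound k m \<mu> C a" and "m \<le> m'" "\<mu> \<le> \<mu>'" "C \<le> C'" "k' \<le> k"
  shows "symbol_bound k' m' \<mu>' C' a"
proof -
  have "weight p q z \<le> weight p' q' z \<Longrightarrow> C * weight p q z \<le> C' * weight p' q' z"
    for p q p' q' and z :: "(real^'a) \<times> (real^'b)"
    using symbol_bound_nonneg[OF assms(1)] assms(4) weight_pos[of p q z]
    by (intro mult_mono) auto
  then show ?thesis
    using assms unfolding symbol_bound_iff_words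
    by (meson diff_right_mono order_trans weight_mono)
qed

lemma symbol_bound_Suc_imp: "symbol_bound (Suc k) m \<mu> C a \<Longrightarrow> symbol_bound k m \<mu> C a"
  by (erule symbol_bound_mono) simp_all

lemma symbol_bound_add:
  "symbol_bound k m \<mu> A a \<Longrightarrow> symbol_bound k m \<mu> B b \<Longrightarrow> smooth a \<Longrightarrow> smooth b \<Longrightarrow>
    symbol_bound k m \<mu> (A + B) (\<lambda>z. a z + b z)"
proof (induction k arbitrary: m \<mu> a b)
  case 0
  then show ?case
    by (auto simp: distrib_right intro!: order_trans[OF norm_triangle_ineq] add_mono)
next
  case (Suc k)
  then show ?case
    by (auto simp: distrib_right partial_add smooth_differentiable smooth_partial
        intro!: order_trans[OF norm_triangle_ineq] add_mono)
qed

lemma symbol_bound_zero: "C \<ge> 0 \<Longrightarrow> symbol_bound k m \<mu> C (\<lambda>z. 0)"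
  by (induction k arbitrary: m \<mu>) (simp_all add: partial_const weight_pos less_imp_le)

lemma symbol_bound_const: "cmod c \<le> C \<Longrightarrow> symbol_bound k 0 0 C (\<lambda>z. c)"
  using order_trans[OF norm_ge_zero]
  by (cases k) (auto simp: partial_const weight_0 intro!: symbol_bound_zero)

text \<open>Leibniz' rule distributes each of the \<open>k\<close> derivatives over two factors, whence \<open>2 ^ k\<close>.\<close>

lemma symbol_bound_mult:
  "symbol_bound k m \<mu> A a \<Longrightarrow> symbol_bound k m' \<mu>' B b \<Longrightarrow> smooth a \<Longrightarrow> smooth b \<Longrightarrow>
    symbol_bound k (m + m') (\<mu> + \<mu>') (2 ^ k * (A * B)) (\<lambda>z. a z * b z)"
proof (induction k arbitrary: m \<mu> a m' \<mu>' b)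
  case 0
  have "cmod (a z) * cmod (b z) \<le> (A * weight m \<mu> z) * (B * weight m' \<mu>' z)" for z
    using 0 symbol_bound_nonneg[OF 0(1)] weight_pos[of m \<mu> z] by (intro mult_mono) auto
  then show ?case by (simp add: norm_mult weight_add mult_ac)
next
  case (Suc k)
  note pos = symbol_bound_nonneg[OF Suc.prems(1)] symbol_bound_nonneg[OF Suc.prems(2)]
  have "cmod (a z * b z) \<le> 2 ^ Suc k * (A * B) * weight (m + m') (\<mu> + \<mu>') z" for z
  proof -
    have "cmod (a z) * cmod (b z) \<le> (A * weight m \<mu> z) * (B * weight m' \<mu>' z)"
      using Suc.prems pos weight_pos[of m \<mu> z] by (intro mult_mono) auto
    also have "\<dots> = 1 * (A * B) * weight (m + m') (\<mu> + \<mu>') z"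
      by (simp add: weight_add mult_ac)
    also have "\<dots> \<le> 2 ^ Suc k * (A * B) * weight (m + m') (\<mu> + \<mu>') z"
      using pos weight_pos[of "m + m'" "\<mu> + \<mu>'" z]
      by (intro mult_right_mono one_le_power) auto
    finally show ?thesis by (simp add: norm_mult)
  qed
  moreover have "symbol_bound k (m + m' - ord_x \<iota>) (\<mu> + \<mu>' - ord_xi \<iota>) (2 ^ Suc k * (A * B))
      (partial (dir \<iota>) (\<lambda>z. a z * b z))" for \<iota>
  proof -
    have a: "symbol_bound k (m - ord_x \<iota>) (\<mu> - ord_xi \<iota>) A (partial (dir \<iota>) a)"
      "symbol_bound k m \<mu> A a"
      using Suc.prems(1) symbol_bound_Suc_imp[OF Suc.prems(1)] by auto
    have b: "symbol_bound k (m' - ord_x \<iota>) (\<mu>' - ord_xi \<iota>) B (partial (dir \<iota>) b)"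
      "symbol_bound k m' \<mu>' B b"
      using Suc.prems(2) symbol_bound_Suc_imp[OF Suc.prems(2)] by auto
    have "symbol_bound k (m + m' - ord_x \<iota>) (\<mu> + \<mu>' - ord_xi \<iota>) (2 ^ k * (A * B) + 2 ^ k * (A * B))
      (\<lambda>z. partial (dir \<iota>) a z * b z + a z * partial (dir \<iota>) b z)"
      using Suc.IH[OF a(1) b(2)] Suc.IH[OF a(2) b(1)] Suc.prems(3,4)
      by (intro symbol_bound_add) (auto simp: algebra_simps intro: smooth_partial)
    then show ?thesis
      using Suc.prems(3,4) by (simp add: partial_mult smooth_differentiable mult_ac)
  qed
  ultimately show ?case by simp
qed

lemma SG_smooth: "a \<in> SG m \<mu> \<Longrightarrow> smooth a"
  by (simp add: SG_iff)

lemma SG_mono: "a \<in> SG m \<mu> \<Longrightarrow> m \<le> m' \<Longrightarrow> \<mu> \<le> \<mu>' \<Longrightarrow> a \<in> SG m' \<mu>'"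
  unfolding SG_iff by (meson order_refl symbol_bound_mono)

lemma SG_add: "a \<in> SG m \<mu> \<Longrightarrow> b \<in> SG m \<mu> \<Longrightarrow> (\<lambda>z. a z + b z) \<in> SG m \<mu>"
  unfolding SG_iff using symbol_bound_add smooth_add by blast

lemma SG_mult:
  "a \<in> SG m \<mu> \<Longrightarrow> b \<in> SG m' \<mu>' \<Longrightarrow> (\<lambda>z. a z * b z) \<in> SG (m + m') (\<mu> + \<mu>')"
  unfolding SG_iff using symbol_bound_mult smooth_mult by blast

lemma SG_const: "(\<lambda>z. c) \<in> SG 0 0"
  unfolding SG_iff using symbol_bound_const[OF order_refl] by blast

lemma SG_cmult: "a \<in> SG m \<mu> \<Longrightarrow> (\<lambda>z. c * a z) \<in> SG m \<mu>"
  using SG_mult[OF SG_const] by fastforce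

lemma SG_diff: "a \<in> SG m \<mu> \<Longrightarrow> b \<in> SG m \<mu> \<Longrightarrow> (\<lambda>z. a z - b z) \<in> SG m \<mu>"
  using SG_add[OF _ SG_cmult[of b m \<mu> "-1"]] by simp

lemma SG_sum:
  fixes f :: "'i \<Rightarrow> (real^'d::finite) \<times> (real^'s::finite) \<Rightarrow> complex"
  shows "finite A \<Longrightarrow> (\<And>i. i \<in> A \<Longrightarrow> f i \<in> SG m \<mu>) \<Longrightarrow> (\<lambda>z. \<Sum>i\<in>A. f i z) \<in> SG m \<mu>"
proof (induction A rule: finite_induct)
  case empty
  have "smooth (\<lambda>z :: (real^'d) \<times> (real^'s). 0 :: complex)" by (rule smooth_const)
  then show ?case using symbol_bound_zero[OF order_refl] by (auto simp: SG_iff)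
next
  case (insert x F)
  then show ?case by (simp add: SG_add)
qed

lemma SG_partial:
  "a \<in> SG m \<mu> \<Longrightarrow> partial (dir \<iota>) a \<in> SG (m - ord_x \<iota>) (\<mu> - ord_xi \<iota>)"
  unfolding SG_iff by (meson symbol_bound_partial smooth_partial)

text \<open>There are finitely many directions, so constants for the separate first derivatives combine into
one.\<close>

lemma symbol_bound_SucI:
  assumes size: "\<And>z. cmod (a z) \<le> A * weight m \<mu> z"
    and partials: "\<And>\<iota>. symbol_bound k (m - ord_x \<iota>) (\<mu> - ord_xi \<iota>) (D \<iota>) (partial (dir \<iota>) a)"
  shows "symbol_bound (Suc k) m \<mu> (max A (Max (range D))) a"
proof -
  define E where "E = max A (Max (range D))"
  have "cmod (a z) \<le> E * weight m \<mu> z" for z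
    by (rule order_trans[OF size]) (auto simp: E_def weight_pos intro!: mult_right_mono less_imp_le)
  moreover have "D \<iota> \<le> E" for \<iota>
    unfolding E_def by (intro max.coboundedI2 Max_ge) auto
  then have "symbol_bound k (m - ord_x \<iota>) (\<mu> - ord_xi \<iota>) E (partial (dir \<iota>) a)" for \<iota>
    using symbol_bound_mono[OF partials order_refl order_refl _ order_refl] by blast
  ultimately show ?thesis by (simp add: E_def)
qed

lemma SG_I_partial:
  assumes "smooth a" and "\<And>z. cmod (a z) \<le> C * weight m \<mu> z"
    and "\<And>\<iota>. partial (dir \<iota>) a \<in> SG (m - ord_x \<iota>) (\<mu> - ord_xi \<iota>)"
  shows "a \<in> SG m \<mu>"
  unfolding SG_iff
proof (intro conjI allI assms(1))
  fix k
  show "\<exists>C. symbol_bound k m \<mu> C a"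
  proof (cases k)
    case 0
    with assms(2) show ?thesis by (auto intro!: exI[of _ C])
  next
    case (Suc k')
    have "\<forall>\<iota>. \<exists>C. symbol_bound k' (m - ord_x \<iota>) (\<mu> - ord_xi \<iota>) C (partial (dir \<iota>) a)"
      using assms(3) unfolding SG_iff by blast
    then obtain D where
      D: "symbol_bound k' (m - ord_x \<iota>) (\<mu> - ord_xi \<iota>) (D \<iota>) (partial (dir \<iota>) a)" for \<iota>
      by metis
    show ?thesis using symbol_bound_SucI[OF assms(2) D] Suc by blast
  qed
qed

text \<open>The derivative of a reciprocal is a product of reciprocals and a derivative of the
  original symbol, so an induction on the number of derivatives reduces the estimates of the
  reciprocal to its size.\<close>

lemma SG_inverse:
  assumes a: "a \<in> SG m \<mu>" and c: "c > 0" and ge: "\<And>z. cmod (a z) \<ge> c * weight m \<mu> z"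
  shows "(\<lambda>z. inverse (a z)) \<in> SG (- m) (- \<mu>)"
proof -
  have nz: "a z \<noteq> 0" for z
  proof -
    have "c * weight m \<mu> z > 0" using c weight_pos[of m \<mu> z] by simp
    then show ?thesis using ge[of z] by auto
  qed
  have sm: "smooth (\<lambda>z. inverse (a z))"
    by (intro smooth_inverse SG_smooth[OF a] nz)
  have size: "cmod (inverse (a z)) \<le> inverse c * weight (- m) (- \<mu>) z" for z
  proof -
    have "inverse (weight m \<mu> z) = weight (- m) (- \<mu>) z"
      using weight_uminus[of m \<mu> z] by (metis inverse_unique inverse_inverse_eq)
    moreover have "inverse (cmod (a z)) \<le> inverse (c * weight m \<mu> z)"
      using ge c weight_pos[of m \<mu> z] by (intro le_imp_inverse_le) auto
    ultimately show ?thesis by (simp add: norm_inverse)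
  qed
  have "\<exists>C. symbol_bound k (- m) (- \<mu>) C (\<lambda>z. inverse (a z))" for k
  proof (induction k)
    case 0
    show ?case unfolding symbol_bound.simps using size by blast
  next
    case (Suc k)
    then obtain C where C: "symbol_bound k (- m) (- \<mu>) C (\<lambda>z. inverse (a z))" by blast
    have "\<exists>D. symbol_bound k (- m - ord_x \<iota>) (- \<mu> - ord_xi \<iota>) D
        (partial (dir \<iota>) (\<lambda>z. inverse (a z)))" for \<iota>
    proof -
      obtain B where B: "symbol_bound k (m - ord_x \<iota>) (\<mu> - ord_xi \<iota>) B (partial (dir \<iota>) a)"
        using SG_partial[OF a, of \<iota>] by (auto simp: SG_iff)
      have sp: "smooth (partial (dir \<iota>) a)"
        by (intro smooth_partial SG_smooth[OF a])
      note CC = symbol_bound_mult[OF C C sm sm]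
      note BCC = symbol_bound_mult[OF B CC sp smooth_mult[OF sm sm]]
      note symbol_bound_mult[OF symbol_bound_const[OF order_refl[of "cmod (- 1)"]] BCC
          smooth_const smooth_mult[OF sp smooth_mult[OF sm sm]]]
      moreover have "0 + (m - ord_x \<iota> + (- m + - m)) = - m - ord_x \<iota>"
        "0 + (\<mu> - ord_xi \<iota> + (- \<mu> + - \<mu>)) = - \<mu> - ord_xi \<iota>" by simp_all
      ultimately show ?thesis
        unfolding partial_inverse[OF smooth_differentiable[OF SG_smooth[OF a]] nz] by metis
    qed
    then obtain D where D: "symbol_bound k (- m - ord_x \<iota>) (- \<mu> - ord_xi \<iota>) (D \<iota>)
        (partial (dir \<iota>) (\<lambda>z. inverse (a z)))" for \<iota> by metis
    show ?case using symbol_bound_SucI[OF size D] by blast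
  qed
  with sm show ?thesis by (simp add: SG_iff)
qed

section \<open>Integration on the phase space\<close>

text \<open>The antiderivative \<open>arctan\<close> gives the half-line, and reflection the other half.\<close>

lemma nn_integral_inverse_1_plus_square:
  "(\<integral>\<^sup>+x. ennreal (1 / (1 + x\<^sup>2)) \<partial>(lborel :: real measure)) < \<infinity>"
proof -
  let ?f = "\<lambda>x::real. 1 / (1 + x\<^sup>2)"
  have pos: "(\<integral>\<^sup>+x. ennreal (?f x) * indicator {0..} x \<partial>lborel) = ennreal (pi / 2 - arctan 0)"
  proof (rule nn_integral_FTC_atLeast)
    show "(arctan has_real_derivative ?f x) (at x)" for x
      using DERIV_arctan[of x] by (simp add: inverse_eq_divide)
  qed (auto intro: tendsto_arctan_at_top add_nonneg_nonneg)
  have "(\<integral>\<^sup>+x. ennreal (?f x) \<partial>lborel) \<le>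
      (\<integral>\<^sup>+x. ennreal (?f x) * indicator {0..} x + ennreal (?f x) * indicator {..0} x \<partial>lborel)"
    by (intro nn_integral_mono) (auto split: split_indicator)
  also have "\<dots> = (\<integral>\<^sup>+x. ennreal (?f x) * indicator {0..} x \<partial>lborel) +
      (\<integral>\<^sup>+x. ennreal (?f x) * indicator {..0} x \<partial>lborel)"
    by (intro nn_integral_add) auto
  also have "(\<integral>\<^sup>+x. ennreal (?f x) * indicator {..0} x \<partial>lborel) =
      (\<integral>\<^sup>+x. ennreal (?f x) * indicator {0..} x \<partial>lborel)"
    by (subst nn_integral_real_affine[where c = "-1" and t = 0])
      (auto intro!: nn_integral_cong split: split_indicator)
  finally show ?thesis unfolding pos
    by (metis ennreal_add_eq_top ennreal_less_top infinity_ennreal_def le_less_trans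
        less_top top.not_eq_extremum)
qed

lemma jap_square: "(jap x)\<^sup>2 = 1 + (norm x)\<^sup>2"
  by (simp add: jap_def)

lemma jap_measurable [measurable]: "jap \<in> borel_measurable (borel :: 'a::euclidean_space measure)"
  unfolding jap_def by measurable

text \<open>Since \<open>1 + (x \<bullet> b)\<^sup>2 \<le> \<langle>x\<rangle>\<^sup>2\<close> for each basis vector \<open>b\<close>, the function is at most a product of
one-dimensional functions \<open>1 / (1 + t\<^sup>2)\<close>, one for each coordinate.\<close>

lemma integrable_jap_powr:
  fixes p :: real
  assumes p: "p \<le> - (2 * DIM('a))"
  shows "integrable lborel (\<lambda>x::'a::euclidean_space. jap x powr p)"
proof -
  have le: "jap x powr p \<le> (\<Prod>b\<in>Basis. 1 / (1 + (x \<bullet> b)\<^sup>2))" for x :: 'a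
  proof -
    have "jap x powr p \<le> jap x powr (- real (2 * DIM('a)))"
      using p by (intro powr_mono jap_ge_1) auto
    also have "\<dots> = 1 / ((jap x)\<^sup>2) ^ DIM('a)"
      by (simp only: powr_minus powr_realpow[OF jap_pos] power_mult divide_inverse mult_1)
    also have "\<dots> = (\<Prod>b\<in>(Basis::'a set). 1 / (jap x)\<^sup>2)"
      by (simp add: power_divide)
    also have "\<dots> \<le> (\<Prod>b\<in>Basis. 1 / (1 + (x \<bullet> b)\<^sup>2))"
    proof (intro prod_mono conjI divide_left_mono)
      fix b :: 'a assume "b \<in> Basis"
      then have "\<bar>x \<bullet> b\<bar> \<le> norm x" by (rule Basis_le_norm)
      then have "\<bar>x \<bullet> b\<bar>\<^sup>2 \<le> (norm x)\<^sup>2" by (intro power_mono) auto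
      then show "1 + (x \<bullet> b)\<^sup>2 \<le> (jap x)\<^sup>2"
        unfolding jap_square by simp
      show "0 < (jap x)\<^sup>2 * (1 + (x \<bullet> b)\<^sup>2)"
        using jap_pos[of x] by (intro mult_pos_pos) (auto intro: add_pos_nonneg)
    qed auto
    finally show ?thesis .
  qed
  have "(\<integral>\<^sup>+x. ennreal (jap (x::'a) powr p) \<partial>lborel) \<le>
      (\<integral>\<^sup>+x. (\<Prod>b\<in>(Basis :: 'a set). ennreal (1 / (1 + (x \<bullet> b)\<^sup>2))) \<partial>lborel)"
    using le by (intro nn_integral_mono) (simp add: prod_ennreal ennreal_leI)
  also have "\<dots> = (\<Prod>b\<in>(Basis::'a set). (\<integral>\<^sup>+x. ennreal (1 / (1 + x\<^sup>2)) \<partial>lborel))"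
    by (rule nn_integral_lborel_prod) auto
  also have "\<dots> < \<infinity>"
    using nn_integral_inverse_1_plus_square by (simp add: power_less_top_ennreal)
  finally show ?thesis
    by (intro integrableI_bounded) auto
qed

lemma jap_Pair_le: "jap (x, y) \<le> jap x * jap y"
proof -
  have "1 + ((norm x)\<^sup>2 + (norm y)\<^sup>2) \<le> (1 + (norm x)\<^sup>2) * (1 + (norm y)\<^sup>2)"
    by (simp add: algebra_simps)
  then show ?thesis
    by (simp add: jap_def norm_Pair flip: real_sqrt_mult)
qed

lemma weight_measurable [measurable]:
  "weight m \<mu> \<in> borel_measurable (borel :: ('v::euclidean_space \<times> 'w::euclidean_space) measure)"
  unfolding weight_def borel_prod[symmetric] by measurable

lemma weight_integrable:
  fixes m \<mu> :: real
  assumes "m \<le> - (2 * DIM('v \<times> 'w))" "\<mu> \<le> - (2 * DIM('v \<times> 'w))"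
  shows "integrable lborel (weight m \<mu> :: 'v::euclidean_space \<times> 'w::euclidean_space \<Rightarrow> real)"
proof (rule Bochner_Integration.integrable_bound)
  let ?N = "- real (2 * DIM('v \<times> 'w))"
  show "integrable lborel (\<lambda>z::'v \<times> 'w. jap z powr ?N)"
    using integrable_jap_powr[where 'a = "'v \<times> 'w" and p = ?N] by simp
  have "weight m \<mu> z \<le> jap z powr ?N" for z :: "'v \<times> 'w"
  proof -
    have "weight m \<mu> z \<le> weight ?N ?N z"
      using assms by (intro weight_mono) auto
    also have "\<dots> = (jap (fst z) * jap (snd z)) powr ?N"
      using jap_pos[of "fst z"] jap_pos[of "snd z"] by (simp add: weight_def powr_mult)
    also have "\<dots> \<le> jap z powr ?N"
      using jap_Pair_le[of "fst z" "snd z"] jap_pos[of z] by (intro powr_mono2') auto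
    finally show ?thesis .
  qed
  then show "AE z in lborel. norm (weight m \<mu> (z :: 'v \<times> 'w)) \<le> norm (jap z powr ?N)"
    by (intro AE_I2) (simp add: abs_of_pos weight_pos)
qed measurable

lemma lborel_translate:
  fixes f :: "'v::euclidean_space \<Rightarrow> 'w::{banach, second_countable_topology}"
  assumes [measurable]: "f \<in> borel_measurable borel"
  shows integrable_translate: "integrable lborel (\<lambda>z. f (c + z)) \<longleftrightarrow> integrable lborel f"
    and integral_translate: "(LINT z|lborel. f (c + z)) = (LINT z|lborel. f z)"
proof -
  have "integrable (distr lborel borel ((+) c)) f \<longleftrightarrow> integrable lborel (\<lambda>z. f (c + z))"
    by (rule integrable_distr_eq) auto
  then show "integrable lborel (\<lambda>z. f (c + z)) \<longleftrightarrow> integrable lborel f"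
    by (simp add: lborel_distr_plus)
  have "integral\<^sup>L (distr lborel borel ((+) c)) f = (LINT z|lborel. f (c + z))"
    by (rule integral_distr) auto
  then show "(LINT z|lborel. f (c + z)) = (LINT z|lborel. f z)"
    by (simp add: lborel_distr_plus)
qed

text \<open>By translation invariance the integral of \<open>F (v + z) - F z\<close> vanishes.  That difference is the
integral of \<open>t \<mapsto> \<partial>\<^sub>v F (t v + z)\<close> over \<open>[0, 1]\<close>; exchanging the order of integration and using
translation invariance for each \<open>t\<close> leaves the integral of \<open>\<partial>\<^sub>v F\<close>.\<close>

lemma integral_partial_eq_0:
  fixes F :: "'v::euclidean_space \<Rightarrow> complex"
  assumes F: "smooth F" and intF: "integrable lborel F"
    and intG: "integrable lborel (partial v F)"
  shows "(LINT z|lborel. partial v F z) = 0"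
proof -
  define G where "G = partial v F"
  have contG: "continuous_on UNIV G" and contF: "continuous_on UNIV F"
    by (auto simp: G_def intro: smooth_continuous smooth_partial F)
  have [measurable]: "G \<in> borel_measurable borel" "F \<in> borel_measurable borel"
    using contG contF by (auto intro: borel_measurable_continuous_onI)
  define H where "H z t = indicator {0..1::real} t *\<^sub>R G (t *\<^sub>R v + z)" for z t
  have Hz: "(LINT t|lborel. H z t) = F (v + z) - F z" for z
  proof -
    have "((\<lambda>t. F (t *\<^sub>R v + z)) has_vector_derivative G (t *\<^sub>R v + z)) (at t within {0..1})" for t
    proof -
      have "((\<lambda>t. t *\<^sub>R v + z) has_derivative (\<lambda>h. h *\<^sub>R v)) (at t)"
        by (auto intro!: derivative_eq_intros)
      from has_derivative_compose[OF this smooth_has_derivative[OF F]]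
      have "((\<lambda>t. F (t *\<^sub>R v + z)) has_derivative (\<lambda>h. partial (h *\<^sub>R v) F (t *\<^sub>R v + z))) (at t)" .
      moreover have "partial (h *\<^sub>R v) F y = h *\<^sub>R G y" for h y
        using linear_cmul[OF has_derivative_linear[OF smooth_has_derivative[OF F]]]
        by (simp add: G_def)
      ultimately show ?thesis
        unfolding has_vector_derivative_def by (simp add: has_derivative_at_withinI)
    qed
    moreover have "continuous_on {0..1} (\<lambda>t. G (t *\<^sub>R v + z))"
      by (intro continuous_on_compose2[OF contG] continuous_intros) auto
    ultimately have "(LINT t|lborel. indicator {0..1} t *\<^sub>R G (t *\<^sub>R v + z)) =
        F (1 *\<^sub>R v + z) - F (0 *\<^sub>R v + z)"
      by (intro integral_FTC_Icc) auto
    then show ?thesis by (simp add: H_def)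
  qed
  have Ht: "(LINT z|lborel. H z t) = indicator {0..1} t *\<^sub>R (LINT z|lborel. G z)" for t
    by (simp add: H_def integral_translate)
  have "integrable (lborel \<Otimes>\<^sub>M lborel) (\<lambda>(t, z). H z t)"
  proof (rule lborel_pair.Fubini_integrable)
    show "(\<lambda>(t, z). H z t) \<in> borel_measurable (lborel \<Otimes>\<^sub>M lborel)"
      unfolding H_def by measurable
    have "(LINT z|lborel. norm (case (t, z) of (t, z) \<Rightarrow> H z t)) =
        indicator {0..1} t * (LINT z|lborel. norm (G z))" for t
      by (simp add: H_def integral_translate[of "\<lambda>z. norm (G z)"])
    then show "integrable lborel (\<lambda>t. LINT z|lborel. norm (case (t, z) of (t, z) \<Rightarrow> H z t))"
      by simp
    show "AE t in lborel. integrable lborel (\<lambda>z. case (t, z) of (t, z) \<Rightarrow> H z t)"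
      using intG by (intro AE_I2) (simp add: H_def integrable_translate G_def[symmetric])
  qed
  from lborel_pair.Fubini_integral[OF this]
  have "(LINT z|lborel. LINT t|lborel. H z t) = (LINT t|lborel. LINT z|lborel. H z t)" .
  also have "\<dots> = (LINT z|lborel. G z)"
    by (simp add: Ht)
  finally have "(LINT z|lborel. G z) = (LINT z|lborel. F (v + z) - F z)"
    by (simp add: Hz)
  also have "\<dots> = (LINT z|lborel. F (v + z)) - (LINT z|lborel. F z)"
    by (rule Bochner_Integration.integral_diff) (auto simp: integrable_translate intF)
  finally show ?thesis by (simp add: G_def integral_translate)
qed

section \<open>Elementary symbols and the regularisation\<close>

lemma SG_minf_iff: "a \<in> SG_minf \<longleftrightarrow> (\<forall>m \<mu>. a \<in> SG m \<mu>)"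
  by (auto simp: SG_minf_def)

lemma SG_minf_mult: "c \<in> SG p q \<Longrightarrow> b \<in> SG_minf \<Longrightarrow> (\<lambda>z. c z * b z) \<in> SG_minf"
  unfolding SG_minf_iff
proof (intro allI)
  fix m \<mu>
  assume "c \<in> SG p q" "\<forall>m \<mu>. b \<in> SG m \<mu>"
  then show "(\<lambda>z. c z * b z) \<in> SG m \<mu>"
    using SG_mult[of c p q b "m - p" "\<mu> - q"] by simp
qed

lemma SG_minf_partial: "b \<in> SG_minf \<Longrightarrow> partial (dir \<iota>) b \<in> SG_minf"
  unfolding SG_minf_iff
proof (intro allI)
  fix m \<mu>
  assume "\<forall>m \<mu>. b \<in> SG m \<mu>"
  then show "partial (dir \<iota>) b \<in> SG m \<mu>"
    using SG_partial[of b "m + ord_x \<iota>" "\<mu> + ord_xi \<iota>" \<iota>] by simp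
qed

lemma SG_minf_add: "a \<in> SG_minf \<Longrightarrow> b \<in> SG_minf \<Longrightarrow> (\<lambda>z. a z + b z) \<in> SG_minf"
  by (simp add: SG_minf_iff SG_add)

lemma SG_minf_sum:
  fixes f :: "'i \<Rightarrow> (real^'d::finite) \<times> (real^'s::finite) \<Rightarrow> complex"
  shows "finite A \<Longrightarrow> (\<And>i. i \<in> A \<Longrightarrow> f i \<in> SG_minf) \<Longrightarrow> (\<lambda>z. \<Sum>i\<in>A. f i z) \<in> SG_minf"
  by (simp add: SG_minf_iff SG_sum)

lemma SG_minf_smooth: "b \<in> SG_minf \<Longrightarrow> smooth b"
  unfolding SG_minf_iff using SG_smooth by blast

lemma SG_zero: "(\<lambda>z. 0) \<in> SG m \<mu>"
  using SG_sum[of "{}"] by simp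

text \<open>The first derivatives of a linear function are constants, hence symbols of order \<open>(0, 0)\<close>; the last
assumption makes this the order expected after one derivative, unless the constant is \<open>0\<close>.\<close>

lemma SG_linear:
  fixes L :: "(real^'d::finite) \<times> (real^'s::finite) \<Rightarrow> complex"
  assumes L: "bounded_linear L" and le: "\<And>z. cmod (L z) \<le> weight m \<mu> z"
    and partials: "\<And>\<iota>. L (dir \<iota>) = 0 \<or> ord_x \<iota> = m \<and> ord_xi \<iota> = \<mu>"
  shows "L \<in> SG m \<mu>"
proof (rule SG_I_partial[where C = 1])
  fix \<iota> :: "'d + 's"
  have "(\<lambda>z. L (dir \<iota>)) \<in> SG (m - ord_x \<iota>) (\<mu> - ord_xi \<iota>)"
    using partials[of \<iota>]
  proof
    assume "L (dir \<iota>) = 0"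
    then show ?thesis by (simp add: SG_zero)
  next
    assume "ord_x \<iota> = m \<and> ord_xi \<iota> = \<mu>"
    then show ?thesis by (simp add: SG_const)
  qed
  then show "partial (dir \<iota>) L \<in> SG (m - ord_x \<iota>) (\<mu> - ord_xi \<iota>)"
    by (simp add: partial_bounded_linear[OF L])
qed (use L le in \<open>auto intro: smooth_bounded_linear\<close>)

lemma SG_one_plus_squares:
  fixes c :: "'i::finite \<Rightarrow> (real^'d::finite) \<times> (real^'s::finite) \<Rightarrow> complex"
  assumes c: "\<And>k. c k \<in> SG p q" and "p \<ge> 0" "q \<ge> 0"
  shows "(\<lambda>z. 1 + (\<Sum>k\<in>UNIV. c k z * c k z)) \<in> SG (2 * p) (2 * q)"
proof (intro SG_add SG_sum)
  show "(\<lambda>z. 1) \<in> SG (2 * p) (2 * q)"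
    by (rule SG_mono[OF SG_const]) (use assms in auto)
  show "(\<lambda>z. c k z * c k z) \<in> SG (2 * p) (2 * q)" for k
    using SG_mult[OF c c, of k k] by simp
qed auto

text \<open>The squares \<open>\<langle>x\<rangle>\<^sup>2\<close> and \<open>\<langle>\<xi>\<rangle>\<^sup>2\<close> are polynomials, which makes them easier symbols than \<open>\<langle>x\<rangle>\<close> and \<open>\<langle>\<xi>\<rangle>\<close>.\<close>

fun jap_sq :: "'d::finite + 's::finite \<Rightarrow> (real^'d) \<times> (real^'s) \<Rightarrow> real" where
  "jap_sq (Inl i) z = (jap (fst z))\<^sup>2"
| "jap_sq (Inr j) z = (jap (snd z))\<^sup>2"

lemma norm_le_jap: "norm x \<le> jap x"
  unfolding jap_def by (rule real_le_rsqrt) simp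

lemma norm_square_vec: "(norm (x :: real^'n::finite))\<^sup>2 = (\<Sum>i\<in>UNIV. (x $ i)\<^sup>2)"
  unfolding power2_norm_eq_inner inner_vec_def by (simp add: power2_eq_square)

lemma of_real_jap_sq:
  "(complex_of_real (jap x))\<^sup>2 =
    1 + (\<Sum>k\<in>UNIV. complex_of_real (x $ k) * complex_of_real (x $ k))"
proof -
  have "(jap x)\<^sup>2 = 1 + (\<Sum>k\<in>UNIV. x $ k * x $ k)"
    unfolding jap_square norm_square_vec by (simp add: power2_eq_square)
  from arg_cong[OF this, of complex_of_real] show ?thesis by simp
qed

lemma SG_jap_sq:
  "(\<lambda>z. complex_of_real (jap_sq \<iota> z)) \<in> SG (2 * ord_x \<iota>) (2 * ord_xi (\<iota> :: 'd::finite + 's::finite))"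
proof (cases \<iota>)
  case (Inl i)
  have coord: "(\<lambda>z :: (real^'d) \<times> (real^'s). complex_of_real (fst z $ k)) \<in> SG 1 0" for k
  proof (rule SG_linear)
    show "bounded_linear (\<lambda>z :: (real^'d) \<times> (real^'s). complex_of_real (fst z $ k))"
      by (intro bounded_linear_compose[OF bounded_linear_of_real]
          bounded_linear_compose[OF bounded_linear_vec_nth] bounded_linear_fst)
    show "cmod (complex_of_real (fst z $ k)) \<le> weight 1 0 z" for z :: "(real^'d) \<times> (real^'s)"
      using component_le_norm_cart[of "fst z" k] norm_le_jap[of "fst z"] jap_pos[of "snd z"]
        jap_pos[of "fst z"] by (simp add: weight_def)
    show "complex_of_real (fst (dir \<kappa> :: (real^'d) \<times> (real^'s)) $ k) = 0 \<or> ord_x \<kappa> = 1 \<and> ord_xi \<kappa> = 0" for \<kappa>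
      by (cases \<kappa>) auto
  qed
  have "(\<lambda>z :: (real^'d) \<times> (real^'s). 1 + (\<Sum>k\<in>UNIV. complex_of_real (fst z $ k) * complex_of_real (fst z $ k))) \<in> SG 2 0"
    using SG_one_plus_squares[OF coord] by simp
  then show ?thesis
    by (simp add: Inl of_real_jap_sq)
next
  case (Inr j)
  have coord: "(\<lambda>z :: (real^'d) \<times> (real^'s). complex_of_real (snd z $ k)) \<in> SG 0 1" for k
  proof (rule SG_linear)
    show "bounded_linear (\<lambda>z :: (real^'d) \<times> (real^'s). complex_of_real (snd z $ k))"
      by (intro bounded_linear_compose[OF bounded_linear_of_real]
          bounded_linear_compose[OF bounded_linear_vec_nth] bounded_linear_snd)
    show "cmod (complex_of_real (snd z $ k)) \<le> weight 0 1 z" for z :: "(real^'d) \<times> (real^'s)"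
      using component_le_norm_cart[of "snd z" k] norm_le_jap[of "snd z"] jap_pos[of "snd z"]
        jap_pos[of "fst z"] by (simp add: weight_def)
    show "complex_of_real (snd (dir \<kappa> :: (real^'d) \<times> (real^'s)) $ k) = 0 \<or> ord_x \<kappa> = 0 \<and> ord_xi \<kappa> = 1" for \<kappa>
      by (cases \<kappa>) auto
  qed
  have "(\<lambda>z :: (real^'d) \<times> (real^'s). 1 + (\<Sum>k\<in>UNIV. complex_of_real (snd z $ k) * complex_of_real (snd z $ k))) \<in> SG 0 2"
    using SG_one_plus_squares[OF coord] by simp
  then show ?thesis
    by (simp add: Inr of_real_jap_sq)
qed

lemma weight_2_2: "weight 2 2 z = (jap (fst z))\<^sup>2 * (jap (snd z))\<^sup>2"
  using jap_pos[of "fst z"] jap_pos[of "snd z"] by (simp add: weight_def)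

lemma SG_weight_2_2:
  "(\<lambda>z :: (real^'d::finite) \<times> (real^'s::finite). complex_of_real (weight 2 2 z)) \<in> SG 2 2"
  using SG_mult[OF SG_jap_sq[of "Inl undefined :: 'd + 's"] SG_jap_sq[of "Inr undefined :: 'd + 's"]]
  by (simp add: weight_2_2)

text \<open>The \<open>N\<close>-th power of \<open>t / N \<le> exp (t / N)\<close>.\<close>

lemma power_le_exp:
  fixes t :: real
  assumes "t \<ge> 0"
  shows "t ^ N \<le> real (N ^ N) * exp t"
proof (cases "N = 0")
  case False
  have "t / N \<le> exp (t / N)"
    using exp_ge_add_one_self[of "t / N"] by linarith
  then have "(t / N) ^ N \<le> exp (t / N) ^ N"
    using assms by (intro power_mono) auto
  also have "\<dots> = exp t"
    using False by (simp flip: exp_of_nat_mult)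
  finally show ?thesis
    using False by (simp add: power_divide field_simps)
qed (use assms in auto)

text \<open>The factor \<open>exp (- \<epsilon> \<langle>x\<rangle>\<^sup>2 \<langle>\<xi>\<rangle>\<^sup>2)\<close> makes a symbol rapidly decreasing for \<open>\<epsilon> > 0\<close> and tends to \<open>1\<close> as
\<open>\<epsilon> \<rightarrow> 0\<close>.  It is written with complex factors so that the differentiation rules for products and
exponentials apply.\<close>

definition regulariser ::
  "real \<Rightarrow> (real^'d::finite) \<times> (real^'s::finite) \<Rightarrow> complex" where
  "regulariser \<epsilon> z = exp (complex_of_real (- \<epsilon>) * complex_of_real (weight 2 2 z))"

lemma regulariser_real: "regulariser \<epsilon> z = complex_of_real (exp (- (\<epsilon> * weight 2 2 z)))"
  by (simp add: regulariser_def exp_of_real[symmetric])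

lemma smooth_regulariser: "smooth (regulariser \<epsilon>)"
  unfolding regulariser_def
  by (intro smooth_exp smooth_mult smooth_const SG_smooth[OF SG_weight_2_2])

lemma partial_regulariser:
  "partial v (regulariser \<epsilon>) =
    (\<lambda>z. partial v (\<lambda>z. complex_of_real (weight 2 2 z)) z * (complex_of_real (- \<epsilon>) * regulariser \<epsilon> z))"
proof -
  have w: "(\<lambda>z :: (real^'a) \<times> (real^'b). complex_of_real (weight 2 2 z)) differentiable (at z)" for z
    by (rule smooth_differentiable[OF SG_smooth[OF SG_weight_2_2]])
  have cw: "smooth (\<lambda>z :: (real^'a) \<times> (real^'b). complex_of_real (- \<epsilon>) * complex_of_real (weight 2 2 z))"
    by (intro smooth_mult smooth_const SG_smooth[OF SG_weight_2_2])
  have "partial v (\<lambda>z :: (real^'a) \<times> (real^'b). complex_of_real (- \<epsilon>) * complex_of_real (weight 2 2 z)) =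
      (\<lambda>z. complex_of_real (- \<epsilon>) * partial v (\<lambda>z. complex_of_real (weight 2 2 z)) z)"
    using partial_mult[OF smooth_differentiable[OF smooth_const[of "complex_of_real (- \<epsilon>)"]] w, of v]
    by (simp add: partial_const)
  then show ?thesis
    unfolding regulariser_def partial_exp[OF smooth_differentiable[OF cw]]
    by (simp only: mult_ac)
qed

text \<open>With \<open>w = \<langle>x\<rangle>\<^sup>2 \<langle>\<xi>\<rangle>\<^sup>2\<close> and \<open>t = \<epsilon> w\<close>, the size of \<open>\<epsilon>\<^sup>N exp (- \<epsilon> w)\<close> is \<open>t\<^sup>N exp (- t) w\<^sup>-\<^sup>N\<close>, where \<open>t\<^sup>N exp (- t)\<close>
is bounded.  Its derivative is \<open>- \<partial>w\<close> times \<open>\<epsilon>\<^sup>N\<^sup>+\<^sup>1 exp (- \<epsilon> w)\<close>, so the estimate of \<open>k + 1\<close> derivatives for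
\<open>N\<close> follows from that of \<open>k\<close> derivatives for \<open>N + 1\<close>.  The case \<open>N = 0\<close> bounds the regularisers
uniformly in \<open>\<epsilon>\<close>; large \<open>N\<close> shows that each of them is rapidly decreasing.\<close>

lemma regulariser_scaled_bound:
  "\<exists>C. \<forall>\<epsilon>. 0 < \<epsilon> \<and> \<epsilon> \<le> 1 \<longrightarrow>
    symbol_bound k (- 2 * real N) (- 2 * real N) C
      (\<lambda>z :: (real^'d::finite) \<times> (real^'s::finite). complex_of_real (\<epsilon> ^ N) * regulariser \<epsilon> z)"
proof -
  let ?g = "\<lambda>N \<epsilon> (z :: (real^'d) \<times> (real^'s)). complex_of_real (\<epsilon> ^ N) * regulariser \<epsilon> z"
  let ?w = "\<lambda>z :: (real^'d) \<times> (real^'s). complex_of_real (weight 2 2 z)"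
  have size: "cmod (?g N \<epsilon> z) \<le> real (N ^ N) * weight (- 2 * real N) (- 2 * real N) z"
    if "0 < \<epsilon>" for N \<epsilon> z
  proof -
    let ?t = "\<epsilon> * weight 2 2 z"
    have t: "?t \<ge> 0" using that weight_pos[of 2 2 z] by simp
    have w: "weight 2 2 z ^ N = weight (- (- 2 * real N)) (- (- 2 * real N)) z"
    proof -
      have pow: "jap x powr (2 * real N) = (jap x)\<^sup>2 ^ N" for x :: "'v::real_normed_vector"
        using powr_realpow[OF jap_pos[of x], of "2 * N"] by (simp add: power_mult)
      show ?thesis
        by (simp only: weight_2_2 power_mult_distrib) (simp add: weight_def pow)
    qed
    have "cmod (?g N \<epsilon> z) * weight 2 2 z ^ N = ?t ^ N * exp (- ?t)"
      using that by (simp add: regulariser_real norm_mult power_mult_distrib norm_power)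
    also have "\<dots> \<le> real (N ^ N) * exp ?t * exp (- ?t)"
      by (intro mult_right_mono power_le_exp t) auto
    also have "\<dots> = real (N ^ N)"
      by (simp add: mult.assoc flip: exp_add)
    finally show ?thesis
      unfolding le_weight_iff w .
  qed
  show ?thesis
  proof (induction k arbitrary: N)
    case 0
    then show ?case using size by (intro exI[of _ "real (N ^ N)"]) auto
  next
    case (Suc k)
    obtain B where B: "\<And>\<epsilon>. 0 < \<epsilon> \<and> \<epsilon> \<le> 1 \<Longrightarrow>
        symbol_bound k (- 2 * real (Suc N)) (- 2 * real (Suc N)) B (?g (Suc N) \<epsilon>)"
      using Suc.IH[of "Suc N"] by blast
    have "\<exists>D. symbol_bound k (2 - ord_x \<iota>) (2 - ord_xi \<iota>) D (partial (dir \<iota>) ?w)"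
      for \<iota> :: "'d + 's"
      using SG_partial[OF SG_weight_2_2] by (auto simp: SG_iff)
    then obtain D where
      D: "symbol_bound k (2 - ord_x \<iota>) (2 - ord_xi \<iota>) (D \<iota>) (partial (dir \<iota>) ?w)"
      for \<iota> :: "'d + 's" by metis
    let ?E = "\<lambda>\<iota> :: 'd + 's. 2 ^ k * (1 * (2 ^ k * (D \<iota> * B)))"
    have "symbol_bound (Suc k) (- 2 * real N) (- 2 * real N) (max (real (N ^ N)) (Max (range ?E))) (?g N \<epsilon>)"
      if \<epsilon>: "0 < \<epsilon> \<and> \<epsilon> \<le> 1" for \<epsilon>
    proof (rule symbol_bound_SucI)
      fix \<iota> :: "'d + 's"
      have w: "smooth (partial (dir \<iota>) ?w)"
        by (intro smooth_partial SG_smooth[OF SG_weight_2_2])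
      have g: "smooth (?g (Suc N) \<epsilon>)"
        by (intro smooth_mult smooth_const smooth_regulariser)
      have "partial (dir \<iota>) (?g N \<epsilon>) = (\<lambda>z. (- 1) * (partial (dir \<iota>) ?w z * ?g (Suc N) \<epsilon> z))"
        using partial_mult[OF smooth_differentiable[OF smooth_const[of "complex_of_real (\<epsilon> ^ N)"]]
            smooth_differentiable[OF smooth_regulariser[of \<epsilon>]], of "dir \<iota>"]
        by (simp add: partial_const partial_regulariser mult_ac)
      moreover have "symbol_bound k (0 + ((2 - ord_x \<iota>) + (- 2 * real (Suc N))))
          (0 + ((2 - ord_xi \<iota>) + (- 2 * real (Suc N)))) (?E \<iota>)
          (\<lambda>z. (- 1) * (partial (dir \<iota>) ?w z * ?g (Suc N) \<epsilon> z))"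
        by (rule symbol_bound_mult[OF symbol_bound_const symbol_bound_mult[OF D B[OF \<epsilon>] w g]
              smooth_const smooth_mult[OF w g]]) simp
      moreover have "0 + ((2 - ord_x \<iota>) + (- 2 * real (Suc N))) = - 2 * real N - ord_x \<iota>"
        "0 + ((2 - ord_xi \<iota>) + (- 2 * real (Suc N))) = - 2 * real N - ord_xi \<iota>"
        by simp_all
      ultimately show "symbol_bound k (- 2 * real N - ord_x \<iota>) (- 2 * real N - ord_xi \<iota>) (?E \<iota>)
          (partial (dir \<iota>) (?g N \<epsilon>))"
        by metis
    qed (use size \<epsilon> in auto)
    then show ?case by blast
  qed
qed

lemma regulariser_in_SG_minf:
  assumes "0 < \<epsilon>" "\<epsilon> \<le> 1"
  shows "(regulariser \<epsilon> :: (real^'d::finite) \<times> (real^'s::finite) \<Rightarrow> complex) \<in> SG_minf"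
  unfolding SG_minf_iff
proof (intro allI)
  fix m \<mu> :: real
  obtain N where N: "real N \<ge> max (- m) (- \<mu>)"
    using real_arch_simple by blast
  let ?g = "\<lambda>z :: (real^'d) \<times> (real^'s). complex_of_real (\<epsilon> ^ N) * regulariser \<epsilon> z"
  have "?g \<in> SG (- 2 * real N) (- 2 * real N)"
    unfolding SG_iff
  proof (intro conjI allI)
    show "smooth ?g" by (intro smooth_mult smooth_const smooth_regulariser)
    show "\<exists>C. symbol_bound k (- 2 * real N) (- 2 * real N) C ?g" for k
      using regulariser_scaled_bound[where 'd = 'd and 's = 's, of k N] assms by metis
  qed
  then have "?g \<in> SG m \<mu>"
    by (rule SG_mono) (use N in auto)
  from SG_cmult[OF this, of "inverse (complex_of_real (\<epsilon> ^ N))"] assms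
  show "(regulariser \<epsilon> :: (real^'d) \<times> (real^'s) \<Rightarrow> complex) \<in> SG m \<mu>"
    by (simp add: mult.assoc[symmetric])
qed

text \<open>The regularisers do not converge to \<open>1\<close> in the symbols of order \<open>(0, 0)\<close>, but they do in order
\<open>(2, 2)\<close>: there \<open>1 - exp (- \<epsilon> w) \<le> \<epsilon> w\<close> has size \<open>\<epsilon>\<close>, and so has the derivative
\<open>- \<epsilon> \<partial>w exp (- \<epsilon> w)\<close>, the exponentials being uniformly bounded symbols of order \<open>(0, 0)\<close>.\<close>

lemma regulariser_approx:
  "\<exists>C. \<forall>\<epsilon>. 0 < \<epsilon> \<and> \<epsilon> \<le> 1 \<longrightarrow>
    symbol_bound k 2 2 (C * \<epsilon>) (\<lambda>z :: (real^'d::finite) \<times> (real^'s::finite). regulariser \<epsilon> z - 1)"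
proof -
  have size: "cmod (regulariser \<epsilon> z - 1) \<le> (1 * \<epsilon>) * weight 2 2 z" if "0 < \<epsilon>"
    for \<epsilon> and z :: "(real^'d::finite) \<times> (real^'s::finite)"
  proof -
    let ?t = "\<epsilon> * weight 2 2 z"
    have "?t \<ge> 0" using that weight_pos[of 2 2 z] by simp
    moreover have "regulariser \<epsilon> z - 1 = complex_of_real (exp (- ?t) - 1)"
      by (simp add: regulariser_real)
    ultimately show ?thesis
      using exp_ge_add_one_self[of "- ?t"] by (simp only: norm_of_real) auto
  qed
  show ?thesis
  proof (cases k)
    case 0
    then show ?thesis using size by (intro exI[of _ 1]) auto
  next
    case (Suc k)
    let ?w = "\<lambda>z :: (real^'d) \<times> (real^'s). complex_of_real (weight 2 2 z)"
    obtain B where B: "\<And>\<epsilon>. 0 < \<epsilon> \<and> \<epsilon> \<le> 1 \<Longrightarrow>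
        symbol_bound k 0 0 B (regulariser \<epsilon> :: (real^'d) \<times> (real^'s) \<Rightarrow> complex)"
      using regulariser_scaled_bound[where 'd = 'd and 's = 's, of k 0] by auto
    have "\<exists>D. symbol_bound k (2 - ord_x \<iota>) (2 - ord_xi \<iota>) D (partial (dir \<iota>) ?w)"
      for \<iota> :: "'d + 's"
      using SG_partial[OF SG_weight_2_2] by (auto simp: SG_iff)
    then obtain D where
      D: "symbol_bound k (2 - ord_x \<iota>) (2 - ord_xi \<iota>) (D \<iota>) (partial (dir \<iota>) ?w)"
      for \<iota> :: "'d + 's" by metis
    define M where "M = max 1 (Max (range (\<lambda>\<iota> :: 'd + 's. 2 ^ k * (1 * (2 ^ k * (D \<iota> * B))))))"
    have M: "M \<ge> 1" "2 ^ k * (1 * (2 ^ k * (D \<iota> * B))) \<le> M" for \<iota>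
      unfolding M_def by (auto intro!: max.coboundedI2 Max_ge)
    have "symbol_bound (Suc k) 2 2 (M * \<epsilon>) (\<lambda>z :: (real^'d) \<times> (real^'s). regulariser \<epsilon> z - 1)"
      if \<epsilon>: "0 < \<epsilon> \<and> \<epsilon> \<le> 1" for \<epsilon>
      unfolding symbol_bound.simps
    proof (intro conjI allI)
      fix z :: "(real^'d) \<times> (real^'s)"
      have "(1 * \<epsilon>) * weight 2 2 z \<le> (M * \<epsilon>) * weight 2 2 z"
        using M \<epsilon> weight_pos[of 2 2 z] by (intro mult_right_mono) auto
      then show "cmod (regulariser \<epsilon> z - 1) \<le> M * \<epsilon> * weight 2 2 z"
        using size[of \<epsilon> z] \<epsilon> by linarith
    next
      fix \<iota> :: "'d + 's"
      let ?g = "regulariser \<epsilon> :: (real^'d) \<times> (real^'s) \<Rightarrow> complex"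
      have w: "smooth (partial (dir \<iota>) ?w)"
        by (intro smooth_partial SG_smooth[OF SG_weight_2_2])
      have g: "smooth ?g" by (rule smooth_regulariser)
      have "partial (dir \<iota>) (\<lambda>z. ?g z + (- 1)) =
          (\<lambda>z. complex_of_real (- \<epsilon>) * (partial (dir \<iota>) ?w z * ?g z))"
        using partial_add[OF smooth_differentiable[OF smooth_regulariser[of \<epsilon>]]
            smooth_differentiable[OF smooth_const[of "- 1 :: complex"]], of "dir \<iota>"]
        by (simp add: partial_const partial_regulariser mult_ac)
      moreover have "symbol_bound k (0 + ((2 - ord_x \<iota>) + 0)) (0 + ((2 - ord_xi \<iota>) + 0))
          (2 ^ k * (\<epsilon> * (2 ^ k * (D \<iota> * B))))
          (\<lambda>z. complex_of_real (- \<epsilon>) * (partial (dir \<iota>) ?w z * ?g z))"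
        by (rule symbol_bound_mult[OF symbol_bound_const symbol_bound_mult[OF D B[OF \<epsilon>] w g]
              smooth_const smooth_mult[OF w g]]) (use \<epsilon> in simp)
      ultimately have "symbol_bound k (2 - ord_x \<iota>) (2 - ord_xi \<iota>)
          ((2 ^ k * (1 * (2 ^ k * (D \<iota> * B)))) * \<epsilon>) (partial (dir \<iota>) (\<lambda>z. ?g z - 1))"
        by (simp add: mult_ac)
      moreover have "(2 ^ k * (1 * (2 ^ k * (D \<iota> * B)))) * \<epsilon> \<le> M * \<epsilon>"
        using M(2) \<epsilon> by (intro mult_right_mono) auto
      ultimately show "symbol_bound k (2 - ord_x \<iota>) (2 - ord_xi \<iota>) (M * \<epsilon>)
          (partial (dir \<iota>) (\<lambda>z. ?g z - 1))"
        using symbol_bound_mono[OF _ order_refl order_refl _ order_refl] by blast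
    qed
    then show ?thesis using Suc by blast
  qed
qed

lemma regularised_symbol:
  assumes "a \<in> SG m \<mu>" "0 < \<epsilon>" "\<epsilon> \<le> 1"
  shows "(\<lambda>z. regulariser \<epsilon> z * a z) \<in> SG_minf"
  using SG_minf_mult[OF assms(1) regulariser_in_SG_minf[OF assms(2,3)]] by (simp add: mult.commute)

lemma regularised_symbol_approx:
  assumes a: "a \<in> SG m \<mu>"
  shows "\<exists>C. \<forall>\<epsilon>. 0 < \<epsilon> \<and> \<epsilon> \<le> 1 \<longrightarrow>
    symbol_bound k (m + 2) (\<mu> + 2) (C * \<epsilon>) (\<lambda>z. regulariser \<epsilon> z * a z - a z)"
proof -
  obtain A where A: "symbol_bound k m \<mu> A a" using a by (auto simp: SG_iff)
  obtain C where C: "\<And>\<epsilon>. 0 < \<epsilon> \<and> \<epsilon> \<le> 1 \<Longrightarrow>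
      symbol_bound k 2 2 (C * \<epsilon>) (\<lambda>z :: (real^'a) \<times> (real^'b). regulariser \<epsilon> z - 1)"
    using regulariser_approx[where 'd = 'a and 's = 'b, of k] by metis
  have sm: "smooth (\<lambda>z :: (real^'a) \<times> (real^'b). regulariser \<epsilon> z - 1)" for \<epsilon>
    using smooth_add[OF smooth_regulariser[of \<epsilon>] smooth_const[of "- 1"]] by simp
  have "symbol_bound k (m + 2) (\<mu> + 2) ((2 ^ k * (A * C)) * \<epsilon>) (\<lambda>z. regulariser \<epsilon> z * a z - a z)"
    if "0 < \<epsilon> \<and> \<epsilon> \<le> 1" for \<epsilon>
    using symbol_bound_mult[OF A C[OF that] SG_smooth[OF a] sm] by (simp add: algebra_simps)
  then show ?thesis by blast
qed

section \<open>The transposed operator and integration by parts\<close>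

lemma symbol_bound_sum:
  fixes f :: "'i \<Rightarrow> (real^'d::finite) \<times> (real^'s::finite) \<Rightarrow> complex"
  assumes "finite A" and "\<And>i. i \<in> A \<Longrightarrow> symbol_bound k m \<mu> (C i) (f i)"
    and "\<And>i. i \<in> A \<Longrightarrow> smooth (f i)"
  shows "symbol_bound k m \<mu> (\<Sum>i\<in>A. C i) (\<lambda>z. \<Sum>i\<in>A. f i z)"
  using assms
proof (induction A rule: finite_induct)
  case empty
  show ?case by (simp add: symbol_bound_zero)
next
  case (insert i A)
  then show ?case by (simp add: symbol_bound_add smooth_sum)
qed

text \<open>The dimension is expressed through a function on the space, so that it becomes a constant attached
to the phase.\<close>

definition domain_dim :: "('v::euclidean_space \<Rightarrow> 'w) \<Rightarrow> nat" where
  "domain_dim f = DIM('v)"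

locale sg_phase =
  fixes \<phi> :: "(real^'d::finite) \<times> (real^'s::finite) \<Rightarrow> real" and n \<nu> :: real
  assumes admissible: "admissible_phase n \<nu> \<phi>"
begin

lemma n_pos: "n > 0" and nu_pos: "\<nu> > 0"
  using admissible by (auto simp: admissible_phase_def)

definition \<Phi> :: "(real^'d) \<times> (real^'s) \<Rightarrow> complex" where
  "\<Phi> z = complex_of_real (\<phi> z)"

lemma Phi_SG: "\<Phi> \<in> SG n \<nu>"
  using admissible by (simp add: admissible_phase_def \<Phi>_def[abs_def])

lemma smooth_Phi: "smooth \<Phi>"
  by (rule SG_smooth[OF Phi_SG])

lemma partial_Phi: "partial v \<Phi> z = complex_of_real (partial v \<phi> z)"
proof -
  have "((\<lambda>z. Re (\<Phi> z)) has_derivative (\<lambda>v. Re (partial v \<Phi> z))) (at z)"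
    by (intro bounded_linear.has_derivative[OF bounded_linear_Re] smooth_has_derivative smooth_Phi)
  then have "(\<phi> has_derivative (\<lambda>v. Re (partial v \<Phi> z))) (at z)"
    by (simp add: \<Phi>_def)
  then have \<phi>: "\<phi> differentiable (at z)"
    by (rule differentiableI)
  from bounded_linear.has_derivative[OF bounded_linear_of_real differentiable_has_partial[OF this]]
  have "(\<Phi> has_derivative (\<lambda>v. complex_of_real (partial v \<phi> z))) (at z)"
    by (simp add: \<Phi>_def[abs_def])
  then show ?thesis by (rule partial_eq)
qed

text \<open>The form \<open>\<Sum> W\<^sub>\<iota> (\<partial>\<^sub>\<iota> \<phi>)\<^sup>2\<close>, with \<open>W\<^sub>\<iota>\<close> equal to \<open>\<langle>x\<rangle>\<^sup>2\<close> or \<open>\<langle>\<xi>\<rangle>\<^sup>2\<close>, is the quantity that admissibility bounds from below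
outside a ball.  Adding \<open>1\<close> makes it positive everywhere.  Since \<open>1\<close> is a symbol of the lower order
\<open>(0, 0)\<close>, this replaces the customary cut-off near the critical points.\<close>

definition \<psi> :: "(real^'d) \<times> (real^'s) \<Rightarrow> complex" where
  "\<psi> z = 1 + (\<Sum>\<iota>\<in>UNIV. complex_of_real (jap_sq \<iota> z) * (partial (dir \<iota>) \<Phi> z * partial (dir \<iota>) \<Phi> z))"

lemma psi_SG: "\<psi> \<in> SG (2 * n) (2 * \<nu>)"
proof -
  have "(\<lambda>z. complex_of_real (jap_sq \<iota> z) * (partial (dir \<iota>) \<Phi> z * partial (dir \<iota>) \<Phi> z))
      \<in> SG (2 * n) (2 * \<nu>)" for \<iota>
    using SG_mult[OF SG_jap_sq[of \<iota>] SG_mult[OF SG_partial[OF Phi_SG] SG_partial[OF Phi_SG]], of \<iota> \<iota>]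
    by (simp add: algebra_simps)
  then show ?thesis
    unfolding \<psi>_def[abs_def] using n_pos nu_pos
    by (intro SG_add SG_sum) (auto intro: SG_mono[OF SG_const])
qed

lemma psi_eq:
  "\<psi> (x, \<xi>) = complex_of_real (1 + ((jap x)\<^sup>2 * (norm (grad_x \<phi> (x, \<xi>)))\<^sup>2 +
    (jap \<xi>)\<^sup>2 * (norm (grad_xi \<phi> (x, \<xi>)))\<^sup>2))"
proof -
  have "\<psi> (x, \<xi>) = complex_of_real (1 + (\<Sum>\<iota>\<in>UNIV. jap_sq \<iota> (x, \<xi>) * (partial (dir \<iota>) \<phi> (x, \<xi>))\<^sup>2))"
    by (simp add: \<psi>_def partial_Phi power2_eq_square)
  also have "(\<Sum>\<iota>\<in>UNIV. jap_sq \<iota> (x, \<xi>) * (partial (dir \<iota> :: (real^'d) \<times> (real^'s)) \<phi> (x, \<xi>))\<^sup>2) =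
      (\<Sum>i\<in>UNIV. (jap x)\<^sup>2 * (grad_x \<phi> (x, \<xi>) $ i)\<^sup>2) + (\<Sum>j\<in>UNIV. (jap \<xi>)\<^sup>2 * (grad_xi \<phi> (x, \<xi>) $ j)\<^sup>2)"
    by (subst UNIV_Plus_UNIV[symmetric], subst sum.Plus) (simp_all add: grad_x_def grad_xi_def)
  finally show ?thesis
    by (simp only: norm_square_vec sum_distrib_left)
qed

text \<open>Outside the ball this is admissibility; inside, the weight is at most \<open>K\<close> and \<open>\<psi> \<ge> 1\<close>.\<close>

lemma psi_lower: "\<exists>c>0. \<forall>z. cmod (\<psi> z) \<ge> c * weight (2 * n) (2 * \<nu>) z"
proof -
  obtain R C where R: "R > 0" and C: "C > 0"
    and lower: "\<And>x \<xi>. norm x + norm \<xi> \<ge> R \<Longrightarrow>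
        (jap x)\<^sup>2 * (norm (grad_x \<phi> (x, \<xi>)))\<^sup>2 + (jap \<xi>)\<^sup>2 * (norm (grad_xi \<phi> (x, \<xi>)))\<^sup>2
          \<ge> C * (jap x powr (2 * n) * jap \<xi> powr (2 * \<nu>))"
    using admissible unfolding admissible_phase_def by blast
  define K where "K = (1 + R) powr (2 * n) * (1 + R) powr (2 * \<nu>)"
  have K: "K > 0" using R by (simp add: K_def)
  have "min C (inverse K) * weight (2 * n) (2 * \<nu>) (x, \<xi>) \<le> cmod (\<psi> (x, \<xi>))" for x \<xi>
  proof -
    let ?G = "(jap x)\<^sup>2 * (norm (grad_x \<phi> (x, \<xi>)))\<^sup>2 + (jap \<xi>)\<^sup>2 * (norm (grad_xi \<phi> (x, \<xi>)))\<^sup>2"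
    have G: "?G \<ge> 0" by simp
    then have psi: "cmod (\<psi> (x, \<xi>)) = 1 + ?G"
      unfolding psi_eq norm_of_real by linarith
    note w = weight_pos[of "2 * n" "2 * \<nu>" "(x, \<xi>)"]
    show ?thesis
    proof (cases "norm x + norm \<xi> \<ge> R")
      case True
      have "min C (inverse K) * weight (2 * n) (2 * \<nu>) (x, \<xi>) \<le> C * weight (2 * n) (2 * \<nu>) (x, \<xi>)"
        using w by (intro mult_right_mono) auto
      also have "\<dots> \<le> ?G" using lower[OF True] by (simp add: weight_def)
      finally show ?thesis using psi by linarith
    next
      case False
      have le: "jap y \<le> 1 + norm y" for y :: "'v::real_normed_vector"
        unfolding jap_def by (rule real_le_lsqrt) (auto simp: power2_eq_square algebra_simps)
      have "norm x < R" "norm \<xi> < R"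
        using False norm_ge_zero[of x] norm_ge_zero[of \<xi>] by linarith+
      then have "jap x \<le> 1 + R" "jap \<xi> \<le> 1 + R"
        using le[of x] le[of \<xi>] by linarith+
      then have "weight (2 * n) (2 * \<nu>) (x, \<xi>) \<le> K"
        unfolding weight_def K_def using jap_pos[of x] jap_pos[of \<xi>] n_pos nu_pos
        by (intro mult_mono powr_mono2) auto
      then have "min C (inverse K) * weight (2 * n) (2 * \<nu>) (x, \<xi>) \<le> inverse K * K"
        using w K C by (intro mult_mono) auto
      then have "min C (inverse K) * weight (2 * n) (2 * \<nu>) (x, \<xi>) \<le> 1"
        using K by simp
      then show ?thesis using psi G by linarith
    qed
  qed
  then show ?thesis
    using C K by (intro exI[of _ "min C (inverse K)"]) (auto simp: split_paired_All)
qed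

lemma psi_nonzero: "\<psi> z \<noteq> 0"
proof -
  obtain c where c: "c > 0" "cmod (\<psi> z) \<ge> c * weight (2 * n) (2 * \<nu>) z"
    using psi_lower by blast
  moreover have "c * weight (2 * n) (2 * \<nu>) z > 0"
    using c(1) weight_pos[of "2 * n" "2 * \<nu>" z] by simp
  ultimately show ?thesis by auto
qed

lemma inverse_psi_SG: "(\<lambda>z. inverse (\<psi> z)) \<in> SG (- (2 * n)) (- (2 * \<nu>))"
  using psi_lower SG_inverse[OF psi_SG] by blast

text \<open>Because \<open>\<partial>\<^sub>\<iota> e\<^sup>i\<^sup>\<phi> = i (\<partial>\<^sub>\<iota> \<phi>) e\<^sup>i\<^sup>\<phi>\<close>, the function \<open>e\<^sup>i\<^sup>\<phi> = \<psi>\<^sup>-\<^sup>1 \<psi> e\<^sup>i\<^sup>\<phi>\<close> equals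
\<open>\<psi>\<^sup>-\<^sup>1 e\<^sup>i\<^sup>\<phi> - i \<Sum> coef\<^sub>\<iota> \<partial>\<^sub>\<iota> e\<^sup>i\<^sup>\<phi>\<close> with the coefficients below.\<close>

definition coef :: "'d + 's \<Rightarrow> (real^'d) \<times> (real^'s) \<Rightarrow> complex" where
  "coef \<iota> z = inverse (\<psi> z) * (complex_of_real (jap_sq \<iota> z) * partial (dir \<iota>) \<Phi> z)"

lemma coef_SG: "coef \<iota> \<in> SG (ord_x \<iota> - n) (ord_xi \<iota> - \<nu>)"
  using SG_mult[OF inverse_psi_SG SG_mult[OF SG_jap_sq[of \<iota>] SG_partial[OF Phi_SG, of \<iota>]]]
  by (simp add: coef_def[abs_def] algebra_simps)

text \<open>The transpose of the operator \<open>\<psi>\<^sup>-\<^sup>1 - i \<Sum> coef\<^sub>\<iota> \<partial>\<^sub>\<iota>\<close> that reproduces \<open>e\<^sup>i\<^sup>\<phi>\<close>.\<close>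

definition parts_op :: "((real^'d) \<times> (real^'s) \<Rightarrow> complex) \<Rightarrow> (real^'d) \<times> (real^'s) \<Rightarrow> complex" where
  "parts_op b z = inverse (\<psi> z) * b z + \<i> * (\<Sum>\<iota>\<in>UNIV. partial (dir \<iota>) (\<lambda>z. coef \<iota> z * b z) z)"

lemma smooth_coef: "smooth (coef \<iota>)"
  by (rule SG_smooth[OF coef_SG])

lemma smooth_inverse_psi: "smooth (\<lambda>z. inverse (\<psi> z))"
  by (rule SG_smooth[OF inverse_psi_SG])

lemma smooth_partial_coef_mult: "smooth b \<Longrightarrow> smooth (partial v (\<lambda>z. coef \<iota> z * b z))"
  by (intro smooth_partial smooth_mult smooth_coef)

lemma smooth_parts_op: "smooth b \<Longrightarrow> smooth (parts_op b)"
  unfolding parts_op_def[abs_def]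
  by (intro smooth_add smooth_mult smooth_sum smooth_const smooth_inverse_psi
      smooth_partial_coef_mult finite)

lemma parts_op_add:
  assumes "smooth a" "smooth b"
  shows "parts_op (\<lambda>z. a z + b z) = (\<lambda>z. parts_op a z + parts_op b z)"
proof
  fix z
  have "partial (dir \<iota>) (\<lambda>z. coef \<iota> z * (a z + b z)) z =
      partial (dir \<iota>) (\<lambda>z. coef \<iota> z * a z) z + partial (dir \<iota>) (\<lambda>z. coef \<iota> z * b z) z" for \<iota>
    using partial_add[OF smooth_differentiable[OF smooth_mult[OF smooth_coef assms(1)]]
        smooth_differentiable[OF smooth_mult[OF smooth_coef assms(2)]], of "dir \<iota>" \<iota> \<iota>]
    by (simp add: distrib_left)
  then show "parts_op (\<lambda>z. a z + b z) z = parts_op a z + parts_op b z"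
    by (simp add: parts_op_def algebra_simps sum.distrib)
qed

text \<open>A coefficient has the orders of \<open>W\<^sub>\<iota> \<partial>\<^sub>\<iota> \<phi> / \<psi>\<close>, which exceed \<open>(- n, - \<nu>)\<close> by exactly the orders that the
derivative \<open>\<partial>\<^sub>\<iota>\<close> takes away again; the term \<open>\<psi>\<^sup>-\<^sup>1 b\<close> gains even \<open>(2 n, 2 \<nu>)\<close>.  The constant \<open>K\<close> is
independent of the orders of \<open>b\<close>.\<close>

lemma parts_op_symbol_bound:
  "\<exists>K\<ge>0. \<forall>m \<mu> C b. smooth b \<longrightarrow> symbol_bound (Suc k) m \<mu> C b \<longrightarrow>
    symbol_bound k (m - n) (\<mu> - \<nu>) (K * C) (parts_op b)"
proof -
  obtain P where P: "symbol_bound k (- (2 * n)) (- (2 * \<nu>)) P (\<lambda>z. inverse (\<psi> z))"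
    using inverse_psi_SG by (auto simp: SG_iff)
  have "\<exists>D. symbol_bound (Suc k) (ord_x \<iota> - n) (ord_xi \<iota> - \<nu>) D (coef \<iota>)" for \<iota>
    using coef_SG by (auto simp: SG_iff simp del: symbol_bound.simps)
  then obtain D where
    D: "symbol_bound (Suc k) (ord_x \<iota> - n) (ord_xi \<iota> - \<nu>) (D \<iota>) (coef \<iota>)" for \<iota>
    by metis
  define K where "K = 2 ^ k * P + 2 ^ k * (\<Sum>\<iota>\<in>(UNIV :: ('d + 's) set). 2 ^ Suc k * D \<iota>)"
  have K: "K \<ge> 0"
    unfolding K_def using symbol_bound_nonneg[OF P] symbol_bound_nonneg[OF D]
    by (intro add_nonneg_nonneg mult_nonneg_nonneg sum_nonneg) auto
  have "symbol_bound k (m - n) (\<mu> - \<nu>) (K * C) (parts_op b)"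
    if b: "smooth b" and C: "symbol_bound (Suc k) m \<mu> C b" for m \<mu> C b
  proof -
    have 1: "symbol_bound k (m - n) (\<mu> - \<nu>) (2 ^ k * (P * C)) (\<lambda>z. inverse (\<psi> z) * b z)"
      using symbol_bound_mult[OF P symbol_bound_Suc_imp[OF C] smooth_inverse_psi b]
      by (rule symbol_bound_mono) (use n_pos nu_pos in auto)
    have "symbol_bound k (m - n) (\<mu> - \<nu>) (2 ^ Suc k * (D \<iota> * C))
        (partial (dir \<iota>) (\<lambda>z. coef \<iota> z * b z))" for \<iota>
      using symbol_bound_partial[OF symbol_bound_mult[OF D C smooth_coef b], of \<iota> \<iota>]
      by (simp add: algebra_simps)
    then have 2: "symbol_bound k (m - n) (\<mu> - \<nu>) (\<Sum>\<iota>\<in>UNIV. 2 ^ Suc k * (D \<iota> * C))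
        (\<lambda>z. \<Sum>\<iota>\<in>UNIV. partial (dir \<iota>) (\<lambda>z. coef \<iota> z * b z) z)"
      by (intro symbol_bound_sum smooth_partial_coef_mult b) auto
    have s: "smooth (\<lambda>z. \<Sum>\<iota>\<in>UNIV. partial (dir \<iota>) (\<lambda>z. coef \<iota> z * b z) z)"
      by (intro smooth_sum smooth_partial_coef_mult b finite)
    have i: "symbol_bound k 0 0 1 (\<lambda>z :: (real^'d) \<times> (real^'s). \<i>)"
      by (rule symbol_bound_const) simp
    have 3: "symbol_bound k (m - n) (\<mu> - \<nu>) (2 ^ k * (1 * (\<Sum>\<iota>\<in>UNIV. 2 ^ Suc k * (D \<iota> * C))))
        (\<lambda>z. \<i> * (\<Sum>\<iota>\<in>UNIV. partial (dir \<iota>) (\<lambda>z. coef \<iota> z * b z) z))"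
      using symbol_bound_mult[OF i 2 smooth_const s] by simp
    have "symbol_bound k (m - n) (\<mu> - \<nu>)
        (2 ^ k * (P * C) + 2 ^ k * (1 * (\<Sum>\<iota>\<in>UNIV. 2 ^ Suc k * (D \<iota> * C)))) (parts_op b)"
      unfolding parts_op_def[abs_def]
      by (intro symbol_bound_add 1 3 smooth_mult smooth_inverse_psi b smooth_const s)
    moreover have "2 ^ k * (P * C) + 2 ^ k * (1 * (\<Sum>\<iota>\<in>UNIV. 2 ^ Suc k * (D \<iota> * C))) = K * C"
      by (simp add: K_def algebra_simps sum_distrib_left sum_distrib_right)
    ultimately show ?thesis by simp
  qed
  with K show ?thesis by blast
qed

lemma smooth_parts_op_power: "smooth b \<Longrightarrow> smooth ((parts_op ^^ r) b)"
  by (induction r) (auto intro: smooth_parts_op)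

lemma parts_op_power_add:
  "smooth a \<Longrightarrow> smooth b \<Longrightarrow> (parts_op ^^ r) (\<lambda>z. a z + b z) = (\<lambda>z. (parts_op ^^ r) a z + (parts_op ^^ r) b z)"
  by (induction r) (simp_all add: parts_op_add smooth_parts_op_power)

lemma parts_op_power_symbol_bound:
  "\<exists>K\<ge>0. \<forall>m \<mu> C b. smooth b \<longrightarrow> symbol_bound (r + k) m \<mu> C b \<longrightarrow>
    symbol_bound k (m - r * n) (\<mu> - r * \<nu>) (K * C) ((parts_op ^^ r) b)"
proof (induction r arbitrary: k)
  case 0
  then show ?case by (intro exI[of _ 1]) auto
next
  case (Suc r)
  obtain K where K: "K \<ge> 0" "\<And>m \<mu> C b. smooth b \<Longrightarrow> symbol_bound (r + Suc k) m \<mu> C b \<Longrightarrow>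
      symbol_bound (Suc k) (m - r * n) (\<mu> - r * \<nu>) (K * C) ((parts_op ^^ r) b)"
    using Suc.IH[of "Suc k"] by blast
  obtain L where L: "L \<ge> 0" "\<And>m \<mu> C b. smooth b \<Longrightarrow> symbol_bound (Suc k) m \<mu> C b \<Longrightarrow>
      symbol_bound k (m - n) (\<mu> - \<nu>) (L * C) (parts_op b)"
    using parts_op_symbol_bound[of k] by blast
  have "symbol_bound k (m - Suc r * n) (\<mu> - Suc r * \<nu>) (L * K * C) ((parts_op ^^ Suc r) b)"
    if "smooth b" "symbol_bound (Suc r + k) m \<mu> C b" for m \<mu> C b
    using L(2)[OF smooth_parts_op_power[OF that(1)] K(2)[OF that(1)]] that(2)
    by (simp add: algebra_simps del: symbol_bound.simps)
  with K(1) L(1) show ?case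
    by (intro exI[of _ "L * K"]) simp
qed

lemma parts_op_SG_minf: "b \<in> SG_minf \<Longrightarrow> parts_op b \<in> SG_minf"
  unfolding parts_op_def[abs_def]
  by (intro SG_minf_add SG_minf_mult[OF inverse_psi_SG] SG_minf_mult[OF SG_const] SG_minf_sum
      SG_minf_partial SG_minf_mult[OF coef_SG] finite)

definition osc :: "(real^'d) \<times> (real^'s) \<Rightarrow> complex" where
  "osc z = exp (\<i> * \<Phi> z)"

lemma norm_osc: "cmod (osc z) = 1"
  by (simp add: osc_def \<Phi>_def)

lemma smooth_osc: "smooth osc"
  unfolding osc_def[abs_def] by (intro smooth_exp smooth_mult smooth_const smooth_Phi)

lemma partial_osc: "partial v osc = (\<lambda>z. \<i> * partial v \<Phi> z * osc z)"
proof -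
  have "partial v (\<lambda>z. \<i> * \<Phi> z) = (\<lambda>z. \<i> * partial v \<Phi> z)"
    using partial_mult[OF smooth_differentiable[OF smooth_const[of \<i>]] smooth_differentiable[OF smooth_Phi], of v]
    by (simp add: partial_const)
  then show ?thesis
    unfolding osc_def[abs_def]
    by (subst partial_exp[OF smooth_differentiable[OF smooth_mult[OF smooth_const smooth_Phi]]]) simp
qed

abbreviation decay :: real where "decay \<equiv> - real (2 * domain_dim \<phi>)"

definition weight_integral :: real where
  "weight_integral = (LINT z|lborel. weight decay decay (z :: (real^'d) \<times> (real^'s)))"

lemma osc_measurable [measurable]: "osc \<in> borel_measurable borel"
  by (rule borel_measurable_continuous_onI[OF smooth_continuous[OF smooth_osc]])

lemma osc_integrable_bound:
  assumes b: "smooth b" "symbol_bound 0 m \<mu> C b" and m: "m \<le> decay" "\<mu> \<le> decay"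
  shows "integrable lborel (\<lambda>z. osc z * b z)"
    and "cmod (LINT z|lborel. osc z * b z) \<le> C * weight_integral"
proof -
  have [measurable]: "b \<in> borel_measurable borel"
    by (rule borel_measurable_continuous_onI[OF smooth_continuous[OF b(1)]])
  have w: "integrable lborel (\<lambda>z :: (real^'d) \<times> (real^'s). C * weight decay decay z)"
    by (intro integrable_mult_right weight_integrable) (auto simp: domain_dim_def)
  have le: "cmod (osc z * b z) \<le> C * weight decay decay z" for z
    using symbol_bound_mono[OF b(2) m order_refl order_refl] by (simp add: norm_mult norm_osc)
  show int: "integrable lborel (\<lambda>z. osc z * b z)"
    by (rule Bochner_Integration.integrable_bound[OF w])
      (auto intro!: AE_I2 order_trans[OF le])
  have "cmod (LINT z|lborel. osc z * b z) \<le> (LINT z|lborel. cmod (osc z * b z))"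
    by (rule integral_norm_bound)
  also have "\<dots> \<le> (LINT z|lborel. C * weight decay decay (z :: (real^'d) \<times> (real^'s)))"
    by (intro integral_mono w integrable_norm int le)
  finally show "cmod (LINT z|lborel. osc z * b z) \<le> C * weight_integral"
    by (simp add: weight_integral_def)
qed

lemma osc_integrable_minf:
  assumes "b \<in> SG_minf"
  shows "integrable lborel (\<lambda>z. osc z * b z)"
proof -
  have "b \<in> SG decay decay"
    using assms by (simp add: SG_minf_iff)
  then obtain C where "symbol_bound 0 decay decay C b"
    unfolding SG_iff by blast
  then show ?thesis
    using osc_integrable_bound(1)[OF SG_minf_smooth[OF assms]] by blast
qed

text \<open>The difference of the two integrands is a combination of the derivatives of the rapidly decreasing
functions \<open>e\<^sup>i\<^sup>\<phi> coef\<^sub>\<iota> b\<close>, each of which integrates to zero.\<close>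

lemma osc_integral_parts_op:
  assumes b: "b \<in> SG_minf"
  shows "(LINT z|lborel. osc z * parts_op b z) = (LINT z|lborel. osc z * b z)"
proof -
  let ?c = "\<lambda>\<iota> z. coef \<iota> z * b z"
  let ?F = "\<lambda>\<iota> z. osc z * ?c \<iota> z"
  have c: "?c \<iota> \<in> SG_minf" for \<iota>
    by (rule SG_minf_mult[OF coef_SG b])
  \<comment> \<open>The product rule separates the derivative of the exponential from that of the amplitude.\<close>
  have dF: "partial (dir \<iota>) (?F \<iota>) =
      (\<lambda>z. osc z * ((\<i> * partial (dir \<iota>) \<Phi> z) * ?c \<iota> z) + osc z * partial (dir \<iota>) (?c \<iota>) z)" for \<iota>
    using partial_mult[OF smooth_differentiable[OF smooth_osc]
        smooth_differentiable[OF SG_minf_smooth[OF c[of \<iota>]]], of "dir \<iota>"]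
    by (simp add: partial_osc mult_ac)
  have "(\<lambda>z. \<i> * partial (dir \<iota>) \<Phi> z) \<in> SG (n - ord_x \<iota>) (\<nu> - ord_xi \<iota>)" for \<iota>
    by (intro SG_cmult SG_partial Phi_SG)
  then have intd: "integrable lborel (partial (dir \<iota>) (?F \<iota>))" for \<iota>
    unfolding dF by (intro Bochner_Integration.integrable_add osc_integrable_minf SG_minf_mult c
        SG_minf_partial)
  have zero: "(LINT z|lborel. partial (dir \<iota>) (?F \<iota>) z) = 0" for \<iota>
    by (intro integral_partial_eq_0 smooth_mult smooth_osc osc_integrable_minf intd c
        SG_minf_smooth)
  have "osc z * parts_op b z = osc z * b z + \<i> * (\<Sum>\<iota>\<in>UNIV. partial (dir \<iota>) (?F \<iota>) z)" for z
  proof -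
    have "\<i> * (\<Sum>\<iota>\<in>UNIV. partial (dir \<iota>) (?F \<iota>) z) =
        - osc z * (\<Sum>\<iota>\<in>UNIV. partial (dir \<iota>) \<Phi> z * ?c \<iota> z) +
        \<i> * osc z * (\<Sum>\<iota>\<in>UNIV. partial (dir \<iota>) (?c \<iota>) z)"
      unfolding dF
      by (simp add: sum.distrib sum_distrib_left distrib_left mult_ac sum_negf
          flip: mult.assoc[of \<i> \<i>])
    moreover have "(\<Sum>\<iota>\<in>UNIV. partial (dir \<iota>) \<Phi> z * ?c \<iota> z) = inverse (\<psi> z) * b z * (\<psi> z - 1)"
    proof -
      have "\<psi> z - 1 =
          (\<Sum>\<iota>\<in>UNIV. complex_of_real (jap_sq \<iota> z) * (partial (dir \<iota>) \<Phi> z * partial (dir \<iota>) \<Phi> z))"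
        by (simp add: \<psi>_def)
      then show ?thesis
        by (simp add: coef_def sum_distrib_left mult_ac)
    qed
    moreover have "inverse (\<psi> z) * b z * (\<psi> z - 1) = b z - inverse (\<psi> z) * b z"
      using psi_nonzero[of z] by (simp add: field_simps)
    ultimately have "osc z * b z + \<i> * (\<Sum>\<iota>\<in>UNIV. partial (dir \<iota>) (?F \<iota>) z) =
        osc z * b z + (- osc z * (b z - inverse (\<psi> z) * b z) +
          \<i> * osc z * (\<Sum>\<iota>\<in>UNIV. partial (dir \<iota>) (?c \<iota>) z))"
      by (simp only:)
    also have "\<dots> = osc z * parts_op b z"
      by (simp add: parts_op_def algebra_simps)
    finally show ?thesis by simp
  qed
  then have "(LINT z|lborel. osc z * parts_op b z) =
      (LINT z|lborel. osc z * b z + \<i> * (\<Sum>\<iota>\<in>UNIV. partial (dir \<iota>) (?F \<iota>) z))"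
    by simp
  also have "\<dots> = (LINT z|lborel. osc z * b z) +
      \<i> * (\<Sum>\<iota>\<in>UNIV. (LINT z|lborel. partial (dir \<iota>) (?F \<iota>) z))"
    using intd by (subst Bochner_Integration.integral_add)
      (auto simp: osc_integrable_minf b Bochner_Integration.integral_sum)
  finally show ?thesis by (simp add: zero)
qed

lemma osc_integral_parts_op_power:
  "b \<in> SG_minf \<Longrightarrow> (LINT z|lborel. osc z * (parts_op ^^ r) b z) = (LINT z|lborel. osc z * b z)"
proof (induction r)
  case (Suc r)
  have "(parts_op ^^ r) b \<in> SG_minf"
    using Suc.prems by (induction r) (auto intro: parts_op_SG_minf)
  then show ?case using Suc by (simp add: osc_integral_parts_op)
qed simp

end

section \<open>The oscillatory integral as a functional on symbols\<close>

context sg_phase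
begin

text \<open>The integral over both variables of \<open>e\<^sup>i\<^sup>\<phi> b\<close> for a symbol \<open>b\<close> of any order.  As a limit of
regularised integrals it is linear and independent of the number of integrations by parts.\<close>

definition osc_functional :: "((real^'d) \<times> (real^'s) \<Rightarrow> complex) \<Rightarrow> complex" where
  "osc_functional b = lim (\<lambda>j. LINT z|lborel. osc z * (regulariser (inverse (real (Suc j))) z * b z))"

text \<open>Integrate by parts \<open>r\<close> times while the integrand still decays rapidly, and only then let \<open>\<epsilon> \<rightarrow> 0\<close>.  The
error is the integral of \<open>e\<^sup>i\<^sup>\<phi>\<close> against the operator power applied to \<open>(g\<^sub>\<epsilon> - 1) b\<close>, whose symbol bounds of order
\<open>(m + 2, \<mu> + 2)\<close> are \<open>O(\<epsilon>)\<close>; the operator lowers these orders below the threshold of integrability.\<close>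

lemma regularised_integral_tendsto:
  assumes b: "b \<in> SG m \<mu>" and r: "m + 2 - r * n \<le> decay" "\<mu> + 2 - r * \<nu> \<le> decay"
  shows "(\<lambda>j. LINT z|lborel. osc z * (regulariser (inverse (real (Suc j))) z * b z))
    \<longlonglongrightarrow> (LINT z|lborel. osc z * (parts_op ^^ r) b z)"
proof -
  let ?\<epsilon> = "\<lambda>j. inverse (real (Suc j))"
  let ?L = "LINT z|lborel. osc z * (parts_op ^^ r) b z"
  obtain K where K: "\<And>m \<mu> C b. smooth b \<Longrightarrow> symbol_bound (r + 0) m \<mu> C b \<Longrightarrow>
      symbol_bound 0 (m - r * n) (\<mu> - r * \<nu>) (K * C) ((parts_op ^^ r) b)"
    using parts_op_power_symbol_bound[of r 0] by blast
  obtain C where C: "\<And>\<epsilon>. 0 < \<epsilon> \<and> \<epsilon> \<le> 1 \<Longrightarrow>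
      symbol_bound (r + 0) (m + 2) (\<mu> + 2) (C * \<epsilon>) (\<lambda>z. regulariser \<epsilon> z * b z - b z)"
    using regularised_symbol_approx[OF b, of "r + 0"] by blast
  note sb = SG_smooth[OF b]
  obtain B where B: "symbol_bound (r + 0) m \<mu> B b"
    using b unfolding SG_iff by blast
  have int_b: "integrable lborel (\<lambda>z. osc z * (parts_op ^^ r) b z)"
    by (rule osc_integrable_bound(1)[OF smooth_parts_op_power[OF sb] K[OF sb B]]) (use r in auto)
  have le: "norm ((LINT z|lborel. osc z * (regulariser (?\<epsilon> j) z * b z)) - ?L) \<le> (K * C * weight_integral) * ?\<epsilon> j" for j
  proof -
    let ?d = "\<lambda>z. regulariser (?\<epsilon> j) z * b z - b z"
    have \<epsilon>: "0 < ?\<epsilon> j \<and> ?\<epsilon> j \<le> 1"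
      by (simp add: inverse_le_1_iff)
    have gb: "(\<lambda>z. regulariser (?\<epsilon> j) z * b z) \<in> SG_minf"
      using regularised_symbol[OF b] \<epsilon> by blast
    have sd: "smooth ?d"
      using smooth_add[OF SG_minf_smooth[OF gb] smooth_mult[OF smooth_const[of "- 1"] sb]] by simp
    note d = K[OF sd C[OF \<epsilon>]]
    have int_d: "integrable lborel (\<lambda>z. osc z * (parts_op ^^ r) ?d z)"
      and le_d: "cmod (LINT z|lborel. osc z * (parts_op ^^ r) ?d z) \<le> K * (C * ?\<epsilon> j) * weight_integral"
      using osc_integrable_bound[OF smooth_parts_op_power[OF sd] d] r by auto
    have "(LINT z|lborel. osc z * (regulariser (?\<epsilon> j) z * b z)) =
        (LINT z|lborel. osc z * (parts_op ^^ r) (\<lambda>z. regulariser (?\<epsilon> j) z * b z) z)"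
      using osc_integral_parts_op_power[OF gb] by simp
    also have "(parts_op ^^ r) (\<lambda>z. regulariser (?\<epsilon> j) z * b z) = (\<lambda>z. (parts_op ^^ r) b z + (parts_op ^^ r) ?d z)"
      using parts_op_power_add[OF sb sd, of r] by simp
    also have "(LINT z|lborel. osc z * ((parts_op ^^ r) b z + (parts_op ^^ r) ?d z)) =
        ?L + (LINT z|lborel. osc z * (parts_op ^^ r) ?d z)"
      using int_b int_d by (simp add: distrib_left)
    finally show ?thesis using le_d by (simp add: mult_ac)
  qed
  have "(\<lambda>j. (K * C * weight_integral) * ?\<epsilon> j) \<longlonglongrightarrow> 0"
    using tendsto_mult[OF tendsto_const[of "K * C * weight_integral"] LIMSEQ_inverse_real_of_nat] by simp
  then have "(\<lambda>j. (LINT z|lborel. osc z * (regulariser (?\<epsilon> j) z * b z)) - ?L) \<longlonglongrightarrow> 0"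
    by (rule Lim_null_comparison[OF always_eventually[OF allI[OF le]]])
  then show ?thesis by (rule LIM_zero_cancel)
qed

lemma osc_functional_eq:
  "b \<in> SG m \<mu> \<Longrightarrow> m + 2 - r * n \<le> decay \<Longrightarrow> \<mu> + 2 - r * \<nu> \<le> decay \<Longrightarrow>
    osc_functional b = (LINT z|lborel. osc z * (parts_op ^^ r) b z)"
  unfolding osc_functional_def by (rule limI[OF regularised_integral_tendsto])

lemma enough_integrations_by_parts:
  "\<exists>r::nat. m + 2 - r * n \<le> decay \<and> \<mu> + 2 - r * \<nu> \<le> decay"
proof -
  obtain r :: nat where "max ((m + 2 - decay) / n) ((\<mu> + 2 - decay) / \<nu>) \<le> real r"
    using real_arch_simple by blast
  then show ?thesis
    using n_pos nu_pos by (intro exI[of _ r]) (auto simp: pos_divide_le_eq)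
qed

lemma osc_functional_tendsto:
  assumes "b \<in> SG m \<mu>"
  shows "(\<lambda>j. LINT z|lborel. osc z * (regulariser (inverse (real (Suc j))) z * b z)) \<longlonglongrightarrow> osc_functional b"
proof -
  obtain r :: nat where r: "m + 2 - r * n \<le> decay" "\<mu> + 2 - r * \<nu> \<le> decay"
    using enough_integrations_by_parts by blast
  show ?thesis
    using regularised_integral_tendsto[OF assms r] osc_functional_eq[OF assms r] by simp
qed

text \<open>The case \<open>r = 0\<close>, as \<open>b\<close> has orders as low as one likes.\<close>

lemma osc_functional_minf: "b \<in> SG_minf \<Longrightarrow> osc_functional b = (LINT z|lborel. osc z * b z)"
  using osc_functional_eq[of b "decay - 2" "decay - 2" 0] by (simp add: SG_minf_iff)

lemma osc_functional_bound:
  "\<exists>k K. K \<ge> 0 \<and> (\<forall>b C. b \<in> SG m \<mu> \<longrightarrow> symbol_bound k m \<mu> C b \<longrightarrow> cmod (osc_functional b) \<le> K * C)"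
proof -
  obtain r :: nat where r: "m + 2 - r * n \<le> decay" "\<mu> + 2 - r * \<nu> \<le> decay"
    using enough_integrations_by_parts by blast
  obtain K where K: "K \<ge> 0" "\<And>m \<mu> C b. smooth b \<Longrightarrow> symbol_bound (r + 0) m \<mu> C b \<Longrightarrow>
      symbol_bound 0 (m - r * n) (\<mu> - r * \<nu>) (K * C) ((parts_op ^^ r) b)"
    using parts_op_power_symbol_bound[of r 0] by blast
  have weight_integral: "weight_integral \<ge> 0"
    unfolding weight_integral_def by (intro Bochner_Integration.integral_nonneg) (auto simp: weight_pos less_imp_le)
  have "cmod (osc_functional b) \<le> (K * weight_integral) * C" if b: "b \<in> SG m \<mu>" and C: "symbol_bound (r + 0) m \<mu> C b" for b C
    using osc_integrable_bound(2)[OF smooth_parts_op_power[OF SG_smooth[OF b]] K(2)[OF SG_smooth[OF b] C]] r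
    by (simp add: osc_functional_eq[OF b r] mult_ac)
  then show ?thesis
    using K(1) weight_integral by (intro exI[of _ "r + 0"] exI[of _ "K * weight_integral"]) auto
qed

lemma osc_functional_add:
  assumes a: "a \<in> SG m \<mu>" and b: "b \<in> SG m \<mu>"
  shows "osc_functional (\<lambda>z. a z + b z) = osc_functional a + osc_functional b"
proof (rule LIMSEQ_unique[OF osc_functional_tendsto[OF SG_add[OF a b]]])
  have "(LINT z|lborel. osc z * (regulariser (inverse (real (Suc j))) z * (a z + b z))) =
      (LINT z|lborel. osc z * (regulariser (inverse (real (Suc j))) z * a z)) +
      (LINT z|lborel. osc z * (regulariser (inverse (real (Suc j))) z * b z))" for j
    unfolding distrib_left
    by (intro Bochner_Integration.integral_add osc_integrable_minf regularised_symbol[OF a]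
        regularised_symbol[OF b]) (auto simp: inverse_le_1_iff)
  then show "(\<lambda>j. LINT z|lborel. osc z * (regulariser (inverse (real (Suc j))) z * (a z + b z)))
      \<longlonglongrightarrow> osc_functional a + osc_functional b"
    using tendsto_add[OF osc_functional_tendsto[OF a] osc_functional_tendsto[OF b]] by simp
qed

lemma osc_functional_cmult:
  assumes a: "a \<in> SG m \<mu>"
  shows "osc_functional (\<lambda>z. c * a z) = c * osc_functional a"
proof (rule LIMSEQ_unique[OF osc_functional_tendsto[OF SG_cmult[OF a]]])
  have "(LINT z|lborel. osc z * (regulariser (inverse (real (Suc j))) z * (c * a z))) =
      c * (LINT z|lborel. osc z * (regulariser (inverse (real (Suc j))) z * a z))" for j
    by (simp add: mult.left_commute[of _ c])
  then show "(\<lambda>j. LINT z|lborel. osc z * (regulariser (inverse (real (Suc j))) z * (c * a z)))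
      \<longlonglongrightarrow> c * osc_functional a"
    using tendsto_mult[OF tendsto_const[of c] osc_functional_tendsto[OF a]] by simp
qed

end

section \<open>Schwartz functions as symbols\<close>

lemma iter_partial_add:
  "smooth f \<Longrightarrow> smooth g \<Longrightarrow>
    iter_partial e ws (\<lambda>x. f x + g x) = (\<lambda>x. iter_partial e ws f x + iter_partial e ws g x)"
  by (induction ws arbitrary: f g) (simp_all add: partial_add smooth_differentiable smooth_partial)

lemma iter_partial_cmult:
  fixes f :: "'v::euclidean_space \<Rightarrow> complex"
  shows "smooth f \<Longrightarrow> iter_partial e ws (\<lambda>x. c * f x) = (\<lambda>x. c * iter_partial e ws f x)"
  by (induction ws arbitrary: f)
    (simp_all add: partial_mult partial_const smooth_differentiable smooth_partial smooth_const)

lemma iter_partial_zero: "iter_partial e ws (\<lambda>x. 0) = (\<lambda>x. 0)"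
  by (induction ws) (simp_all add: partial_const)

abbreviation schwartz_deriv :: "('d \<Rightarrow> nat) \<Rightarrow> (real^'d::finite \<Rightarrow> complex) \<Rightarrow> real^'d \<Rightarrow> complex" where
  "schwartz_deriv \<equiv> mi_partial (\<lambda>i. axis i 1)"

lemma schwartz_smooth: "f \<in> schwartz \<Longrightarrow> smooth f"
  by (simp add: schwartz_def)

lemma schwartz_bdd: "f \<in> schwartz \<Longrightarrow> bdd_above (range (\<lambda>x. jap x ^ k * cmod (schwartz_deriv \<alpha> f x)))"
  unfolding schwartz_def bdd_above_def by (auto simp: image_iff)

lemma schwartz_seminorm_upper:
  "f \<in> schwartz \<Longrightarrow> jap x ^ k * cmod (schwartz_deriv \<alpha> f x) \<le> schwartz_seminorm k \<alpha> f"
  unfolding schwartz_seminorm_def by (rule cSUP_upper[OF _ schwartz_bdd]) auto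

lemma schwartz_seminorm_least:
  "(\<And>x. jap x ^ k * cmod (schwartz_deriv \<alpha> f x) \<le> C) \<Longrightarrow> schwartz_seminorm k \<alpha> f \<le> C"
  unfolding schwartz_seminorm_def by (rule cSUP_least) auto

lemma schwartz_add:
  assumes f: "f \<in> schwartz" and g: "g \<in> schwartz"
  shows "(\<lambda>x. f x + g x) \<in> schwartz"
    and "schwartz_seminorm k \<alpha> (\<lambda>x. f x + g x) \<le> schwartz_seminorm k \<alpha> f + schwartz_seminorm k \<alpha> g"
proof -
  have le: "jap x ^ k * cmod (schwartz_deriv \<alpha> (\<lambda>x. f x + g x) x) \<le>
      schwartz_seminorm k \<alpha> f + schwartz_seminorm k \<alpha> g" for x k \<alpha>
  proof -
    have "jap x ^ k * cmod (schwartz_deriv \<alpha> (\<lambda>x. f x + g x) x) \<le>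
        jap x ^ k * (cmod (schwartz_deriv \<alpha> f x) + cmod (schwartz_deriv \<alpha> g x))"
      using jap_pos[of x] schwartz_smooth[OF f] schwartz_smooth[OF g]
      by (simp add: mi_partial_eq_iter iter_partial_add norm_triangle_ineq)
    then show ?thesis
      using schwartz_seminorm_upper[OF f, of x k \<alpha>] schwartz_seminorm_upper[OF g, of x k \<alpha>]
      by (simp add: distrib_left)
  qed
  then show "(\<lambda>x. f x + g x) \<in> schwartz"
    using schwartz_smooth[OF f] schwartz_smooth[OF g] by (auto simp: schwartz_def)
  show "schwartz_seminorm k \<alpha> (\<lambda>x. f x + g x) \<le> schwartz_seminorm k \<alpha> f + schwartz_seminorm k \<alpha> g"
    by (rule schwartz_seminorm_least) (rule le)
qed

lemma schwartz_cmult: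
  assumes f: "f \<in> schwartz"
  shows "(\<lambda>x. c * f x) \<in> schwartz"
    and "schwartz_seminorm k \<alpha> (\<lambda>x. c * f x) \<le> cmod c * schwartz_seminorm k \<alpha> f"
proof -
  have le: "jap x ^ k * cmod (schwartz_deriv \<alpha> (\<lambda>x. c * f x) x) \<le> cmod c * schwartz_seminorm k \<alpha> f"
    for x k \<alpha>
    using mult_left_mono[OF schwartz_seminorm_upper[OF f, of x k \<alpha>] norm_ge_zero[of c]]
    by (simp add: mi_partial_eq_iter iter_partial_cmult schwartz_smooth[OF f] norm_mult mult_ac)
  then show "(\<lambda>x. c * f x) \<in> schwartz"
    using schwartz_smooth[OF f] by (auto simp: schwartz_def)
  show "schwartz_seminorm k \<alpha> (\<lambda>x. c * f x) \<le> cmod c * schwartz_seminorm k \<alpha> f"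
    by (rule schwartz_seminorm_least) (rule le)
qed

lemma schwartz_diff:
  "f \<in> schwartz \<Longrightarrow> g \<in> schwartz \<Longrightarrow> (\<lambda>x. f x - g x) \<in> schwartz"
  using schwartz_add(1)[OF _ schwartz_cmult(1)[of g "- 1"]] by simp

lemma zero_in_schwartz: "(\<lambda>x. 0) \<in> (schwartz :: (real^'d::finite \<Rightarrow> complex) set)"
  and schwartz_seminorm_zero: "schwartz_seminorm k \<alpha> (\<lambda>x :: real^'d::finite. 0) \<le> 0"
proof -
  have "schwartz_deriv \<alpha> (\<lambda>x. 0) x = 0" for \<alpha> and x :: "real^'d"
    by (simp add: mi_partial_eq_iter iter_partial_zero)
  then show "(\<lambda>x :: real^'d. 0) \<in> schwartz" "schwartz_seminorm k \<alpha> (\<lambda>x :: real^'d. 0) \<le> 0"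
    by (auto simp: schwartz_def intro: schwartz_seminorm_least)
qed

text \<open>Derivatives in \<open>\<xi>\<close> vanish, and those in \<open>x\<close> are derivatives of \<open>f\<close>.\<close>

lemma symbol_bound_fst:
  fixes m :: real and f :: "real^'d::finite \<Rightarrow> complex"
  assumes "smooth f" "C \<ge> 0"
    and "\<And>ws x. length ws \<le> k \<Longrightarrow>
      cmod (iter_partial (\<lambda>i. axis i 1) ws f x) \<le> C * jap x powr (m - length ws)"
  shows "symbol_bound k m 0 C (\<lambda>z :: (real^'d::finite) \<times> (real^'s::finite). f (fst z))"
  using assms
proof (induction k arbitrary: f m)
  case 0
  then show ?case
    using 0(3)[of "[]"] less_imp_neq[OF jap_pos] by (auto simp: weight_def)
next
  case (Suc k)
  have "cmod (f (fst z)) \<le> C * weight m 0 z" for z :: "(real^'d) \<times> (real^'s)"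
    using Suc.prems(3)[of "[]" "fst z"] jap_pos[of "snd z"] by (simp add: weight_def)
  moreover have "symbol_bound k (m - ord_x \<iota>) (0 - ord_xi \<iota>) C
      (partial (dir \<iota>) (\<lambda>z :: (real^'d) \<times> (real^'s). f (fst z)))" for \<iota> :: "'d + 's"
  proof -
    have p: "partial (dir \<iota>) (\<lambda>z :: (real^'d) \<times> (real^'s). f (fst z)) =
        (\<lambda>z. partial (fst (dir \<iota> :: (real^'d) \<times> (real^'s))) f (fst z))"
      by (rule partial_comp_linear[OF bounded_linear_fst smooth_differentiable[OF Suc.prems(1)]])
    show ?thesis
    proof (cases \<iota>)
      case (Inl i)
      have "symbol_bound k (m - 1) 0 C (\<lambda>z :: (real^'d) \<times> (real^'s). partial (axis i 1) f (fst z))"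
      proof (rule Suc.IH[OF smooth_partial[OF Suc.prems(1)] Suc.prems(2)])
        fix ws :: "'d list" and x assume "length ws \<le> k"
        then show "cmod (iter_partial (\<lambda>i. axis i 1) ws (partial (axis i 1) f) x) \<le>
            C * jap x powr (m - 1 - length ws)"
          using Suc.prems(3)[of "i # ws" x] by (simp add: algebra_simps)
      qed
      then show ?thesis unfolding p by (simp add: Inl)
    next
      case (Inr j)
      have "partial 0 f = (\<lambda>x. 0)"
        using linear_0[OF has_derivative_linear[OF smooth_has_derivative[OF Suc.prems(1)]]] by auto
      then show ?thesis unfolding p by (simp add: Inr symbol_bound_zero[OF Suc.prems(2)])
    qed
  qed
  ultimately show ?case by simp
qed

text \<open>One norm that dominates all Schwartz seminorms entering the estimate of \<open>k\<close> derivatives.\<close>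

definition schwartz_norm :: "nat \<Rightarrow> (real^'d::finite \<Rightarrow> complex) \<Rightarrow> real" where
  "schwartz_norm k f = (\<Sum>\<alpha>\<in>{..\<lambda>_. k}. schwartz_seminorm k \<alpha> f)"

lemma schwartz_seminorm_nonneg: "f \<in> schwartz \<Longrightarrow> schwartz_seminorm k \<alpha> f \<ge> 0"
  by (rule order_trans[OF _ schwartz_seminorm_upper[of f 0]]) (auto simp: jap_pos less_imp_le)

lemma schwartz_norm_nonneg: "f \<in> schwartz \<Longrightarrow> schwartz_norm k f \<ge> 0"
  unfolding schwartz_norm_def by (intro sum_nonneg schwartz_seminorm_nonneg)

lemma schwartz_symbol_bound:
  assumes f: "f \<in> schwartz"
  shows "symbol_bound k 0 0 (schwartz_norm k f) (\<lambda>z :: (real^'d::finite) \<times> (real^'s::finite). f (fst z))"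
proof (rule symbol_bound_fst[OF schwartz_smooth[OF f] schwartz_norm_nonneg[OF f]])
  fix ws :: "'d list" and x assume ws: "length ws \<le> k"
  let ?\<alpha> = "count (mset ws)"
  have "?\<alpha> i \<le> k" for i
    using count_le_size[of "mset ws" i] ws by simp
  then have \<alpha>: "?\<alpha> \<in> {..\<lambda>_. k}" by (auto simp: le_fun_def)
  have "jap x ^ length ws * cmod (schwartz_deriv ?\<alpha> f x) \<le> jap x ^ k * cmod (schwartz_deriv ?\<alpha> f x)"
    by (intro mult_right_mono power_increasing ws jap_ge_1) auto
  also have "\<dots> \<le> schwartz_seminorm k ?\<alpha> f"
    by (rule schwartz_seminorm_upper[OF f])
  also have "\<dots> \<le> schwartz_norm k f"
    unfolding schwartz_norm_def
    by (rule member_le_sum[OF \<alpha>]) (auto intro: schwartz_seminorm_nonneg f finite_atMost_mi)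
  finally have "cmod (schwartz_deriv ?\<alpha> f x) \<le> schwartz_norm k f / jap x ^ length ws"
    using jap_pos[of x] by (simp add: pos_le_divide_eq mult.commute)
  also have "\<dots> = schwartz_norm k f * jap x powr (0 - real (length ws))"
    using jap_pos[of x] by (simp add: powr_minus powr_realpow divide_inverse)
  finally show "cmod (iter_partial (\<lambda>i. axis i 1) ws f x) \<le> schwartz_norm k f * jap x powr (0 - real (length ws))"
    by (simp add: iter_partial_eq_mi schwartz_smooth[OF f])
qed

lemma schwartz_SG:
  "f \<in> schwartz \<Longrightarrow> (\<lambda>z :: (real^'d::finite) \<times> (real^'s::finite). f (fst z)) \<in> SG 0 0"
  unfolding SG_iff using schwartz_symbol_bound
    smooth_comp_linear[OF bounded_linear_fst schwartz_smooth] by blast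

lemma SG_times_schwartz:
  fixes a :: "(real^'d::finite) \<times> (real^'s::finite) \<Rightarrow> complex"
  assumes "a \<in> SG m \<mu>" "f \<in> schwartz"
  shows "(\<lambda>z. a z * f (fst z)) \<in> SG m \<mu>"
  using SG_mult[OF assms(1) schwartz_SG[OF assms(2)]] by simp

section \<open>Topologies defined by seminorms\<close>

text \<open>\<open>S\<close> contains a ball around \<open>f\<close> for the maximum of finitely many seminorms of the family.\<close>

definition seminorm_nhd ::
  "('z \<Rightarrow> complex) set \<Rightarrow> (('z \<Rightarrow> complex) \<Rightarrow> real) set \<Rightarrow> ('z \<Rightarrow> complex) set \<Rightarrow> ('z \<Rightarrow> complex) \<Rightarrow> bool" where
  "seminorm_nhd V P S f \<longleftrightarrow>
    (\<exists>F\<subseteq>P. finite F \<and> (\<exists>\<delta>>0. \<forall>g\<in>V. (\<forall>p\<in>F. p (\<lambda>z. g z - f z) < \<delta>) \<longrightarrow> g \<in> S))"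

lemma seminorm_nhdI:
  "F \<subseteq> P \<Longrightarrow> finite F \<Longrightarrow> \<delta> > 0 \<Longrightarrow>
    (\<And>g. g \<in> V \<Longrightarrow> (\<And>p. p \<in> F \<Longrightarrow> p (\<lambda>z. g z - f z) < \<delta>) \<Longrightarrow> g \<in> S) \<Longrightarrow> seminorm_nhd V P S f"
  unfolding seminorm_nhd_def by (intro exI[of _ F] conjI exI[of _ \<delta>]) simp_all

lemma seminorm_nhdE:
  assumes "seminorm_nhd V P S f"
  obtains F \<delta> where "F \<subseteq> P" "finite F" "\<delta> > 0"
    "\<forall>g\<in>V. (\<forall>p\<in>F. p (\<lambda>z. g z - f z) < \<delta>) \<longrightarrow> g \<in> S"
  using assms unfolding seminorm_nhd_def by (elim exE conjE) (rule that)

lemma openin_seminorm_topologyI: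
  assumes zero: "\<forall>p\<in>P. p (\<lambda>z. 0) \<le> 0" and S: "S \<subseteq> V"
    and ball: "\<And>f. f \<in> S \<Longrightarrow> seminorm_nhd V P S f"
  shows "openin (seminorm_topology V P) S"
proof (subst openin_subopen, intro ballI)
  fix f assume f: "f \<in> S"
  obtain F \<delta> where F: "F \<subseteq> P" "finite F" and \<delta>: "\<delta> > 0"
    and sub: "\<forall>g\<in>V. (\<forall>p\<in>F. p (\<lambda>z. g z - f z) < \<delta>) \<longrightarrow> g \<in> S"
    using ball[OF f] by (rule seminorm_nhdE)
  define B where "B p = {g \<in> V. p (\<lambda>z. g z - f z) < \<delta>}" for p
  let ?U = "\<Inter>(insert V (B ` F))"
  have "openin (seminorm_topology V P) V"
    unfolding seminorm_topology_def by (rule topology_generated_by_Basis) simp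
  moreover have "openin (seminorm_topology V P) (B p)" if "p \<in> F" for p
  proof -
    have "p \<in> P" "f \<in> V" using that F f S by auto
    then show ?thesis
      unfolding seminorm_topology_def B_def using \<delta>
      by (intro topology_generated_by_Basis insertI2 CollectI exI[of _ p] exI[of _ f] exI[of _ \<delta>])
        simp
  qed
  ultimately have "openin (seminorm_topology V P) ?U"
    using F(2) by (intro openin_Inter) auto
  moreover have "f \<in> ?U"
    using f S F zero \<delta> by (auto simp: B_def intro: le_less_trans)
  moreover have "?U \<subseteq> S"
    using sub by (auto simp: B_def)
  ultimately show "\<exists>T. openin (seminorm_topology V P) T \<and> f \<in> T \<and> T \<subseteq> S"
    by blast
qed

text \<open>The topology is generated by balls around arbitrary centres.  By the triangle inequality such a ball
contains a ball around each of its points, and this property survives finite intersections and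
unions.\<close>

lemma openin_seminorm_topology_imp_nhd:
  assumes tri: "\<And>p f g h. p \<in> P \<Longrightarrow> f \<in> V \<Longrightarrow> g \<in> V \<Longrightarrow> h \<in> V \<Longrightarrow>
      p (\<lambda>z. h z - f z) \<le> p (\<lambda>z. h z - g z) + p (\<lambda>z. g z - f z)"
    and S: "openin (seminorm_topology V P) S" and f: "f \<in> S"
  shows "seminorm_nhd V P S f"
proof -
  let ?B = "insert V {{g \<in> V. p (\<lambda>z. g z - f z) < \<epsilon>} | p f \<epsilon>. p \<in> P \<and> f \<in> V \<and> 0 < \<epsilon>}"
  have "generate_topology_on ?B S"
    using S by (simp add: seminorm_topology_def openin_topology_generated_by_iff)
  then show ?thesis
    using f
  proof (induction arbitrary: f)
    case Empty
    then show ?case by simp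
  next
    case (Int a b)
    have a: "seminorm_nhd V P a f" and b: "seminorm_nhd V P b f"
      using Int by auto
    obtain F \<delta> where F: "F \<subseteq> P" "finite F" "\<delta> > 0"
        "\<forall>g\<in>V. (\<forall>p\<in>F. p (\<lambda>z. g z - f z) < \<delta>) \<longrightarrow> g \<in> a"
      using a by (rule seminorm_nhdE)
    obtain G \<eta> where G: "G \<subseteq> P" "finite G" "\<eta> > 0"
        "\<forall>g\<in>V. (\<forall>p\<in>G. p (\<lambda>z. g z - f z) < \<eta>) \<longrightarrow> g \<in> b"
      using b by (rule seminorm_nhdE)
    show ?case
    proof (rule seminorm_nhdI[of "F \<union> G" _ "min \<delta> \<eta>"])
      fix g assume "g \<in> V" "\<And>p. p \<in> F \<union> G \<Longrightarrow> p (\<lambda>z. g z - f z) < min \<delta> \<eta>"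
      then show "g \<in> a \<inter> b" using F(4) G(4) by simp
    qed (use F G in auto)
  next
    case (UN K)
    then obtain k where k: "k \<in> K" "f \<in> k" by blast
    obtain F \<delta> where F: "F \<subseteq> P" "finite F" "\<delta> > 0"
        "\<forall>g\<in>V. (\<forall>p\<in>F. p (\<lambda>z. g z - f z) < \<delta>) \<longrightarrow> g \<in> k"
      using UN.IH[OF k] by (rule seminorm_nhdE)
    then show ?case
      using k by (intro seminorm_nhdI[of F _ \<delta>]) auto
  next
    case (Basis s)
    from Basis(1) show ?case
    proof (elim insertE CollectE exE conjE)
      assume "s = V"
      then show ?thesis by (intro seminorm_nhdI[of "{}" _ 1]) auto
    next
      fix p f0 \<epsilon>
      assume s: "s = {g \<in> V. p (\<lambda>z. g z - f0 z) < \<epsilon>}" and p: "p \<in> P" "f0 \<in> V"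
      have f: "f \<in> V" "p (\<lambda>z. f z - f0 z) < \<epsilon>" using Basis(2) s by auto
      show ?thesis
      proof (rule seminorm_nhdI[of "{p}" _ "\<epsilon> - p (\<lambda>z. f z - f0 z)"])
        fix g assume g: "g \<in> V"
          and "\<And>p'. p' \<in> {p} \<Longrightarrow> p' (\<lambda>z. g z - f z) < \<epsilon> - p (\<lambda>z. f z - f0 z)"
        then have "p (\<lambda>z. g z - f z) < \<epsilon> - p (\<lambda>z. f z - f0 z)" by simp
        then show "g \<in> s" using tri[OF p(1) p(2) f(1) g] g by (simp add: s)
      qed (use p f in auto)
    qed
  qed
qed

lemma topspace_seminorm_topology: "topspace (seminorm_topology V P) = V"
  unfolding seminorm_topology_def topology_generated_by_topspace by auto

lemma continuous_map_seminorm_euclidean: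
  fixes u :: "('z \<Rightarrow> complex) \<Rightarrow> complex"
  assumes zero: "\<forall>p\<in>P. p (\<lambda>z. 0) \<le> 0" and F: "finite F" "F \<subseteq> P" and C: "C \<ge> 0"
    and le: "\<And>f g. f \<in> V \<Longrightarrow> g \<in> V \<Longrightarrow> cmod (u g - u f) \<le> C * (\<Sum>p\<in>F. p (\<lambda>z. g z - f z))"
  shows "continuous_map (seminorm_topology V P) euclidean u"
  unfolding continuous_map_def topspace_seminorm_topology
proof (intro conjI allI impI)
  fix U :: "complex set" assume "openin euclidean U"
  then have U: "open U" by simp
  show "openin (seminorm_topology V P) {f \<in> V. u f \<in> U}"
  proof (rule openin_seminorm_topologyI[OF zero])
    fix f assume "f \<in> {f \<in> V. u f \<in> U}"
    then have f: "f \<in> V" "u f \<in> U" by auto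
    then obtain e where e: "e > 0" "\<And>w. dist w (u f) < e \<Longrightarrow> w \<in> U"
      using U unfolding open_dist by blast
    define \<delta> where "\<delta> = e / (C * card F + 1)"
    have pos: "C * card F + 1 > 0" using C by (simp add: add_nonneg_pos)
    have \<delta>: "\<delta> > 0" using e pos by (simp add: \<delta>_def)
    have "u g \<in> U" if g: "g \<in> V" "\<forall>p\<in>F. p (\<lambda>z. g z - f z) < \<delta>" for g
    proof (rule e(2))
      have "dist (u g) (u f) \<le> C * (\<Sum>p\<in>F. p (\<lambda>z. g z - f z))"
        using le[OF f(1) g(1)] by (simp add: dist_norm)
      also have "\<dots> \<le> C * (\<Sum>p\<in>F. \<delta>)"
        using g(2) C by (intro mult_left_mono sum_mono) (auto intro: less_imp_le)
      also have "\<dots> < (C * card F + 1) * \<delta>"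
        using \<delta> by (simp add: algebra_simps)
      also have "\<dots> = e" using pos by (simp add: \<delta>_def)
      finally show "dist (u g) (u f) < e" .
    qed
    then show "seminorm_nhd V P {f \<in> V. u f \<in> U} f"
      using F \<delta> by (intro seminorm_nhdI[of F _ \<delta>]) auto
  qed auto
qed auto

text \<open>The subbasic sets of the target are balls whose centres may lie outside the image of \<open>I\<close>, whence the
triangle inequality for the target seminorms.\<close>

lemma continuous_map_seminorm_topologies:
  assumes zero: "\<forall>p\<in>P. p (\<lambda>z. 0) \<le> 0" and I: "\<And>a. a \<in> V \<Longrightarrow> I a \<in> W"
    and tri: "\<And>q f g h. q \<in> Q \<Longrightarrow> f \<in> W \<Longrightarrow> g \<in> W \<Longrightarrow> h \<in> W \<Longrightarrow>
      q (\<lambda>z. h z - f z) \<le> q (\<lambda>z. h z - g z) + q (\<lambda>z. g z - f z)"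
    and le: "\<And>q. q \<in> Q \<Longrightarrow> \<exists>p\<in>P. \<exists>C\<ge>0. \<forall>a\<in>V. \<forall>b\<in>V. q (\<lambda>z. I b z - I a z) \<le> C * p (\<lambda>z. b z - a z)"
  shows "continuous_map (seminorm_topology V P) (seminorm_topology W Q) I"
  unfolding seminorm_topology_def[of W]
proof (rule continuous_on_generated_topo)
  fix U assume "U \<in> insert W {{g \<in> W. p (\<lambda>z. g z - f z) < \<epsilon>} | p f \<epsilon>. p \<in> Q \<and> f \<in> W \<and> 0 < \<epsilon>}"
  then consider "U = W" | q w \<epsilon> where "q \<in> Q" "w \<in> W" "0 < \<epsilon>"
      "U = {g \<in> W. q (\<lambda>z. g z - w z) < \<epsilon>}"
    by blast
  then have "openin (seminorm_topology V P) {a \<in> V. I a \<in> U}"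
  proof cases
    case 1
    then have "{a \<in> V. I a \<in> U} = topspace (seminorm_topology V P)"
      using I by (auto simp: topspace_seminorm_topology)
    then show ?thesis by simp
  next
    case 2
    show ?thesis
    proof (rule openin_seminorm_topologyI[OF zero])
      fix a assume a: "a \<in> {a \<in> V. I a \<in> U}"
      obtain p C where p: "p \<in> P" "C \<ge> 0"
        "\<And>a b. a \<in> V \<Longrightarrow> b \<in> V \<Longrightarrow> q (\<lambda>z. I b z - I a z) \<le> C * p (\<lambda>z. b z - a z)"
        using le[OF 2(1)] by blast
      define \<eta> where "\<eta> = \<epsilon> - q (\<lambda>z. I a z - w z)"
      have \<eta>: "\<eta> > 0" using a 2 by (simp add: \<eta>_def)
      have \<delta>: "\<eta> / (C + 1) > 0" using \<eta> p(2) by simp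
      have "I b \<in> U" if b: "b \<in> V" "p (\<lambda>z. b z - a z) < \<eta> / (C + 1)" for b
      proof -
        have "q (\<lambda>z. I b z - w z) \<le> q (\<lambda>z. I b z - I a z) + q (\<lambda>z. I a z - w z)"
          using tri[OF 2(1), of w "I a" "I b"] I a b 2 by auto
        also have "q (\<lambda>z. I b z - I a z) \<le> C * p (\<lambda>z. b z - a z)"
          using p(3) a b by blast
        also have "\<dots> \<le> C * (\<eta> / (C + 1))"
          using b(2) p(2) by (intro mult_left_mono) auto
        also have "\<dots> < (C + 1) * (\<eta> / (C + 1))"
          using \<delta> by (intro mult_strict_right_mono) auto
        also have "\<dots> = \<eta>" using p(2) by simp
        finally show ?thesis using I b 2 by (simp add: \<eta>_def)
      qed
      then show "seminorm_nhd V P {a \<in> V. I a \<in> U} a"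
        using p(1) \<delta> by (intro seminorm_nhdI[of "{p}" _ "\<eta> / (C + 1)"]) auto
    qed auto
  qed
  moreover have "I -` U \<inter> topspace (seminorm_topology V P) = {a \<in> V. I a \<in> U}"
    by (auto simp: topspace_seminorm_topology)
  ultimately show "openin (seminorm_topology V P) (I -` U \<inter> topspace (seminorm_topology V P))"
    by simp
qed (use I in \<open>auto simp: topspace_seminorm_topology\<close>)

section \<open>Tempered distributions\<close>

lemma schwartz_topology_zero:
  "\<forall>p\<in>{schwartz_seminorm k \<alpha> | k \<alpha>. True}. p (\<lambda>z :: real^'d::finite. 0) \<le> 0"
  using schwartz_seminorm_zero by auto

lemma schwartz_topology_triangle:
  "p \<in> {schwartz_seminorm k \<alpha> | k \<alpha>. True} \<Longrightarrow> f \<in> schwartz \<Longrightarrow> g \<in> schwartz \<Longrightarrow> h \<in> schwartz \<Longrightarrow>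
    p (\<lambda>z. h z - f z) \<le> p (\<lambda>z. h z - g z) + p (\<lambda>z. g z - f z)"
  using schwartz_add(2)[OF schwartz_diff[of h g] schwartz_diff[of g f]] by auto

text \<open>By continuity at \<open>0\<close> the functional is less than \<open>1\<close> on a ball of finitely many seminorms; a bounded set
shrinks into this ball under multiplication by a small \<open>t > 0\<close>.  This makes the suprema that define
the strong topology finite.\<close>

lemma tempered_bounded_on_bounded:
  assumes u: "u \<in> tempered" and B: "schwartz_bounded B"
  shows "\<exists>C. \<forall>f\<in>B. cmod (u f) \<le> C"
proof -
  have cont: "continuous_map schwartz_topology euclidean u"
    and hom: "\<And>c f. f \<in> schwartz \<Longrightarrow> u (\<lambda>x. c * f x) = c * u f"
    using u by (auto simp: tempered_def)
  have "u (\<lambda>x. 0) = 0"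
    using hom[OF zero_in_schwartz, of 0] by simp
  moreover have "openin schwartz_topology {f \<in> topspace schwartz_topology. u f \<in> ball 0 1}"
    by (rule openin_continuous_map_preimage[OF cont]) simp
  ultimately have op: "openin schwartz_topology {f \<in> schwartz. u f \<in> ball 0 1}"
    and z: "(\<lambda>x. 0) \<in> {f \<in> schwartz. u f \<in> ball 0 1}"
    by (auto simp: schwartz_topology_def topspace_seminorm_topology zero_in_schwartz)
  obtain F \<delta> where F: "F \<subseteq> {schwartz_seminorm k \<alpha> | k \<alpha>. True}" "finite F" "\<delta> > 0"
    and small: "\<forall>g\<in>schwartz. (\<forall>p\<in>F. p (\<lambda>z. g z - 0) < \<delta>) \<longrightarrow>
      g \<in> {f \<in> schwartz. u f \<in> ball 0 1}"
    using openin_seminorm_topology_imp_nhd[OF schwartz_topology_triangle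
          op[unfolded schwartz_topology_def] z] by (rule seminorm_nhdE)
  have "\<forall>p\<in>F. \<exists>C\<ge>0. \<forall>f\<in>B. p f \<le> C"
  proof
    fix p assume "p \<in> F"
    then obtain k \<alpha> where p: "p = schwartz_seminorm k \<alpha>" using F(1) by blast
    obtain C where "\<forall>f\<in>B. schwartz_seminorm k \<alpha> f \<le> C"
      using B unfolding schwartz_bounded_def by blast
    then show "\<exists>C\<ge>0. \<forall>f\<in>B. p f \<le> C"
      unfolding p by (intro exI[of _ "max C 0"]) (auto simp: le_max_iff_disj)
  qed
  then obtain c where c: "\<And>p. p \<in> F \<Longrightarrow> c p \<ge> 0 \<and> (\<forall>f\<in>B. p f \<le> c p)"
    by metis
  define S where "S = (\<Sum>p\<in>F. c p) + 1"
  have S: "S > 0" "\<And>p. p \<in> F \<Longrightarrow> c p < S"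
  proof -
    show "S > 0" unfolding S_def using sum_nonneg[of F c] c by (simp add: add_nonneg_pos)
    show "c p < S" if "p \<in> F" for p
      using member_le_sum[OF that, of c] c F(2) by (simp add: S_def)
  qed
  define t where "t = \<delta> / S"
  have t: "t > 0" using F S by (simp add: t_def)
  have "cmod (u f) \<le> 1 / t" if f: "f \<in> B" for f
  proof -
    have fS: "f \<in> schwartz" using f B by (auto simp: schwartz_bounded_def)
    have "p (\<lambda>z. complex_of_real t * f z - 0) < \<delta>" if p: "p \<in> F" for p
    proof -
      obtain k \<alpha> where pe: "p = schwartz_seminorm k \<alpha>" using F(1) p by blast
      have "p (\<lambda>z. complex_of_real t * f z) \<le> t * p f"
        using schwartz_cmult(2)[OF fS, of k \<alpha> "complex_of_real t"] t by (simp add: pe)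
      also have "\<dots> \<le> t * c p"
        using c[OF p] f t by (intro mult_left_mono) auto
      also have "\<dots> < t * S" using S(2)[OF p] t by simp
      also have "\<dots> = \<delta>" using S by (simp add: t_def)
      finally show ?thesis by simp
    qed
    then have "cmod (u (\<lambda>x. complex_of_real t * f x)) < 1"
      using small schwartz_cmult(1)[OF fS, of "complex_of_real t"] by auto
    then show ?thesis
      using t by (simp add: hom[OF fS] norm_mult field_simps)
  qed
  then show ?thesis by blast
qed

text \<open>The common form of the seminorms of both topologies on the tempered distributions.\<close>

definition sup_on :: "(real^'d::finite \<Rightarrow> complex) set \<Rightarrow> ((real^'d \<Rightarrow> complex) \<Rightarrow> complex) \<Rightarrow> real" where
  "sup_on B u = (SUP f\<in>B. cmod (u f))"

text \<open>The weak topology arises from the singletons, the strong one from all nonempty bounded sets.  The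
arguments below use only that the sets are bounded and nonempty and that the singletons are among them.\<close>

lemma tempered_topology_cases:
  assumes "T = tempered_weak_topology \<or> T = tempered_strong_topology"
  obtains BB where "T = seminorm_topology tempered (sup_on ` BB)"
    "\<And>B. B \<in> BB \<Longrightarrow> schwartz_bounded B \<and> B \<noteq> {}" "\<And>f. f \<in> schwartz \<Longrightarrow> {f} \<in> BB"
proof -
  have single: "schwartz_bounded {f}" if "f \<in> schwartz" for f :: "real^'d \<Rightarrow> complex"
    using that by (auto simp: schwartz_bounded_def)
  from assms show thesis
  proof
    assume T: "T = tempered_weak_topology"
    have "{\<lambda>u. cmod (u f) | f. f \<in> schwartz} = sup_on ` ((\<lambda>f. {f}) ` schwartz)"
      by (auto simp: sup_on_def[abs_def] image_image)
    then show thesis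
      using single by (intro that[of "(\<lambda>f. {f}) ` schwartz"]) (auto simp: T tempered_weak_topology_def)
  next
    assume T: "T = tempered_strong_topology"
    have "{\<lambda>u. (SUP f\<in>B. cmod (u f)) | B. schwartz_bounded B \<and> B \<noteq> {}} =
        sup_on ` {B. schwartz_bounded B \<and> B \<noteq> {}}"
      by (auto simp: sup_on_def[abs_def])
    then show thesis
      using single by (intro that[of "{B. schwartz_bounded B \<and> B \<noteq> {}}"])
        (auto simp: T tempered_strong_topology_def)
  qed
qed

lemma sup_on_upper:
  assumes B: "schwartz_bounded B" and "u \<in> tempered" "v \<in> tempered" and f: "f \<in> B"
  shows "cmod (u f - v f) \<le> sup_on B (\<lambda>f. u f - v f)"
proof -
  obtain C D where "\<forall>f\<in>B. cmod (u f) \<le> C" "\<forall>f\<in>B. cmod (v f) \<le> D"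
    using tempered_bounded_on_bounded[OF _ B] assms(2,3) by metis
  then have "\<forall>f\<in>B. cmod (u f - v f) \<le> C + D"
    by (meson add_mono norm_triangle_ineq4 order_trans)
  then have "bdd_above ((\<lambda>f. cmod (u f - v f)) ` B)" by (auto simp: bdd_above_def)
  then show ?thesis unfolding sup_on_def using f by (rule cSUP_upper[rotated])
qed

lemma sup_on_triangle:
  assumes B: "schwartz_bounded B" "B \<noteq> {}" and t: "u \<in> tempered" "v \<in> tempered" "w \<in> tempered"
  shows "sup_on B (\<lambda>f. w f - u f) \<le> sup_on B (\<lambda>f. w f - v f) + sup_on B (\<lambda>f. v f - u f)"
  unfolding sup_on_def[of B "\<lambda>f. w f - u f"]
proof (rule cSUP_least[OF B(2)])
  fix f assume f: "f \<in> B"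
  have "cmod (w f - u f) \<le> cmod (w f - v f) + cmod (v f - u f)"
    using norm_triangle_ineq[of "w f - v f" "v f - u f"] by simp
  then show "cmod (w f - u f) \<le> sup_on B (\<lambda>f. w f - v f) + sup_on B (\<lambda>f. v f - u f)"
    using sup_on_upper[OF B(1) t(3,2) f] sup_on_upper[OF B(1) t(2,1) f] by linarith
qed

section \<open>The topology of the symbol spaces\<close>

lemma SG_topology_zero:
  "\<forall>p\<in>{SG_seminorm m \<mu> \<alpha> \<beta> | \<alpha> \<beta>. True}. p (\<lambda>z :: (real^'d::finite) \<times> (real^'s::finite). 0) \<le> 0"
  using symbol_bound_imp_seminorm_le[OF symbol_bound_zero[OF order_refl]] by auto

lemma SG_seminorm_add:
  assumes a: "a \<in> SG m \<mu>" and b: "b \<in> SG m \<mu>"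
  shows "SG_seminorm m \<mu> \<alpha> \<beta> (\<lambda>z. a z + b z) \<le> SG_seminorm m \<mu> \<alpha> \<beta> a + SG_seminorm m \<mu> \<alpha> \<beta> b"
  unfolding SG_seminorm_eq[of m \<mu> \<alpha> \<beta> "\<lambda>z. a z + b z"]
proof (intro cSUP_least)
  fix p assume p: "p \<in> {..\<alpha>} \<times> {..\<beta>}"
  have "scaled_deriv m \<mu> (\<lambda>z. a z + b z) (fst p) (snd p) z \<le>
      SG_seminorm m \<mu> \<alpha> \<beta> a + SG_seminorm m \<mu> \<alpha> \<beta> b" for z
  proof -
    have "scaled_deriv m \<mu> (\<lambda>z. a z + b z) (fst p) (snd p) z \<le>
        scaled_deriv m \<mu> a (fst p) (snd p) z + scaled_deriv m \<mu> b (fst p) (snd p) z"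
      unfolding scaled_deriv_def deriv_x_xi_eq_iter
        iter_partial_add[OF SG_smooth[OF a] SG_smooth[OF b]] distrib_right[symmetric]
      by (intro mult_right_mono norm_triangle_ineq less_imp_le[OF weight_pos])
    then show ?thesis
      using scaled_deriv_le_seminorm[OF a, of "fst p" \<alpha> "snd p" \<beta> z] p
        scaled_deriv_le_seminorm[OF b, of "fst p" \<alpha> "snd p" \<beta> z] by auto
  qed
  then show "(case p of (\<gamma>, \<delta>) \<Rightarrow> SUP z. scaled_deriv m \<mu> (\<lambda>z. a z + b z) \<gamma> \<delta> z) \<le>
      SG_seminorm m \<mu> \<alpha> \<beta> a + SG_seminorm m \<mu> \<alpha> \<beta> b"
    by (auto simp: case_prod_unfold intro!: cSUP_least)
qed auto

lemma SG_topology_triangle: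
  assumes "p \<in> {SG_seminorm m \<mu> \<alpha> \<beta> | \<alpha> \<beta>. True}" "f \<in> SG m \<mu>" "g \<in> SG m \<mu>" "h \<in> SG m \<mu>"
  shows "p (\<lambda>z. h z - f z) \<le> p (\<lambda>z. h z - g z) + p (\<lambda>z. g z - f z)"
  using SG_seminorm_add[OF SG_diff[OF assms(4,3)] SG_diff[OF assms(3,2)]] assms(1) by auto

text \<open>Rapidly decreasing symbols are dense, at the price of a topology of slightly higher order.\<close>

lemma regularised_symbol_limit:
  assumes a: "a \<in> SG m \<mu>"
  shows "limitin (SG_topology (m + 2) (\<mu> + 2))
    (\<lambda>j z. regulariser (inverse (real (Suc j))) z * a z) a sequentially"
  unfolding limitin_def
proof (intro conjI allI impI)
  have a': "a \<in> SG (m + 2) (\<mu> + 2)" by (rule SG_mono[OF a]) auto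
  then show "a \<in> topspace (SG_topology (m + 2) (\<mu> + 2))"
    by (simp add: SG_topology_def topspace_seminorm_topology)
  fix U assume U: "openin (SG_topology (m + 2) (\<mu> + 2)) U \<and> a \<in> U"
  let ?aj = "\<lambda>j z. regulariser (inverse (real (Suc j))) z * a z"
  obtain F \<delta> where F: "F \<subseteq> {SG_seminorm (m + 2) (\<mu> + 2) \<alpha> \<beta> | \<alpha> \<beta>. True}" "finite F" "\<delta> > 0"
    and ball: "\<forall>g\<in>SG (m + 2) (\<mu> + 2). (\<forall>p\<in>F. p (\<lambda>z. g z - a z) < \<delta>) \<longrightarrow> g \<in> U"
    using openin_seminorm_topology_imp_nhd[OF SG_topology_triangle
        U[THEN conjunct1, unfolded SG_topology_def] U[THEN conjunct2]] by (rule seminorm_nhdE)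
  have "\<forall>\<^sub>F j in sequentially. p (\<lambda>z. ?aj j z - a z) < \<delta>" if p: "p \<in> F" for p
  proof -
    obtain \<alpha> \<beta> where pe: "p = SG_seminorm (m + 2) (\<mu> + 2) \<alpha> \<beta>" using F(1) p by blast
    obtain C where C: "\<And>\<epsilon>. 0 < \<epsilon> \<and> \<epsilon> \<le> 1 \<Longrightarrow> symbol_bound (mi_size \<alpha> + mi_size \<beta>) (m + 2) (\<mu> + 2)
        (C * \<epsilon>) (\<lambda>z. regulariser \<epsilon> z * a z - a z)"
      using regularised_symbol_approx[OF a] by blast
    have le: "p (\<lambda>z. ?aj j z - a z) \<le> C * inverse (real (Suc j))" for j
      unfolding pe by (intro symbol_bound_imp_seminorm_le C) (auto simp: inverse_le_1_iff)
    have "(\<lambda>j. C * inverse (real (Suc j))) \<longlonglongrightarrow> C * 0"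
      by (intro tendsto_intros LIMSEQ_inverse_real_of_nat)
    then have "\<forall>\<^sub>F j in sequentially. C * inverse (real (Suc j)) < \<delta>"
      using F(3) by (auto intro: order_tendstoD(2))
    then show ?thesis by eventually_elim (rule le_less_trans[OF le])
  qed
  then have "\<forall>\<^sub>F j in sequentially. \<forall>p\<in>F. p (\<lambda>z. ?aj j z - a z) < \<delta>"
    using F(2) by (simp add: eventually_ball_finite_distrib)
  then show "\<forall>\<^sub>F j in sequentially. ?aj j \<in> U"
  proof eventually_elim
    case (elim j)
    have "?aj j \<in> SG_minf"
      by (rule regularised_symbol[OF a]) (auto simp: inverse_le_1_iff)
    then show ?case using elim ball by (auto simp: SG_minf_iff)
  qed
qed

section \<open>The oscillatory integral as a family of tempered distributions\<close>

lemma SG_pinf_iff: "a \<in> SG_pinf \<longleftrightarrow> (\<exists>m \<mu>. a \<in> SG m \<mu>)"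
  by (auto simp: SG_pinf_def)

lemma SG_pinf_common:
  assumes "a \<in> SG_pinf" "b \<in> SG_pinf"
  obtains m \<mu> where "a \<in> SG m \<mu>" "b \<in> SG m \<mu>"
proof -
  obtain m \<mu> m' \<mu>' where "a \<in> SG m \<mu>" "b \<in> SG m' \<mu>'"
    using assms by (auto simp: SG_pinf_iff)
  then show thesis
    by (intro that[of "max m m'" "max \<mu> \<mu>'"]) (auto elim: SG_mono)
qed

context sg_phase
begin

definition osc_distribution ::
  "((real^'d) \<times> (real^'s) \<Rightarrow> complex) \<Rightarrow> (real^'d \<Rightarrow> complex) \<Rightarrow> complex" where
  "osc_distribution = restrict (\<lambda>a. restrict (\<lambda>f. osc_functional (\<lambda>z. a z * f (fst z))) schwartz) SG_pinf"

lemma osc_distribution_eq: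
  "a \<in> SG m \<mu> \<Longrightarrow> f \<in> schwartz \<Longrightarrow> osc_distribution a f = osc_functional (\<lambda>z. a z * f (fst z))"
  by (auto simp: osc_distribution_def SG_pinf_iff)

lemma osc_distribution_add:
  assumes "a \<in> SG m \<mu>" "b \<in> SG m \<mu>" "f \<in> schwartz"
  shows "osc_distribution (\<lambda>z. a z + b z) f = osc_distribution a f + osc_distribution b f"
  using osc_functional_add[OF SG_times_schwartz SG_times_schwartz, OF assms(1,3,2,3)] assms SG_add[OF assms(1,2)]
  by (simp add: osc_distribution_eq distrib_right)

lemma osc_distribution_cmult:
  assumes "a \<in> SG m \<mu>" "f \<in> schwartz"
  shows "osc_distribution (\<lambda>z. c * a z) f = c * osc_distribution a f"
  using osc_functional_cmult[OF SG_times_schwartz[OF assms], of c] SG_cmult[OF assms(1), of c] assms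
  by (simp add: osc_distribution_eq mult.assoc)

lemma osc_distribution_diff:
  assumes "a \<in> SG m \<mu>" "b \<in> SG m \<mu>" "f \<in> schwartz"
  shows "osc_distribution (\<lambda>z. b z - a z) f = osc_distribution b f - osc_distribution a f"
  using osc_distribution_add[OF assms(2) SG_cmult[OF assms(1), of "- 1"] assms(3)]
    osc_distribution_cmult[OF assms(1,3), of "- 1"] by simp

lemma osc_distribution_add_right:
  assumes "a \<in> SG m \<mu>" "f \<in> schwartz" "g \<in> schwartz"
  shows "osc_distribution a (\<lambda>x. f x + g x) = osc_distribution a f + osc_distribution a g"
  using osc_functional_add[OF SG_times_schwartz[OF assms(1,2)] SG_times_schwartz[OF assms(1,3)]] assms
  by (simp add: osc_distribution_eq[OF assms(1)] schwartz_add distrib_left)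

lemma osc_distribution_cmult_right:
  assumes "a \<in> SG m \<mu>" "f \<in> schwartz"
  shows "osc_distribution a (\<lambda>x. c * f x) = c * osc_distribution a f"
  using osc_functional_cmult[OF SG_times_schwartz[OF assms], of c] assms
  by (simp add: osc_distribution_eq[OF assms(1)] schwartz_cmult mult.left_commute)

text \<open>One product bound serves temperedness, which fixes \<open>a\<close>, and continuity in the symbol, which is
uniform for \<open>f\<close> in a bounded set.  It holds because \<open>a(x, \<xi>) f(x)\<close> is again a symbol of order \<open>(m, \<mu>)\<close>.\<close>

lemma osc_distribution_bound:
  "\<exists>k C. C \<ge> 0 \<and> (\<forall>a\<in>SG m \<mu>. \<forall>f\<in>schwartz.
    cmod (osc_distribution a f) \<le> C * SG_seminorm m \<mu> (\<lambda>_. k) (\<lambda>_. k) a * schwartz_norm k f)"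
proof -
  obtain k K where K: "K \<ge> 0"
    and bound: "\<And>b C. b \<in> SG m \<mu> \<Longrightarrow> symbol_bound k m \<mu> C b \<Longrightarrow> cmod (osc_functional b) \<le> K * C"
    using osc_functional_bound[of m \<mu>] by blast
  have "cmod (osc_distribution a f) \<le> (K * 2 ^ k) * SG_seminorm m \<mu> (\<lambda>_. k) (\<lambda>_. k) a * schwartz_norm k f"
    if a: "a \<in> SG m \<mu>" and f: "f \<in> schwartz" for a f
  proof -
    have "symbol_bound k (m + 0) (\<mu> + 0)
        (2 ^ k * (SG_seminorm m \<mu> (\<lambda>_. k) (\<lambda>_. k) a * schwartz_norm k f)) (\<lambda>z. a z * f (fst z))"
      by (intro symbol_bound_mult SG_imp_symbol_bound[OF a] schwartz_symbol_bound[OF f]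
          SG_smooth[OF a] SG_smooth[OF schwartz_SG[OF f]])
    then have "symbol_bound k m \<mu>
        (2 ^ k * (SG_seminorm m \<mu> (\<lambda>_. k) (\<lambda>_. k) a * schwartz_norm k f)) (\<lambda>z. a z * f (fst z))"
      by simp
    from bound[OF SG_times_schwartz[OF a f] this] show ?thesis
      by (simp add: osc_distribution_eq[OF a f] mult_ac)
  qed
  with K show ?thesis by (intro exI[of _ k] exI[of _ "K * 2 ^ k"]) auto
qed

lemma osc_distribution_tempered:
  assumes "a \<in> SG_pinf"
  shows "osc_distribution a \<in> tempered"
proof -
  obtain m \<mu> where a: "a \<in> SG m \<mu>" using assms by (auto simp: SG_pinf_iff)
  obtain k C where C: "C \<ge> 0" and bound: "\<And>f. f \<in> schwartz \<Longrightarrow>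
      cmod (osc_distribution a f) \<le> C * SG_seminorm m \<mu> (\<lambda>_. k) (\<lambda>_. k) a * schwartz_norm k f"
    using osc_distribution_bound[of m \<mu>] a by blast
  let ?C = "C * SG_seminorm m \<mu> (\<lambda>_. k) (\<lambda>_. k) a"
  let ?F = "schwartz_seminorm k ` {..\<lambda>_. k}"
  have C0: "?C \<ge> 0"
    using C symbol_bound_nonneg[OF SG_imp_symbol_bound[OF a, of k]] by simp
  have "continuous_map schwartz_topology euclidean (osc_distribution a)"
    unfolding schwartz_topology_def
  proof (rule continuous_map_seminorm_euclidean[where F = ?F and C = "?C * card {..\<lambda>_ :: 'd. k}"])
    fix f g :: "real^'d \<Rightarrow> complex" assume f: "f \<in> schwartz" and g: "g \<in> schwartz"
    let ?h = "\<lambda>z. g z - f z"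
    have h: "?h \<in> schwartz" by (rule schwartz_diff[OF g f])
    have "osc_distribution a g - osc_distribution a f = osc_distribution a ?h"
      using osc_distribution_add_right[OF a g schwartz_cmult(1)[OF f, of "- 1"]]
        osc_distribution_cmult_right[OF a f, of "- 1"] by simp
    then have 1: "cmod (osc_distribution a g - osc_distribution a f) \<le> ?C * schwartz_norm k ?h"
      using bound[OF h] by simp
    have 2: "schwartz_norm k ?h \<le> card {..\<lambda>_ :: 'd. k} * (\<Sum>p\<in>?F. p ?h)"
    proof -
      have "schwartz_seminorm k \<alpha> ?h \<le> (\<Sum>p\<in>?F. p ?h)" if "\<alpha> \<in> {..\<lambda>_. k}" for \<alpha>
        using member_le_sum[of "schwartz_seminorm k \<alpha>" ?F "\<lambda>p. p ?h"] that
          schwartz_seminorm_nonneg[OF h] finite_atMost_mi by auto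
      then show ?thesis
        unfolding schwartz_norm_def by (rule sum_bounded_above)
    qed
    show "cmod (osc_distribution a g - osc_distribution a f) \<le>
        ?C * card {..\<lambda>_ :: 'd. k} * (\<Sum>p\<in>?F. p ?h)"
      using order_trans[OF 1 mult_left_mono[OF 2 C0]] by (simp only: mult.assoc)
  qed (use C0 schwartz_seminorm_zero finite_atMost_mi in auto)
  moreover have "osc_distribution a \<in> extensional schwartz"
    using assms by (simp add: osc_distribution_def)
  ultimately show ?thesis
    using osc_distribution_add_right[OF a] osc_distribution_cmult_right[OF a]
    by (auto simp: tempered_def)
qed

lemma osc_distribution_continuous:
  assumes T: "T = tempered_weak_topology \<or> T = tempered_strong_topology"
  shows "continuous_map (SG_topology m \<mu>) T (restrict osc_distribution (SG m \<mu>))"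
proof -
  obtain BB where T: "T = seminorm_topology tempered (sup_on ` BB)"
    and BB: "\<And>B. B \<in> BB \<Longrightarrow> schwartz_bounded B \<and> B \<noteq> {}"
    using tempered_topology_cases[OF assms] by metis
  obtain k C where C: "C \<ge> 0" and bound: "\<And>a f. a \<in> SG m \<mu> \<Longrightarrow> f \<in> schwartz \<Longrightarrow>
      cmod (osc_distribution a f) \<le> C * SG_seminorm m \<mu> (\<lambda>_. k) (\<lambda>_. k) a * schwartz_norm k f"
    using osc_distribution_bound[of m \<mu>] by blast
  let ?I = "restrict osc_distribution (SG m \<mu>)"
  let ?p = "SG_seminorm m \<mu> (\<lambda>_ :: 'd. k) (\<lambda>_ :: 's. k)"
  show ?thesis
    unfolding T SG_topology_def
  proof (rule continuous_map_seminorm_topologies[OF SG_topology_zero])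
    show "?I a \<in> tempered" if "a \<in> SG m \<mu>" for a
      using that osc_distribution_tempered by (auto simp: SG_pinf_iff)
    show "q (\<lambda>z. w z - u z) \<le> q (\<lambda>z. w z - v z) + q (\<lambda>z. v z - u z)"
      if "q \<in> sup_on ` BB" "u \<in> tempered" "v \<in> tempered" "w \<in> tempered" for q u v w
      using that BB sup_on_triangle by blast
    fix q assume "q \<in> sup_on ` BB"
    then obtain B where q: "q = sup_on B" and B: "schwartz_bounded B" "B \<noteq> {}"
      using BB by blast
    obtain D where D: "\<And>\<alpha> f. f \<in> B \<Longrightarrow> schwartz_seminorm k \<alpha> f \<le> D \<alpha>"
      using B(1) unfolding schwartz_bounded_def by metis
    have BS: "B \<subseteq> schwartz" using B(1) by (simp add: schwartz_bounded_def)
    define S where "S = (\<Sum>\<alpha>\<in>{..\<lambda>_ :: 'd. k}. D \<alpha>)"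
    have S: "schwartz_norm k f \<le> S" if "f \<in> B" for f
      unfolding schwartz_norm_def S_def by (intro sum_mono D that)
    have S0: "S \<ge> 0"
      using S B(2) BS schwartz_norm_nonneg by (meson all_not_in_conv order_trans subsetD)
    have "q (\<lambda>f. ?I b f - ?I a f) \<le> (C * S) * ?p (\<lambda>z. b z - a z)" if ab: "a \<in> SG m \<mu>" "b \<in> SG m \<mu>" for a b
      unfolding q sup_on_def
    proof (rule cSUP_least[OF B(2)])
      fix f assume f: "f \<in> B"
      have d: "(\<lambda>z. b z - a z) \<in> SG m \<mu>" by (rule SG_diff[OF ab(2,1)])
      have p0: "?p (\<lambda>z. b z - a z) \<ge> 0"
        by (rule symbol_bound_nonneg[OF SG_imp_symbol_bound[OF d]])
      have "cmod (?I b f - ?I a f) = cmod (osc_distribution (\<lambda>z. b z - a z) f)"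
        using ab osc_distribution_diff[OF ab] f BS by auto
      also have "\<dots> \<le> C * ?p (\<lambda>z. b z - a z) * schwartz_norm k f"
        using bound[OF d] f BS by auto
      also have "\<dots> \<le> C * ?p (\<lambda>z. b z - a z) * S"
        using S[OF f] C p0 by (intro mult_left_mono) auto
      finally show "cmod (?I b f - ?I a f) \<le> (C * S) * ?p (\<lambda>z. b z - a z)"
        by (simp add: mult_ac)
    qed
    then show "\<exists>p\<in>{SG_seminorm m \<mu> \<alpha> \<beta> | \<alpha> \<beta>. True}. \<exists>C\<ge>0. \<forall>a\<in>SG m \<mu>. \<forall>b\<in>SG m \<mu>.
        q (\<lambda>z. ?I b z - ?I a z) \<le> C * p (\<lambda>z. b z - a z)"
      using C S0 by (intro bexI[of _ ?p] exI[of _ "C * S"]) auto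
  qed
qed

lemma domain_dim_phase: "domain_dim \<phi> = CARD('d) + CARD('s)"
  by (simp add: domain_dim_def)

lemma fibre_integrable:
  assumes a: "a \<in> SG_minf"
  shows "integrable lborel (\<lambda>\<xi>. osc (x, \<xi>) * a (x, \<xi>))"
proof -
  have "a \<in> SG 0 decay" using a by (simp add: SG_minf_iff)
  then obtain C where C: "symbol_bound 0 0 decay C a" unfolding SG_iff by blast
  have cont: "continuous_on UNIV (\<lambda>z. osc z * a z)"
    by (intro smooth_continuous smooth_mult smooth_osc SG_minf_smooth a)
  have meas: "(\<lambda>\<xi>. osc (x, \<xi>) * a (x, \<xi>)) \<in> borel_measurable borel"
    by (intro borel_measurable_continuous_onI continuous_on_compose2[OF cont] continuous_intros) auto
  have "integrable lborel (\<lambda>\<xi>::real^'s. C * jap \<xi> powr decay)"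
    by (intro integrable_mult_right integrable_jap_powr) (simp add: domain_dim_phase)
  then show ?thesis
  proof (rule Bochner_Integration.integrable_bound)
    show "AE \<xi> in lborel. norm (osc (x, \<xi>) * a (x, \<xi>)) \<le> norm (C * jap \<xi> powr decay)"
      using C jap_pos[of x] by (intro AE_I2) (auto simp: norm_mult norm_osc weight_def intro: order_trans)
  qed (simp add: meas)
qed

text \<open>Fubini's theorem for the rapidly decreasing function \<open>a(x, \<xi>) f(x)\<close>.\<close>

lemma osc_distribution_minf:
  assumes a: "a \<in> SG_minf" and f: "f \<in> schwartz"
  shows "integrable lborel (\<lambda>x. (LINT \<xi>|lborel. osc (x, \<xi>) * a (x, \<xi>)) * f x)"
    and "osc_distribution a f = (LINT x|lborel. (LINT \<xi>|lborel. osc (x, \<xi>) * a (x, \<xi>)) * f x)"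
proof -
  let ?g = "\<lambda>z. osc z * (a z * f (fst z))"
  have af: "(\<lambda>z. a z * f (fst z)) \<in> SG_minf"
    using a f by (auto simp: SG_minf_iff intro: SG_times_schwartz)
  have int: "integrable (lborel \<Otimes>\<^sub>M lborel) ?g"
    using osc_integrable_minf[OF af] by (simp add: lborel_prod)
  have inner: "(LINT \<xi>|lborel. ?g (x, \<xi>)) = (LINT \<xi>|lborel. osc (x, \<xi>) * a (x, \<xi>)) * f x" for x
    by (simp add: mult.assoc[symmetric])
  show "integrable lborel (\<lambda>x. (LINT \<xi>|lborel. osc (x, \<xi>) * a (x, \<xi>)) * f x)"
    using lborel_pair.integrable_fst'[OF int] by (simp only: inner)
  have "osc_distribution a f = (LINT z|lborel. ?g z)"
    using osc_functional_minf[OF af] osc_distribution_eq[OF _ f] a by (metis SG_minf_iff)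
  also have "\<dots> = (LINT x|lborel. (LINT \<xi>|lborel. ?g (x, \<xi>)))"
    using lborel_pair.integral_fst'[OF int] by (simp add: lborel_prod)
  finally show "osc_distribution a f = (LINT x|lborel. (LINT \<xi>|lborel. osc (x, \<xi>) * a (x, \<xi>)) * f x)"
    by (simp only: inner)
qed

end

text \<open>The value at \<open>f\<close> is controlled by the seminorm of the singleton of \<open>f\<close>, present in both topologies.\<close>

lemma limitin_tempered_imp_pointwise:
  assumes T: "T = tempered_weak_topology \<or> T = tempered_strong_topology"
    and lim: "limitin T u v sequentially" and f: "f \<in> schwartz"
  shows "(\<lambda>j. u j f) \<longlonglongrightarrow> v f"
proof (rule tendstoI)
  fix \<epsilon> :: real assume \<epsilon>: "\<epsilon> > 0"
  obtain BB where T': "T = seminorm_topology tempered (sup_on ` BB)" and B: "{f} \<in> BB"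
    using tempered_topology_cases[OF T] f by metis
  have v: "v \<in> tempered"
    using lim by (simp add: limitin_def T' topspace_seminorm_topology)
  let ?U = "{w \<in> tempered. sup_on {f} (\<lambda>f. w f - v f) < \<epsilon>}"
  have "openin T ?U"
    unfolding T' seminorm_topology_def using B v \<epsilon> by (intro topology_generated_by_Basis) blast
  moreover have "v \<in> ?U" using v \<epsilon> by (simp add: sup_on_def)
  ultimately have "\<forall>\<^sub>F j in sequentially. u j \<in> ?U"
    using lim unfolding limitin_def by blast
  then show "\<forall>\<^sub>F j in sequentially. dist (u j f) (v f) < \<epsilon>"
    by eventually_elim (simp add: sup_on_def dist_norm)
qed

text \<open>
A symbol of order \<open>(m, \<mu>)\<close> is the limit of its regularisations in the topology of order
\<open>(m + 2, \<mu> + 2)\<close>, on which both maps are continuous; hence their values on rapidly decreasing symbols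
determine them.
\<close>

lemma continuous_extension_unique:
  fixes I I' :: "((real^'d::finite) \<times> (real^'s::finite) \<Rightarrow> complex) \<Rightarrow> (real^'d \<Rightarrow> complex) \<Rightarrow> complex"
  assumes T: "T = tempered_weak_topology \<or> T = tempered_strong_topology"
    and I: "\<And>m \<mu>. continuous_map (SG_topology m \<mu>) T (restrict I (SG m \<mu>))"
    and I': "\<And>m \<mu>. continuous_map (SG_topology m \<mu>) T (restrict I' (SG m \<mu>))"
    and eq: "\<And>a f. a \<in> SG_minf \<Longrightarrow> f \<in> schwartz \<Longrightarrow> I a f = I' a f"
    and a: "a \<in> SG m \<mu>" and f: "f \<in> schwartz"
  shows "I a f = I' a f"
proof -
  let ?aj = "\<lambda>j z. regulariser (inverse (real (Suc j))) z * a z"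
  have aj: "?aj j \<in> SG_minf" for j
    by (rule regularised_symbol[OF a]) (auto simp: inverse_le_1_iff)
  then have aj': "?aj j \<in> SG (m + 2) (\<mu> + 2)" for j
    by (simp add: SG_minf_iff)
  have a': "a \<in> SG (m + 2) (\<mu> + 2)" by (rule SG_mono[OF a]) auto
  have lim: "(\<lambda>j. H (?aj j) f) \<longlonglongrightarrow> H a f"
    if H: "continuous_map (SG_topology (m + 2) (\<mu> + 2)) T (restrict H (SG (m + 2) (\<mu> + 2)))" for H
    using limitin_tempered_imp_pointwise[OF T continuous_map_limit[OF H regularised_symbol_limit[OF a]] f]
      aj' a' by (simp add: comp_def)
  have "(\<lambda>j. I (?aj j) f) \<longlonglongrightarrow> I' a f"
    using lim[OF I'] by (simp only: eq[OF aj f])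
  with lim[OF I] show ?thesis by (rule LIMSEQ_unique)
qed

theorem theorem2p7:
  fixes \<phi> :: "(real^'d::finite) \<times> (real^'s::finite) \<Rightarrow> real"
    and n \<nu> :: real
    and T :: "((real^'d \<Rightarrow> complex) \<Rightarrow> complex) topology"
  assumes "admissible_phase n \<nu> \<phi>"
    and "T = tempered_weak_topology \<or> T = tempered_strong_topology"
  shows "\<exists>!I. I \<in> (SG_pinf :: ((real^'d) \<times> (real^'s) \<Rightarrow> complex) set) \<rightarrow>\<^sub>E tempered \<and>
     (\<forall>a\<in>SG_pinf. \<forall>b\<in>SG_pinf. \<forall>f\<in>schwartz. I (\<lambda>z. a z + b z) f = I a f + I b f) \<and>
     (\<forall>c. \<forall>a\<in>SG_pinf. \<forall>f\<in>schwartz. I (\<lambda>z. c * a z) f = c * I a f) \<and>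
     (\<forall>a\<in>SG_minf.
        (\<forall>x. integrable lborel (\<lambda>\<xi>. exp (\<i> * complex_of_real (\<phi> (x, \<xi>))) * a (x, \<xi>))) \<and>
        (\<forall>f\<in>schwartz.
           integrable lborel
             (\<lambda>x. (LINT \<xi>|lborel. exp (\<i> * complex_of_real (\<phi> (x, \<xi>))) * a (x, \<xi>)) * f x) \<and>
           I a f =
             (LINT x|lborel. (LINT \<xi>|lborel. exp (\<i> * complex_of_real (\<phi> (x, \<xi>))) * a (x, \<xi>)) * f x))) \<and>
     (\<forall>m \<mu>. continuous_map (SG_topology m \<mu>) T (restrict I (SG m \<mu>)))"
    (is "\<exists>!I. ?P I")
proof -
  interpret sg_phase \<phi> n \<nu> by standard (rule assms(1))
  have osc: "exp (\<i> * complex_of_real (\<phi> z)) = osc z" for z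
    by (simp add: osc_def \<Phi>_def)
  show ?thesis
  proof (rule ex1I)
    show "?P osc_distribution"
      unfolding osc
    proof (intro conjI ballI allI)
      show "osc_distribution \<in> SG_pinf \<rightarrow>\<^sub>E tempered"
        using osc_distribution_tempered by (auto simp: osc_distribution_def)
      show "osc_distribution (\<lambda>z. a z + b z) f = osc_distribution a f + osc_distribution b f"
        if "a \<in> SG_pinf" "b \<in> SG_pinf" "f \<in> schwartz" for a b f
        using SG_pinf_common[OF that(1,2)] osc_distribution_add that(3) by metis
      show "osc_distribution (\<lambda>z. c * a z) f = c * osc_distribution a f"
        if "a \<in> SG_pinf" "f \<in> schwartz" for c a f
        using that osc_distribution_cmult by (auto simp: SG_pinf_iff)
    qed (auto simp: fibre_integrable osc_distribution_minf osc_distribution_continuous[OF assms(2)])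
  next
    fix I assume I: "?P I"
    have eq: "I a f = osc_distribution a f" if "a \<in> SG m \<mu>" "f \<in> schwartz" for a f m \<mu>
    proof (rule continuous_extension_unique[OF assms(2) _ _ _ that])
      show "continuous_map (SG_topology m \<mu>) T (restrict I (SG m \<mu>))" for m \<mu>
        using I by blast
      show "continuous_map (SG_topology m \<mu>) T (restrict osc_distribution (SG m \<mu>))" for m \<mu>
        by (rule osc_distribution_continuous[OF assms(2)])
      show "I a f = osc_distribution a f" if "a \<in> SG_minf" "f \<in> schwartz" for a f
        using I that unfolding osc by (simp add: osc_distribution_minf)
    qed
    show "I = osc_distribution"
    proof (rule extensionalityI[of _ SG_pinf])
      show "I \<in> extensional SG_pinf" using I by (auto simp: PiE_def)
      show "osc_distribution \<in> extensional SG_pinf" by (simp add: osc_distribution_def)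
      fix a :: "(real^'d) \<times> (real^'s) \<Rightarrow> complex" assume a: "a \<in> SG_pinf"
      then obtain m \<mu> where am: "a \<in> SG m \<mu>" by (auto simp: SG_pinf_iff)
      have ext: "I a \<in> extensional schwartz" "osc_distribution a \<in> extensional schwartz"
        using I osc_distribution_tempered[OF a] a by (auto simp: tempered_def)
      show "I a = osc_distribution a"
        by (rule extensionalityI[OF ext eq[OF am]])
    qed
  qed
qed

end
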